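(* Every $4$-edge-connected graph is rigid in every non-Euclidean normed plane.
   Context: A connected graph is $k$-edge-connected if it remains connected after the removal of any $k-1$ edges. A normed plane is a 2-dimensional real normed space $(X,\|\cdot\|)$; it is Euclidean if its norm is induced by an inner product and non-Euclidean otherwise. A support functional of $x\in X$ is an $f\in X^*$ with $\|f\|=\|x\|$ and $f(x)=\|x\|^2$. A nonzero $x\in X$ is smooth if it has exactly one support functional, denoted $\varphi(x)$. Graphs are finite and simple. A framework in $X$ is a pair $(G,p)$ with $p=(p_v)_{v\in V(G)}\in X^{V(G)}$ (a placement of $G$). It is well-positioned if $p_v-p_w$ is smooth for every edge $vw$; then put $\varphi_{v,w}:=\varphi\big((p_v-p_w)/\|p_v-p_w\|\big)$ and define the rigidity operator $df_G(p):X^{V(G)}\to\mathbb{R}^{E(G)}$, $u\mapsto(\varphi_{v,w}(u_v-u_w))_{vw\in E(G)}$. An infinitesimal flex of a well-positioned $(G,p)$ is an element of $\ker df_G(p)$; it is trivial if there is a $C^1$ curve $\gamma$ in the isometry group of $X$ (all isometries of $X$ are affine) with $\gamma(0)=\mathrm{id}$ and $u_v=\frac{d}{dt}\gamma(t)(p_v)|_{t=0}$ for all $v$ (in a non-Euclidean normed plane the trivial flexes are exactly the constant families $u_v=a$, $a\in X$). A well-positioned $(G,p)$ is infinitesimally rigid if every infinitesimal flex is trivial. A graph $G$ is rigid in $X$ if some placement $p$ makes $(G,p)$ infinitesimally rigid. *)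

theory Defs
  imports "HOL-Analysis.Analysis"
begin

definition normed_plane :: "'a::real_normed_vector itself \<Rightarrow> bool" where
  "normed_plane _ \<longleftrightarrow> dim (UNIV :: 'a set) = 2"

definition euclidean_norm :: "'a::real_normed_vector itself \<Rightarrow> bool" where
  "euclidean_norm _ \<longleftrightarrow>
     (\<exists>B :: 'a \<Rightarrow> 'a \<Rightarrow> real.
        (\<forall>x. linear (B x)) \<and> (\<forall>y. linear (\<lambda>x. B x y)) \<and>
        (\<forall>x y. B x y = B y x) \<and> (\<forall>x. x \<noteq> 0 \<longrightarrow> B x x > 0) \<and>
        (\<forall>x. norm x = sqrt (B x x)))"

definition support_functional :: "'a::real_normed_vector \<Rightarrow> ('a \<Rightarrow> real) \<Rightarrow> bool" where
  "support_functional x f \<longleftrightarrow>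
     bounded_linear f \<and> onorm f = norm x \<and> f x = (norm x)\<^sup>2"

definition smooth_point :: "'a::real_normed_vector \<Rightarrow> bool" where
  "smooth_point x \<longleftrightarrow> x \<noteq> 0 \<and> (\<exists>!f. support_functional x f)"

definition supp_fun :: "'a::real_normed_vector \<Rightarrow> ('a \<Rightarrow> real)" where
  "supp_fun x = (THE f. support_functional x f)"

definition simple_graph :: "'v set \<Rightarrow> 'v set set \<Rightarrow> bool" where
  "simple_graph V E \<longleftrightarrow> finite V \<and>
     (\<forall>e\<in>E. \<exists>x y. e = {x, y} \<and> x \<noteq> y \<and> x \<in> V \<and> y \<in> V)"

definition graph_connected :: "'v set \<Rightarrow> 'v set set \<Rightarrow> bool" where
  "graph_connected V E \<longleftrightarrow> V \<noteq> {} \<and>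
     (\<forall>x\<in>V. \<forall>y\<in>V. (\<lambda>a b. {a, b} \<in> E)\<^sup>*\<^sup>* x y)"

definition k_edge_connected :: "nat \<Rightarrow> 'v set \<Rightarrow> 'v set set \<Rightarrow> bool" where
  "k_edge_connected k V E \<longleftrightarrow>
     (\<forall>F. F \<subseteq> E \<longrightarrow> card F < k \<longrightarrow> graph_connected V (E - F))"

definition well_positioned :: "'v set set \<Rightarrow> ('v \<Rightarrow> 'a::real_normed_vector) \<Rightarrow> bool" where
  "well_positioned E p \<longleftrightarrow> (\<forall>v w. {v, w} \<in> E \<longrightarrow> smooth_point (p v - p w))"

text \<open>u lies in the kernel of the rigidity operator df_G(p).\<close>
definition inf_flex :: "'v set set \<Rightarrow> ('v \<Rightarrow> 'a::real_normed_vector) \<Rightarrow> ('v \<Rightarrow> 'a) \<Rightarrow> bool" where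
  "inf_flex E p u \<longleftrightarrow>
     (\<forall>v w. {v, w} \<in> E \<longrightarrow>
        supp_fun ((1 / norm (p v - p w)) *\<^sub>R (p v - p w)) (u v - u w) = 0)"

definition is_isometry :: "('a::real_normed_vector \<Rightarrow> 'a) \<Rightarrow> bool" where
  "is_isometry g \<longleftrightarrow> surj g \<and> (\<forall>x y. norm (g x - g y) = norm (x - y))"

text \<open>Trivial flex: derivative at 0 of a C^1 curve of isometries through the
identity. Isometries are affine, so C^1 in the isometry group amounts to
t \<mapsto> gamma t x being C^1 for every x.\<close>
definition trivial_flex :: "'v set \<Rightarrow> ('v \<Rightarrow> 'a::real_normed_vector) \<Rightarrow> ('v \<Rightarrow> 'a) \<Rightarrow> bool" where
  "trivial_flex V p u \<longleftrightarrow>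
     (\<exists>(\<gamma> :: real \<Rightarrow> 'a \<Rightarrow> 'a) \<epsilon>. \<epsilon> > 0 \<and>
        (\<forall>t\<in>{-\<epsilon><..<\<epsilon>}. is_isometry (\<gamma> t)) \<and> \<gamma> 0 = id \<and>
        (\<forall>x. (\<lambda>t. \<gamma> t x) C1_differentiable_on {-\<epsilon><..<\<epsilon>}) \<and>
        (\<forall>v\<in>V. u v = vector_derivative (\<lambda>t. \<gamma> t (p v)) (at 0)))"

definition inf_rigid :: "'v set \<Rightarrow> 'v set set \<Rightarrow> ('v \<Rightarrow> 'a::real_normed_vector) \<Rightarrow> bool" where
  "inf_rigid V E p \<longleftrightarrow> well_positioned E p \<and>
     (\<forall>u. inf_flex E p u \<longrightarrow> trivial_flex V p u)"

definition rigid_in :: "'a::real_normed_vector itself \<Rightarrow> 'v set \<Rightarrow> 'v set set \<Rightarrow> bool" where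
  "rigid_in _ V E \<longleftrightarrow> (\<exists>p :: 'v \<Rightarrow> 'a. inf_rigid V E p)"

end

(* A maximal (2,2)-sparse subgraph of a 4-edge-connected graph is (2,2)-tight: its maximal tight
   vertex sets partition V, all edges between them are kept, and with k > 1 parts there would be at
   least 2k such edges, too many for sparsity.

   A (2,2)-tight graph is rigid by induction. A proper tight subgraph with at least two vertices,
   taken maximal, is either contracted to a vertex (a shrunken copy of it replaces that vertex in a
   framework of the quotient) or misses only one vertex, of degree two. Without such a subgraph some
   vertex has degree three and a 1-reduction applies, unless the graph is K4.

   For K4 take a parallelogram 0, x, x + y, y. It is flexible iff the map sending a direction z to
   the kernel direction of the norming functional of z respects the harmonic quadruple x, y, x + y,
   x - y. If this holds for all parallelograms, then, as in von Staudt's theorem, the map is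
   projective: along a line e + t y it is an affine function of t in suitable coordinates. This is a
   differential equation for the norm on the line, whose solutions with the right behaviour at both
   ends of the line are the Euclidean ones. *)

theory Submission
  imports Defs
begin

text \<open>There are no generic placements to rely on: the norm need be neither analytic nor
  everywhere differentiable nor strictly convex. Their place is taken by two facts. On suitable
  lines only countably many points fail to be smooth, and rigidity is an open condition on the
  functionals assigned to the edges. In the limit these functionals need not come from a placement:
  an edge or a whole subgraph may collapse to a point while its functionals survive. This is what
  makes it possible to insert a vertex or a subgraph. The sparsity count is the number 2 |V| of
  unknowns minus the two dimensions of translations. The case of a missing vertex of degree two is
  the obstruction to contraction: a vertex with two edges into the subgraph would produce parallel
  edges. The behaviour at the ends of the line comes from the choice of y smooth and e in the kernel
  of its functional. The norm of e + t y then lies between C |t| and C |t| plus a constant, with the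
  same C, the norm of y, at both ends. The non-Euclidean solutions of the differential equation
  would need different growth rates at the two ends.\<close>

subsection \<open>Linear algebra in the plane\<close>

text \<open>Stated with coefficients because the set \<open>{x, z}\<close> shrinks to a singleton
  for \<open>x = z\<close>, and \<open>independent\<close> would then accept a repeated nonzero
  vector.\<close>

definition indep2 :: "'a::real_vector \<Rightarrow> 'a \<Rightarrow> bool" where
  "indep2 x z \<longleftrightarrow> (\<forall>a b. a *\<^sub>R x + b *\<^sub>R z = 0 \<longrightarrow> a = 0 \<and> b = 0)"

lemma indep2_nonzero:
  assumes "indep2 x z" shows "x \<noteq> 0" "z \<noteq> 0"
proof -
  have "1 *\<^sub>R x + 0 *\<^sub>R z \<noteq> 0" "0 *\<^sub>R x + 1 *\<^sub>R z \<noteq> 0"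
    using assms unfolding indep2_def by (metis zero_neq_one)+
  then show "x \<noteq> 0" "z \<noteq> 0" by auto
qed

lemma indep2_iff_independent:
  "indep2 x z \<longleftrightarrow> x \<noteq> z \<and> independent {x, z}"
proof -
  have dep: "dependent {x, z} \<longleftrightarrow> z = 0 \<or> (\<exists>k. x = k *\<^sub>R z)" if "x \<noteq> z"
    using that span_singleton[of z] dependent_single[of z] independent_insert[of x "{z}"]
    by auto
  show ?thesis
  proof
    assume i: "indep2 x z"
    have "x \<noteq> z"
    proof
      assume "x = z"
      then have "1 *\<^sub>R x + (-1) *\<^sub>R z = 0" by simp
      with i show False unfolding indep2_def by (metis zero_neq_one)
    qed
    moreover have "x \<noteq> k *\<^sub>R z" for k
    proof
      assume "x = k *\<^sub>R z"
      then have "1 *\<^sub>R x + (-k) *\<^sub>R z = 0" by simp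
      with i show False unfolding indep2_def by (metis zero_neq_one)
    qed
    ultimately show "x \<noteq> z \<and> independent {x, z}"
      using dep indep2_nonzero[OF i] by auto
  next
    assume h: "x \<noteq> z \<and> independent {x, z}"
    then have z: "z \<noteq> 0" and k: "\<And>k. x \<noteq> k *\<^sub>R z" using dep by auto
    show "indep2 x z" unfolding indep2_def
    proof (intro allI impI)
      fix a b assume ab: "a *\<^sub>R x + b *\<^sub>R z = 0"
      have "a = 0"
      proof (rule ccontr)
        assume a: "a \<noteq> 0"
        have "x = (1/a) *\<^sub>R (a *\<^sub>R x)" using a by simp
        also have "a *\<^sub>R x = (-b) *\<^sub>R z" using ab by (simp add: eq_neg_iff_add_eq_0)
        finally show False using k by (metis scaleR_scaleR)
      qed
      then show "a = 0 \<and> b = 0" using ab z by simp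
    qed
  qed
qed

lemma indep2_commute: "indep2 x z \<longleftrightarrow> indep2 z x"
  by (metis (no_types) indep2_iff_independent insert_commute)

lemma not_indep2E:
  assumes "\<not> indep2 x z" "z \<noteq> 0"
  obtains k where "x = k *\<^sub>R z"
proof -
  obtain a b where ab: "a *\<^sub>R x + b *\<^sub>R z = 0" "a \<noteq> 0 \<or> b \<noteq> 0"
    using assms(1) unfolding indep2_def by blast
  have a: "a \<noteq> 0" using ab assms(2) by auto
  have "x = (1/a) *\<^sub>R (a *\<^sub>R x)" using a by simp
  also have "a *\<^sub>R x = (-b) *\<^sub>R z" using ab by (simp add: eq_neg_iff_add_eq_0)
  finally show thesis using that by (metis scaleR_scaleR)
qed

lemma indep2_add_multiple:
  assumes "indep2 x z" shows "indep2 (x + t *\<^sub>R z) z"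
  unfolding indep2_def
proof (intro allI impI)
  fix a b assume "a *\<^sub>R (x + t *\<^sub>R z) + b *\<^sub>R z = 0"
  then have "a *\<^sub>R x + (a * t + b) *\<^sub>R z = 0" by (simp add: algebra_simps)
  then show "a = 0 \<and> b = 0" using assms unfolding indep2_def by fastforce
qed

lemma indep2_scale:
  assumes "indep2 x z" "c \<noteq> 0" shows "indep2 x (c *\<^sub>R z)"
  unfolding indep2_def
proof (intro allI impI)
  fix a b assume "a *\<^sub>R x + b *\<^sub>R c *\<^sub>R z = 0"
  then have "a *\<^sub>R x + (b * c) *\<^sub>R z = 0" by simp
  then show "a = 0 \<and> b = 0" using assms unfolding indep2_def by fastforce
qed

lemma indep2_functional:
  fixes c d :: real
  assumes "indep2 x z"
  obtains D where "linear D" "D x = c" "D z = d"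
proof -
  have "independent {x, z}" using assms unfolding indep2_iff_independent by simp
  from linear_independent_extend[OF this, of "\<lambda>y. if y = x then c else d"]
  obtain D where "linear D" "\<forall>y\<in>{x, z}. D y = (if y = x then c else d)" by blast
  with assms[unfolded indep2_iff_independent] show thesis
    by (intro that[of D]) auto
qed

lemma plane_basis:
  assumes "normed_plane TYPE('a::real_normed_vector)"
  obtains b1 b2 :: "'a::real_normed_vector" where "indep2 b1 b2"
proof -
  obtain B :: "'a set" where "independent B" "card B = dim (UNIV :: 'a set)"
    by (rule basis_exists[of "UNIV :: 'a set"])
  then show thesis
    using assms that unfolding normed_plane_def indep2_iff_independent
    by (metis card_2_iff)
qed

text \<open>Otherwise \<open>p\<close>, \<open>x\<close> and \<open>z\<close> would be three
  independent vectors in the span of a basis of two elements.\<close>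

lemma plane_coords:
  fixes x z p :: "'a::real_normed_vector"
  assumes "normed_plane TYPE('a)" "indep2 x z"
  obtains a b where "p = a *\<^sub>R x + b *\<^sub>R z"
proof -
  have "p \<in> span {x, z}"
  proof (rule ccontr)
    assume p: "p \<notin> span {x, z}"
    obtain B :: "'a set" where B: "independent B" "card B = 2" "UNIV \<subseteq> span B"
      using basis_exists[of "UNIV :: 'a set"] assms(1)
      unfolding normed_plane_def by metis
    have ind: "independent (insert p {x, z})"
      using p assms(2) span_superset[of "{x, z}"]
      unfolding indep2_iff_independent by (subst independent_insert) auto
    have "finite B" using B(2) by (metis card.infinite zero_neq_numeral)
    then have "card (insert p {x, z}) \<le> card B"
      using independent_span_bound[OF _ ind] B(3) by blast
    moreover have "p \<notin> {x, z}" using p span_superset by blast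
    then have "card (insert p {x, z}) = 3"
      using assms(2) unfolding indep2_iff_independent by auto
    ultimately show False using B(2) by simp
  qed
  then obtain k where "p - k *\<^sub>R x \<in> span {z}" by (auto simp: span_breakdown_eq)
  then obtain b where "p - k *\<^sub>R x = b *\<^sub>R z" by (auto simp: span_singleton)
  then have "p = k *\<^sub>R x + b *\<^sub>R z" by (simp add: algebra_simps)
  then show thesis by (rule that)
qed

lemma exists_indep2:
  fixes x :: "'a::real_normed_vector"
  assumes "normed_plane TYPE('a)" "x \<noteq> 0"
  obtains z where "indep2 x z"
proof -
  obtain b1 b2 :: 'a where b: "indep2 b1 b2" using plane_basis[OF assms(1)] .
  have "indep2 b1 x \<or> indep2 b2 x"
  proof (rule ccontr)
    assume "\<not> ?thesis"
    then obtain k l where kl: "b1 = k *\<^sub>R x" "b2 = l *\<^sub>R x"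
      using not_indep2E[OF _ assms(2)] by metis
    then have "l *\<^sub>R b1 + (-k) *\<^sub>R b2 = 0" by simp
    then have "l = 0" using b unfolding indep2_def by metis
    then show False using kl indep2_nonzero[OF b] by simp
  qed
  then show thesis using that indep2_commute by metis
qed

lemma functional_kernel:
  fixes D :: "'a::real_normed_vector \<Rightarrow> real"
  assumes "normed_plane TYPE('a)" "linear D"
  obtains k where "k \<noteq> 0" "D k = 0"
proof -
  obtain b1 b2 :: 'a where b: "indep2 b1 b2" using plane_basis[OF assms(1)] .
  show thesis
  proof (cases "D b1 = 0")
    case True
    then show thesis using that indep2_nonzero[OF b] by blast
  next
    case False
    define k where "k = (- D b2) *\<^sub>R b1 + D b1 *\<^sub>R b2"
    have "k \<noteq> 0" using b False unfolding k_def indep2_def by blast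
    moreover have "D k = 0"
      using assms(2) by (simp add: k_def linear_add linear_scale linear_diff)
    ultimately show thesis by (rule that)
  qed
qed

subsection \<open>Directional derivatives of the norm\<close>

text \<open>\<open>D\<close> is the Gateaux differential of the norm at \<open>x\<close>. It agrees
  with the support functional of the normalised point (\<open>supp_fun_normalized\<close>) and makes
  one-variable calculus along lines available.\<close>

definition nderiv :: "'a::real_normed_vector \<Rightarrow> ('a \<Rightarrow> real) \<Rightarrow> bool" where
  "nderiv x D \<longleftrightarrow> linear D \<and>
     (\<forall>w. ((\<lambda>s. norm (x + s *\<^sub>R w)) has_real_derivative D w) (at 0))"

definition nsmooth :: "'a::real_normed_vector \<Rightarrow> bool" where
  "nsmooth x \<longleftrightarrow> x \<noteq> 0 \<and> (\<exists>D. nderiv x D)"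

definition ngrad :: "'a::real_normed_vector \<Rightarrow> 'a \<Rightarrow> real" where
  "ngrad x = (THE D. nderiv x D)"

lemma nderiv_unique: "nderiv x D \<Longrightarrow> nderiv x D' \<Longrightarrow> D = D'"
  unfolding nderiv_def by (metis DERIV_unique ext)

lemma nderiv_ngrad: "nderiv x D \<Longrightarrow> ngrad x = D"
  unfolding ngrad_def using nderiv_unique by blast

lemma nsmooth_nderiv: "nsmooth x \<Longrightarrow> nderiv x (ngrad x)"
  unfolding nsmooth_def using nderiv_ngrad by metis

lemma nsmooth_nonzero: "nsmooth x \<Longrightarrow> x \<noteq> 0"
  by (simp add: nsmooth_def)

lemma nsmooth_linear: "nsmooth x \<Longrightarrow> linear (ngrad x)"
  using nsmooth_nderiv unfolding nderiv_def by blast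

lemma ngrad_has_derivative:
  "nsmooth x \<Longrightarrow> ((\<lambda>s. norm (x + s *\<^sub>R w)) has_real_derivative ngrad x w) (at 0)"
  using nsmooth_nderiv unfolding nderiv_def by blast

lemma ngrad_self:
  assumes "nsmooth x" shows "ngrad x x = norm x"
proof -
  have "((\<lambda>s. (1 + s) * norm x) has_real_derivative norm x) (at 0)"
    by (auto intro!: derivative_eq_intros)
  then have "((\<lambda>s. norm (x + s *\<^sub>R x)) has_real_derivative norm x) (at 0)"
  proof (rule DERIV_cong_ev[THEN iffD1, rotated -1])
    have "eventually (\<lambda>s::real. s > -1) (nhds 0)"
      by (rule order_tendstoD) (auto intro: filterlim_ident)
    then show "eventually (\<lambda>s. (1 + s) * norm x = norm (x + s *\<^sub>R x)) (nhds 0)"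
    proof eventually_elim
      case (elim s)
      have "x + s *\<^sub>R x = (1 + s) *\<^sub>R x" by (simp add: algebra_simps)
      then show ?case using elim by simp
    qed
  qed auto
  then show ?thesis using ngrad_has_derivative[OF assms] DERIV_unique by blast
qed

lemma ngrad_le:
  assumes "nsmooth x" shows "ngrad x w \<le> norm w"
proof -
  have "((\<lambda>s. (norm (x + s *\<^sub>R w) - norm x) / s) \<longlongrightarrow> ngrad x w) (at 0)"
    using ngrad_has_derivative[OF assms, of w] by (simp add: has_field_derivative_iff)
  then have l: "((\<lambda>s. (norm (x + s *\<^sub>R w) - norm x) / s) \<longlongrightarrow> ngrad x w) (at_right 0)"
    by (rule filterlim_at_split[THEN iffD1, THEN conjunct2])
  have "eventually (\<lambda>s. (norm (x + s *\<^sub>R w) - norm x) / s \<le> norm w) (at_right 0)"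
    unfolding eventually_at_right_field
  proof (intro exI[of _ 1] conjI allI impI)
    fix s :: real assume s: "0 < s" "s < 1"
    have "norm (x + s *\<^sub>R w) \<le> norm x + s * norm w"
      using norm_triangle_ineq[of x "s *\<^sub>R w"] s by simp
    then show "(norm (x + s *\<^sub>R w) - norm x) / s \<le> norm w"
      using s by (simp add: field_simps)
  qed simp
  then show ?thesis using tendsto_upperbound[OF l] by simp
qed

lemma ngrad_minus_arg: "nsmooth x \<Longrightarrow> ngrad x (- w) = - ngrad x w"
  using nsmooth_linear linear_neg by blast

lemma ngrad_abs_le:
  assumes "nsmooth x" shows "\<bar>ngrad x w\<bar> \<le> norm w"
  using ngrad_le[OF assms, of w] ngrad_le[OF assms, of "- w"] ngrad_minus_arg[OF assms, of w] by simp

text \<open>The norm is homogeneous of degree one, so its differential has degree zero and only the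
  sign of \<open>c\<close> survives.\<close>

lemma nderiv_scale:
  assumes "nderiv x D" "c \<noteq> 0"
  shows "nderiv (c *\<^sub>R x) (\<lambda>w. sgn c * D w)"
  unfolding nderiv_def
proof (intro conjI allI)
  show "linear (\<lambda>w. sgn c * D w)"
    using assms(1) unfolding nderiv_def by (auto simp: linear_iff algebra_simps)
  fix w
  have "((\<lambda>s. norm (x + s *\<^sub>R w)) has_real_derivative D w) (at (0 / c))"
    using assms(1) unfolding nderiv_def by simp
  moreover have "((\<lambda>s. s / c) has_real_derivative 1 / c) (at 0)"
    using assms(2) by (auto intro!: derivative_eq_intros)
  ultimately have "((\<lambda>s. norm (x + (s / c) *\<^sub>R w)) has_real_derivative D w * (1 / c)) (at 0)"
    by (rule DERIV_chain'[rotated])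
  then have "((\<lambda>s. \<bar>c\<bar> * norm (x + (s / c) *\<^sub>R w)) has_real_derivative \<bar>c\<bar> * (D w * (1 / c))) (at 0)"
    by (rule DERIV_cmult)
  moreover have "\<bar>c\<bar> * norm (x + (s / c) *\<^sub>R w) = norm (c *\<^sub>R x + s *\<^sub>R w)" for s
  proof -
    have "c *\<^sub>R x + s *\<^sub>R w = c *\<^sub>R (x + (s / c) *\<^sub>R w)"
      using assms(2) by (simp add: scaleR_add_right del: scaleR_eq_0_iff)
    then show ?thesis by simp
  qed
  moreover have "\<bar>c\<bar> * (D w * (1 / c)) = sgn c * D w"
    using assms(2) by (simp add: sgn_real_def)
  ultimately show "((\<lambda>s. norm (c *\<^sub>R x + s *\<^sub>R w)) has_real_derivative sgn c * D w) (at 0)"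
    by simp
qed

lemma nsmooth_scale:
  assumes "nsmooth x" "c \<noteq> 0"
  shows "nsmooth (c *\<^sub>R x)" "ngrad (c *\<^sub>R x) w = sgn c * ngrad x w"
  using nderiv_scale[OF nsmooth_nderiv[OF assms(1)] assms(2)]
    nderiv_ngrad[OF nderiv_scale[OF nsmooth_nderiv[OF assms(1)] assms(2)]] nsmooth_nonzero[OF assms(1)] assms(2)
  unfolding nsmooth_def by auto

lemma nsmooth_minus:
  assumes "nsmooth x" shows "nsmooth (- x)" "ngrad (- x) w = - ngrad x w"
  using nsmooth_scale[OF assms, of "-1"] by auto

lemma nsmooth_scale_iff: "c \<noteq> 0 \<Longrightarrow> nsmooth (c *\<^sub>R x) \<longleftrightarrow> nsmooth x"
  using nsmooth_scale(1)[of x c] nsmooth_scale(1)[of "c *\<^sub>R x" "1 / c"] by auto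

lemma nsmooth_minus_commute: "nsmooth (x - y) \<longleftrightarrow> nsmooth (y - x)"
  using nsmooth_minus(1) minus_diff_eq by metis

lemma ngrad_minus_commute: "nsmooth (x - y) \<Longrightarrow> ngrad (y - x) w = - ngrad (x - y) w"
  using nsmooth_minus(2) minus_diff_eq by metis

lemma ngrad_support:
  assumes "nsmooth x" shows "support_functional x (\<lambda>w. norm x * ngrad x w)"
proof -
  note lin = nsmooth_linear[OF assms]
  have bl: "bounded_linear (ngrad x)"
    using lin ngrad_abs_le[OF assms]
    by (intro bounded_linear_intro[where K = 1]) (auto simp: linear_add linear_scale)
  then have bl': "bounded_linear (\<lambda>w. norm x * ngrad x w)"
    by (rule bounded_linear_const_mult)
  have "onorm (\<lambda>w. norm x * ngrad x w) = norm x"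
  proof (rule antisym)
    show "onorm (\<lambda>w. norm x * ngrad x w) \<le> norm x"
      using ngrad_abs_le[OF assms] by (intro onorm_bound) (auto simp: abs_mult mult_left_mono)
    have "norm (norm x * ngrad x x) / norm x \<le> onorm (\<lambda>w. norm x * ngrad x w)"
      by (rule le_onorm[OF bl'])
    then show "norm x \<le> onorm (\<lambda>w. norm x * ngrad x w)"
      using ngrad_self[OF assms] nsmooth_nonzero[OF assms] by simp
  qed
  then show ?thesis
    unfolding support_functional_def
    using bl' ngrad_self[OF assms] by (simp add: power2_eq_square)
qed

text \<open>A multiple of the norm dominates \<open>f\<close> along every line through
  \<open>x\<close>, with equality at \<open>x\<close>, so the derivative of the difference vanishes
  at this minimum.\<close>

lemma support_unique:
  assumes "nsmooth x" "support_functional x f"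
  shows "f = (\<lambda>w. norm x * ngrad x w)"
proof
  fix w
  have bl: "bounded_linear f" and o: "onorm f = norm x" and fx: "f x = (norm x)\<^sup>2"
    using assms(2) unfolding support_functional_def by auto
  have lin: "linear f" using bl by (rule bounded_linear.linear)
  define F where "F = (\<lambda>s. norm x * norm (x + s *\<^sub>R w) - (f x + s * f w))"
  have "F 0 \<le> F s" for s
  proof -
    have "f (x + s *\<^sub>R w) \<le> norm x * norm (x + s *\<^sub>R w)"
      using onorm[OF bl, of "x + s *\<^sub>R w"] o by simp
    then show ?thesis using lin fx
      by (simp add: F_def linear_add linear_scale power2_eq_square)
  qed
  moreover have "(F has_real_derivative norm x * ngrad x w - f w) (at 0)"
    unfolding F_def by (auto intro!: derivative_eq_intros ngrad_has_derivative[OF assms(1)])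
  ultimately have "norm x * ngrad x w - f w = 0"
    by (intro DERIV_local_min[where d = 1]) auto
  then show "f w = norm x * ngrad x w" by simp
qed

lemma nsmooth_smooth_point:
  assumes "nsmooth x" shows "smooth_point x"
  unfolding smooth_point_def
  using nsmooth_nonzero[OF assms] ngrad_support[OF assms] support_unique[OF assms] by blast

lemma supp_fun_normalized:
  assumes "nsmooth x" shows "supp_fun ((1 / norm x) *\<^sub>R x) = ngrad x"
proof -
  have x: "x \<noteq> 0" using nsmooth_nonzero[OF assms] .
  have s: "nsmooth ((1 / norm x) *\<^sub>R x)" using nsmooth_scale(1)[OF assms] x by simp
  have "ngrad ((1 / norm x) *\<^sub>R x) w = ngrad x w" for w
    using nsmooth_scale(2)[OF assms, of "1 / norm x" w] x by simp
  moreover have "supp_fun ((1 / norm x) *\<^sub>R x)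
      = (\<lambda>w. norm ((1 / norm x) *\<^sub>R x) * ngrad ((1 / norm x) *\<^sub>R x) w)"
    unfolding supp_fun_def
    by (rule the_equality, rule ngrad_support[OF s], rule support_unique[OF s])
  ultimately show ?thesis using x by simp
qed

lemma norm_ge_tangent:
  assumes "nsmooth x" shows "norm (x + w) \<ge> norm x + ngrad x w"
  using ngrad_le[OF assms, of "x + w"] ngrad_self[OF assms] nsmooth_linear[OF assms]
  by (simp add: linear_add)

text \<open>For fixed \<open>s > 0\<close> the difference quotient of the convex norm bounds the
  gradient from above and is continuous in the base point. Applied to \<open>- w\<close>, this also
  gives the lower bound.\<close>

lemma ngrad_tendsto:
  assumes "nsmooth x" "\<And>n. nsmooth (X n)" "X \<longlonglongrightarrow> x"
  shows "(\<lambda>n. ngrad (X n) w) \<longlonglongrightarrow> ngrad x w"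
proof -
  have upper: "eventually (\<lambda>n. ngrad (X n) w < ngrad x w + e) sequentially" if e: "e > 0" for e w
  proof -
    have "((\<lambda>s. (norm (x + s *\<^sub>R w) - norm x) / s) \<longlongrightarrow> ngrad x w) (at 0)"
      using ngrad_has_derivative[OF assms(1), of w] by (simp add: has_field_derivative_iff)
    then have "((\<lambda>s. (norm (x + s *\<^sub>R w) - norm x) / s) \<longlongrightarrow> ngrad x w) (at_right 0)"
      by (rule filterlim_at_split[THEN iffD1, THEN conjunct2])
    then have "eventually (\<lambda>s. (norm (x + s *\<^sub>R w) - norm x) / s < ngrad x w + e) (at_right 0)"
      by (rule order_tendstoD(2)) (use e in simp)
    moreover have "eventually (\<lambda>s::real. s > 0) (at_right 0)"
      by (rule eventually_at_right_less)
    ultimately have "eventually (\<lambda>s. s > 0 \<and> (norm (x + s *\<^sub>R w) - norm x) / s < ngrad x w + e) (at_right 0)"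
      by (simp add: eventually_conj)
    then obtain s where s: "s > 0" "(norm (x + s *\<^sub>R w) - norm x) / s < ngrad x w + e"
      using eventually_happens by (metis (no_types, lifting) trivial_limit_at_right_real)
    have "(\<lambda>n. (norm (X n + s *\<^sub>R w) - norm (X n)) / s) \<longlonglongrightarrow> (norm (x + s *\<^sub>R w) - norm x) / s"
      using assms(3) s(1) by (intro tendsto_intros) auto
    then have "eventually (\<lambda>n. (norm (X n + s *\<^sub>R w) - norm (X n)) / s < ngrad x w + e) sequentially"
      using s(2) by (rule order_tendstoD(2))
    then show ?thesis
    proof eventually_elim
      case (elim n)
      have "norm (X n + s *\<^sub>R w) \<ge> norm (X n) + s * ngrad (X n) w"
        using norm_ge_tangent[OF assms(2), of n "s *\<^sub>R w"] nsmooth_linear[OF assms(2), of n]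
        by (simp add: linear_scale)
      then have "ngrad (X n) w \<le> (norm (X n + s *\<^sub>R w) - norm (X n)) / s"
        using s(1) by (simp add: field_simps)
      then show ?case using elim by simp
    qed
  qed
  show ?thesis
  proof (rule order_tendstoI)
    fix a assume "a < ngrad x w"
    then have "eventually (\<lambda>n. ngrad (X n) (- w) < ngrad x (- w) + (ngrad x w - a)) sequentially"
      by (intro upper) simp
    then show "eventually (\<lambda>n. a < ngrad (X n) w) sequentially"
      by eventually_elim (simp add: ngrad_minus_arg assms)
  next
    fix a assume "ngrad x w < a"
    then have "eventually (\<lambda>n. ngrad (X n) w < ngrad x w + (a - ngrad x w)) sequentially"
      by (intro upper) simp
    then show "eventually (\<lambda>n. ngrad (X n) w < a) sequentially" by simp
  qed
qed

subsection \<open>Almost every point of a line is smooth\<close>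

text \<open>The subgradient inequalities at \<open>s\<close> and \<open>t\<close> squeeze the
  difference quotient between \<open>\<sigma> t\<close> and \<open>\<sigma> s\<close>, and
  continuity at \<open>t\<close> closes the gap.\<close>

lemma derivative_from_subgradient:
  fixes h \<sigma> :: "real \<Rightarrow> real"
  assumes sub: "\<And>s t. h s \<ge> h t + \<sigma> t * (s - t)" and cont: "isCont \<sigma> t"
  shows "(h has_real_derivative \<sigma> t) (at t)"
proof -
  have "((\<lambda>s. (h s - h t) / (s - t) - \<sigma> t) \<longlongrightarrow> 0) (at t)"
  proof (rule Lim_null_comparison)
    show "((\<lambda>s. \<bar>\<sigma> s - \<sigma> t\<bar>) \<longlongrightarrow> 0) (at t)"
      using cont unfolding isCont_def by (simp add: LIM_zero tendsto_rabs_zero)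
    show "eventually (\<lambda>s. norm ((h s - h t) / (s - t) - \<sigma> t) \<le> \<bar>\<sigma> s - \<sigma> t\<bar>) (at t)"
      unfolding eventually_at
    proof (intro exI[of _ 1] conjI ballI impI)
      fix s assume "s \<noteq> t \<and> dist s t < 1"
      then have st: "s \<noteq> t" by simp
      have a: "h s - h t \<ge> \<sigma> t * (s - t)" using sub[of t s] by simp
      have b: "h s - h t \<le> \<sigma> s * (s - t)" using sub[of s t] by (simp add: algebra_simps)
      show "norm ((h s - h t) / (s - t) - \<sigma> t) \<le> \<bar>\<sigma> s - \<sigma> t\<bar>"
      proof (cases "s > t")
        case True
        then have "\<sigma> t \<le> (h s - h t) / (s - t)" "(h s - h t) / (s - t) \<le> \<sigma> s"
          using a b by (auto simp: field_simps)
        then show ?thesis by simp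
      next
        case False
        then have "s - t < 0" using st by simp
        then have "\<sigma> t \<ge> (h s - h t) / (s - t)" "(h s - h t) / (s - t) \<ge> \<sigma> s"
          using a b by (auto simp: neg_le_divide_eq neg_divide_le_eq mult.commute)
        then show ?thesis by simp
      qed
    qed simp
  qed
  then show ?thesis by (simp add: has_field_derivative_iff LIM_zero_iff)
qed

lemma countable_nondifferentiable_norm:
  fixes x z :: "'a::real_normed_vector"
  shows "countable {t. \<not> (\<exists>d. ((\<lambda>s. norm (x + s *\<^sub>R z)) has_real_derivative d) (at t))}"
proof -
  define h where "h = (\<lambda>s. norm (x + s *\<^sub>R z))"
  have conv: "convex_on UNIV h"
  proof (rule convex_onI)
    fix t a b :: real assume t: "0 < t" "t < 1"
    have "x + ((1 - t) * a + t * b) *\<^sub>R z = (1 - t) *\<^sub>R (x + a *\<^sub>R z) + t *\<^sub>R (x + b *\<^sub>R z)"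
      by (simp add: algebra_simps)
    then show "h ((1 - t) *\<^sub>R a + t *\<^sub>R b) \<le> (1 - t) * h a + t * h b"
      using norm_triangle_ineq[of "(1 - t) *\<^sub>R (x + a *\<^sub>R z)" "t *\<^sub>R (x + b *\<^sub>R z)"] t
      by (simp add: h_def)
  qed simp
  \<comment> \<open>The infimum of the slopes to the right, that is, the right derivative: a
    monotone choice of subgradients, hence with countably many jumps.\<close>
  define \<sigma> where "\<sigma> = (\<lambda>t. Inf ((\<lambda>s. (h t - h s) / (t - s)) ` ({t<..} \<inter> UNIV)))"
  have sub: "h s \<ge> h t + \<sigma> t * (s - t)" for s t
    unfolding \<sigma>_def by (rule convex_le_Inf_differential[OF conv]) auto
  have "mono \<sigma>"
  proof (rule monoI)
    fix s t :: real assume st: "s \<le> t"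
    show "\<sigma> s \<le> \<sigma> t"
    proof (cases "s = t")
      case False
      have "\<sigma> s * (t - s) \<le> \<sigma> t * (t - s)"
        using sub[of s t] sub[of t s] by (simp add: algebra_simps)
      then show ?thesis using False st by simp
    qed simp
  qed
  then have "countable {t. \<not> isCont \<sigma> t}" by (rule mono_ctble_discont)
  then show ?thesis
    by (rule countable_subset[rotated])
       (use derivative_from_subgradient[OF sub] in \<open>auto simp: h_def\<close>)
qed

text \<open>One transversal direction suffices because homogeneity governs the radial one: for
  \<open>w = a *\<^sub>R x + b *\<^sub>R z\<close> and small \<open>s\<close>, the point
  \<open>x + s *\<^sub>R w\<close> is \<open>1 + s * a\<close> times a point of the line through
  \<open>x\<close> in direction \<open>z\<close>.\<close>

lemma nsmooth_from_direction:
  fixes x z :: "'a::real_normed_vector"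
  assumes plane: "normed_plane TYPE('a)" and ind: "indep2 x z"
    and der: "((\<lambda>s. norm (x + s *\<^sub>R z)) has_real_derivative d) (at 0)"
  shows "nsmooth x"
proof -
  obtain D where D: "linear D" "D x = norm x" "D z = d"
    using indep2_functional[OF ind] .
  have "((\<lambda>s. norm (x + s *\<^sub>R w)) has_real_derivative D w) (at 0)" for w
  proof -
    obtain a b where w: "w = a *\<^sub>R x + b *\<^sub>R z" using plane_coords[OF plane ind] .
    have ev: "eventually (\<lambda>s::real. 1 + s * a > 0) (nhds 0)"
    proof -
      have "((\<lambda>s. 1 + s * a) \<longlongrightarrow> 1 + 0 * a) (nhds 0)"
        by (intro tendsto_intros filterlim_ident)
      then show ?thesis by (rule order_tendstoD) simp
    qed
    have "((\<lambda>s. s * b / (1 + s * a)) has_real_derivative b) (at 0)"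
      by (auto intro!: derivative_eq_intros)
    moreover have "((\<lambda>s. norm (x + s *\<^sub>R z)) has_real_derivative d) (at (0 * b / (1 + 0 * a)))"
      using der by simp
    ultimately have "((\<lambda>s. norm (x + (s * b / (1 + s * a)) *\<^sub>R z)) has_real_derivative d * b) (at 0)"
      by (rule DERIV_chain')
    then have "((\<lambda>s. (1 + s * a) * norm (x + (s * b / (1 + s * a)) *\<^sub>R z)) has_real_derivative D w) (at 0)"
      using D by (auto intro!: derivative_eq_intros simp: w linear_add linear_scale)
    then show ?thesis
    proof (rule DERIV_cong_ev[THEN iffD1, rotated -1])
      show "eventually (\<lambda>s. (1 + s * a) * norm (x + (s * b / (1 + s * a)) *\<^sub>R z)
          = norm (x + s *\<^sub>R w)) (nhds 0)"
        using ev
      proof eventually_elim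
        case (elim s)
        have "x + s *\<^sub>R w = (1 + s * a) *\<^sub>R (x + (s * b / (1 + s * a)) *\<^sub>R z)"
          using elim by (simp add: w scaleR_add_right scaleR_add_left)
        then show ?case using elim by simp
      qed
    qed auto
  qed
  then have "nderiv x D" using D(1) unfolding nderiv_def by blast
  then show ?thesis using indep2_nonzero[OF ind] unfolding nsmooth_def by blast
qed

lemma countable_not_nsmooth_line_indep2:
  fixes x z :: "'a::real_normed_vector"
  assumes plane: "normed_plane TYPE('a)" and ind: "indep2 x z"
  shows "countable {t. \<not> nsmooth (x + t *\<^sub>R z)}"
proof (rule countable_subset[OF _ countable_nondifferentiable_norm[of x z]], clarify)
  fix t d assume t: "\<not> nsmooth (x + t *\<^sub>R z)"
    and d: "((\<lambda>s. norm (x + s *\<^sub>R z)) has_real_derivative d) (at t)"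
  have "((\<lambda>s. norm (x + (t + s) *\<^sub>R z)) has_real_derivative d) (at 0)"
    using DERIV_shift[of "\<lambda>s. norm (x + s *\<^sub>R z)" d 0 t] d by (simp add: add.commute)
  then have "nsmooth (x + t *\<^sub>R z)"
    by (intro nsmooth_from_direction[OF plane indep2_add_multiple[OF ind]])
       (simp add: algebra_simps)
  with t show False by simp
qed

text \<open>A line through the origin consists of multiples of \<open>z\<close>; smoothness of
  \<open>z\<close> leaves the origin as its only bad point. Every other line is transversal to its
  points.\<close>

lemma countable_not_nsmooth_line:
  fixes x z :: "'a::real_normed_vector"
  assumes plane: "normed_plane TYPE('a)" and z: "nsmooth z"
  shows "countable {t. \<not> nsmooth (x + t *\<^sub>R z)}"
proof (cases "indep2 x z")
  case False
  then obtain k where k: "x = k *\<^sub>R z" using not_indep2E nsmooth_nonzero[OF z] by blast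
  have line: "x + t *\<^sub>R z = (k + t) *\<^sub>R z" for t by (simp add: k algebra_simps)
  have "{t. \<not> nsmooth (x + t *\<^sub>R z)} \<subseteq> {- k}"
  proof
    fix t assume "t \<in> {t. \<not> nsmooth (x + t *\<^sub>R z)}"
    then have "k + t = 0"
      using nsmooth_scale(1)[OF z, of "k + t"] by (auto simp: line)
    then show "t \<in> {- k}" by simp
  qed
  then show ?thesis by (rule countable_subset) simp
qed (rule countable_not_nsmooth_line_indep2[OF plane])

text \<open>Here the base point is smooth and the direction arbitrary, even zero. Inverting the
  parameter turns \<open>x + t *\<^sub>R z\<close> into a multiple of a point on a line in direction
  \<open>x\<close>.\<close>

lemma countable_not_nsmooth_ray:
  fixes x z :: "'a::real_normed_vector"
  assumes plane: "normed_plane TYPE('a)" and x: "nsmooth x"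
  shows "countable {t. \<not> nsmooth (x + t *\<^sub>R z)}"
proof -
  have "{t. \<not> nsmooth (x + t *\<^sub>R z)} \<subseteq> (\<lambda>t. 1 / t) ` {t. \<not> nsmooth (z + t *\<^sub>R x)}"
  proof
    fix t assume t: "t \<in> {t. \<not> nsmooth (x + t *\<^sub>R z)}"
    then have t0: "t \<noteq> 0" using x by auto
    have "x + t *\<^sub>R z = t *\<^sub>R (z + (1 / t) *\<^sub>R x)" using t0 by (simp add: algebra_simps)
    then have "\<not> nsmooth (z + (1 / t) *\<^sub>R x)" using t t0 nsmooth_scale_iff by (metis mem_Collect_eq)
    then show "t \<in> (\<lambda>t. 1 / t) ` {t. \<not> nsmooth (z + t *\<^sub>R x)}"
      using t0 by (intro image_eqI[of _ _ "1 / t"]) auto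
  qed
  then show ?thesis
    by (rule countable_subset) (intro countable_image countable_not_nsmooth_line[OF plane x])
qed

lemma exists_between_avoiding_countable:
  fixes a b :: real
  assumes "countable S" "a < b"
  obtains t where "a < t" "t < b" "t \<notin> S"
proof -
  have "{a<..<b} - S \<noteq> {}"
    using assms uncountable_minus_countable[of "{a<..<b}" S] uncountable_open_interval[of a b]
    by (metis countable_empty)
  then show thesis using that by (metis DiffE all_not_in_conv greaterThanLessThan_iff)
qed

lemma exists_nsmooth_indep2:
  fixes x :: "'a::real_normed_vector"
  assumes plane: "normed_plane TYPE('a)" and "x \<noteq> 0"
  obtains z where "nsmooth z" "indep2 z x"
proof -
  obtain w where w: "indep2 w x" using exists_indep2[OF assms] indep2_commute by metis
  obtain t where "t \<notin> {t. \<not> nsmooth (w + t *\<^sub>R x)}"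
    using exists_between_avoiding_countable[OF countable_not_nsmooth_line_indep2[OF plane w], of 0 1]
    by auto
  then show thesis using that[of "w + t *\<^sub>R x"] indep2_add_multiple[OF w] by simp
qed

lemma exists_nsmooth:
  assumes plane: "normed_plane TYPE('a::real_normed_vector)"
  obtains z :: "'a::real_normed_vector" where "nsmooth z"
proof -
  obtain b1 b2 :: 'a where "indep2 b1 b2" using plane_basis[OF plane] .
  then show thesis using exists_nsmooth_indep2[OF plane] indep2_nonzero that by metis
qed

subsection \<open>Rigid frameworks\<close>

text \<open>Admitting only translations as flexes gives a form of rigidity that passes to limits;
  \<open>grigid_rigid_in\<close> leads back to curves of isometries.\<close>

definition fw_rigid :: "'v set \<Rightarrow> 'v set set \<Rightarrow> ('v \<Rightarrow> 'a::real_normed_vector) \<Rightarrow> bool" where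
  "fw_rigid V E p \<longleftrightarrow>
     (\<forall>v w. {v, w} \<in> E \<longrightarrow> nsmooth (p v - p w)) \<and>
     (\<forall>u. (\<forall>v w. {v, w} \<in> E \<longrightarrow> ngrad (p v - p w) (u v - u w) = 0) \<longrightarrow>
        (\<forall>v\<in>V. \<forall>w\<in>V. u v = u w))"

definition grigid :: "'a::real_normed_vector itself \<Rightarrow> 'v set \<Rightarrow> 'v set set \<Rightarrow> bool" where
  "grigid _ V E \<longleftrightarrow> (\<exists>p :: 'v \<Rightarrow> 'a. fw_rigid V E p)"

lemma fw_rigidI:
  assumes "\<And>v w. {v, w} \<in> E \<Longrightarrow> nsmooth (p v - p w)"
    and "\<And>u v w. (\<And>v w. {v, w} \<in> E \<Longrightarrow> ngrad (p v - p w) (u v - u w) = 0) \<Longrightarrow> v \<in> V \<Longrightarrow> w \<in> V \<Longrightarrow> u v = u w"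
  shows "fw_rigid V E p"
  using assms unfolding fw_rigid_def by blast

lemma fw_rigid_nsmooth: "fw_rigid V E p \<Longrightarrow> {v, w} \<in> E \<Longrightarrow> nsmooth (p v - p w)"
  unfolding fw_rigid_def by blast

lemma fw_rigid_flex:
  assumes "fw_rigid V E p" "\<And>v w. {v, w} \<in> E \<Longrightarrow> ngrad (p v - p w) (u v - u w) = 0"
    "v \<in> V" "w \<in> V"
  shows "u v = u w"
  using assms unfolding fw_rigid_def by blast

lemma grigidI: "fw_rigid V E (p :: 'v \<Rightarrow> 'a::real_normed_vector) \<Longrightarrow> grigid TYPE('a) V E"
  unfolding grigid_def by blast

lemma simple_graph_edge:
  assumes "simple_graph V E" "{v, w} \<in> E"
  shows "v \<in> V" "w \<in> V" "v \<noteq> w"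
proof -
  obtain x y where "{v, w} = {x, y}" "x \<noteq> y" "x \<in> V" "y \<in> V"
    using assms unfolding simple_graph_def by blast
  then show "v \<in> V" "w \<in> V" "v \<noteq> w" by (auto simp: doubleton_eq_iff)
qed

lemma simple_graph_mono: "simple_graph V E \<Longrightarrow> F \<subseteq> E \<Longrightarrow> simple_graph V F"
  unfolding simple_graph_def by blast

lemma is_isometry_translation: "is_isometry (\<lambda>x::'a::real_normed_vector. x + c)"
proof -
  have "surj (\<lambda>x. x + c)" by (rule surjI[of _ "\<lambda>x. x - c"]) simp
  then show ?thesis unfolding is_isometry_def by simp
qed

lemma grigid_rigid_in:
  assumes "grigid TYPE('a::real_normed_vector) V E"
  shows "rigid_in TYPE('a) V E"
proof -
  obtain p :: "'b \<Rightarrow> 'a" where p: "fw_rigid V E p" using assms unfolding grigid_def by blast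
  have "trivial_flex V p u" if flex: "inf_flex E p u" for u
  proof -
    have const: "u v = u w" if "v \<in> V" "w \<in> V" for v w
    proof (rule fw_rigid_flex[OF p])
      fix v w assume e: "{v, w} \<in> E"
      then show "ngrad (p v - p w) (u v - u w) = 0"
        using flex supp_fun_normalized[OF fw_rigid_nsmooth[OF p e]] unfolding inf_flex_def by metis
    qed (use that in auto)
    obtain a where a: "\<And>v. v \<in> V \<Longrightarrow> u v = a" using const by (metis equals0I)
    define \<gamma> :: "real \<Rightarrow> 'a \<Rightarrow> 'a" where "\<gamma> = (\<lambda>t x. x + t *\<^sub>R a)"
    have der: "((\<lambda>t. \<gamma> t x) has_vector_derivative a) (at t)" for x t
      unfolding \<gamma>_def by (auto intro!: derivative_eq_intros)
    have "(\<lambda>t. \<gamma> t x) C1_differentiable_on S" for x S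
      unfolding C1_differentiable_on_def using der
      by (intro exI[of _ "\<lambda>_. a"]) auto
    moreover have "is_isometry (\<gamma> t)" for t
      unfolding \<gamma>_def by (rule is_isometry_translation)
    moreover have "\<gamma> 0 = id" by (auto simp: \<gamma>_def)
    moreover have "u v = vector_derivative (\<lambda>t. \<gamma> t (p v)) (at 0)" if "v \<in> V" for v
      using a[OF that] vector_derivative_at[OF der] by simp
    ultimately show ?thesis
      unfolding trivial_flex_def by (intro exI[of _ \<gamma>] exI[of _ 1]) auto
  qed
  moreover have "well_positioned E p"
    unfolding well_positioned_def using fw_rigid_nsmooth[OF p] nsmooth_smooth_point by blast
  ultimately show ?thesis unfolding rigid_in_def inf_rigid_def by blast
qed

subsection \<open>Limits of frameworks\<close>

lemma plane_coordinate_functionals: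
  fixes x z :: "'a::real_normed_vector"
  assumes "normed_plane TYPE('a)" "indep2 x z"
  obtains A B where "linear A" "linear B" "\<And>p. p = A p *\<^sub>R x + B p *\<^sub>R z"
proof -
  obtain A :: "'a \<Rightarrow> real" where A: "linear A" "A x = 1" "A z = 0"
    using indep2_functional[OF assms(2)] .
  obtain B :: "'a \<Rightarrow> real" where B: "linear B" "B x = 0" "B z = 1"
    using indep2_functional[OF assms(2)] .
  have "p = A p *\<^sub>R x + B p *\<^sub>R z" for p
  proof -
    obtain a b where "p = a *\<^sub>R x + b *\<^sub>R z" using plane_coords[OF assms] .
    then show ?thesis using A B by (simp add: linear_add linear_scale)
  qed
  then show thesis using that A B by blast
qed

lemma bounded_family_subseq:
  fixes X :: "nat \<Rightarrow> 'v \<Rightarrow> 'b::heine_borel"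
  assumes "finite V" "\<And>v. v \<in> V \<Longrightarrow> bounded (range (\<lambda>n. X n v))"
  obtains r l where "strict_mono (r :: nat \<Rightarrow> nat)" "\<And>v. v \<in> V \<Longrightarrow> (\<lambda>n. X (r n) v) \<longlonglongrightarrow> l v"
proof -
  have "\<exists>r l. strict_mono (r :: nat \<Rightarrow> nat) \<and> (\<forall>v\<in>V. (\<lambda>n. X (r n) v) \<longlonglongrightarrow> l v)"
    using assms
  proof (induction V rule: finite_induct)
    case empty
    show ?case by (intro exI[of _ id]) (auto simp: strict_mono_def)
  next
    case (insert a V)
    then obtain r l where r: "strict_mono r" "\<forall>v\<in>V. (\<lambda>n. X (r n) v) \<longlonglongrightarrow> l v" by blast
    have "bounded (range (\<lambda>n. X (r n) a))"
      using insert.prems[of a] by (rule bounded_subset) auto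
    then obtain l' s where s: "strict_mono s" "((\<lambda>n. X (r n) a) \<circ> s) \<longlonglongrightarrow> l'"
      using bounded_imp_convergent_subsequence by blast
    have "(\<lambda>n. X ((r \<circ> s) n) v) \<longlonglongrightarrow> (l(a := l')) v" if "v \<in> insert a V" for v
    proof (cases "v = a")
      case True
      then show ?thesis using s(2) by (simp add: o_def)
    next
      case False
      then have "((\<lambda>n. X (r n) v) \<circ> s) \<longlonglongrightarrow> l v"
        using r(2) that s(1) by (intro LIMSEQ_subseq_LIMSEQ) auto
      then show ?thesis using False by (simp add: o_def)
    qed
    then show ?case using strict_mono_o[OF r(1) s(1)] by blast
  qed
  then show thesis using that by blast
qed

text \<open>Rigidity is an open condition on the functionals: normalised non-constant flexes of the
  frameworks \<^term>\<open>P n\<close> would accumulate at one of the limit system.\<close>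

lemma rigid_limit:
  fixes P :: "nat \<Rightarrow> 'v \<Rightarrow> 'a::real_normed_vector"
  assumes plane: "normed_plane TYPE('a)" and graph: "simple_graph V E"
    and nsmooth: "\<And>n v w. {v, w} \<in> E \<Longrightarrow> nsmooth (P n v - P n w)"
    and lim: "\<And>v w z. {v, w} \<in> E \<Longrightarrow> (\<lambda>n. ngrad (P n v - P n w) z) \<longlonglongrightarrow> f v w z"
    and rig: "\<And>u v w. (\<And>v w. {v, w} \<in> E \<Longrightarrow> f v w (u v - u w) = 0) \<Longrightarrow> v \<in> V \<Longrightarrow> w \<in> V \<Longrightarrow> u v = u w"
  shows "\<exists>n. fw_rigid V E (P n)"
proof (rule ccontr)
  assume "\<nexists>n. fw_rigid V E (P n)"
  then have "\<forall>n. \<exists>u. (\<forall>v w. {v, w} \<in> E \<longrightarrow> ngrad (P n v - P n w) (u v - u w) = 0) \<and>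
      (\<exists>v\<in>V. \<exists>w\<in>V. u v \<noteq> u w)"
    using nsmooth unfolding fw_rigid_def by blast
  then obtain u where u: "\<And>n v w. {v, w} \<in> E \<Longrightarrow> ngrad (P n v - P n w) (u n v - u n w) = 0"
    and nonconst: "\<And>n. \<exists>v\<in>V. \<exists>w\<in>V. u n v \<noteq> u n w" by metis
  have fin: "finite V" using graph unfolding simple_graph_def by blast
  obtain v0 where v0: "v0 \<in> V" using nonconst by blast
  obtain b1 b2 :: 'a where b: "indep2 b1 b2" using plane_basis[OF plane] .
  obtain A B where AB: "linear A" "linear B" and coord: "\<And>p. p = A p *\<^sub>R b1 + B p *\<^sub>R b2"
    using plane_coordinate_functionals[OF plane b] by metis
  \<comment> \<open>The class of \<open>'a\<close> provides no convergent subsequences, so the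
    flexes are read in coordinates. Subtracting the value at \<open>v0\<close> removes translations,
    after which the total size \<open>S n\<close> can be scaled to 1.\<close>
  define c where "c = (\<lambda>n v. (A (u n v - u n v0), B (u n v - u n v0)))"
  define S where "S = (\<lambda>n. \<Sum>v\<in>V. \<bar>fst (c n v)\<bar> + \<bar>snd (c n v)\<bar>)"
  have Spos: "S n > 0" for n
  proof -
    obtain v where v: "v \<in> V" "u n v \<noteq> u n v0" using nonconst[of n] v0 by metis
    have "c n v \<noteq> 0"
    proof
      assume "c n v = 0"
      then have "u n v - u n v0 = 0 *\<^sub>R b1 + 0 *\<^sub>R b2"
        using coord[of "u n v - u n v0"] by (simp add: c_def zero_prod_def)
      with v show False by simp
    qed
    then have "0 < \<bar>fst (c n v)\<bar> + \<bar>snd (c n v)\<bar>"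
      by (simp add: prod_eq_iff zero_prod_def) linarith
    then show ?thesis unfolding S_def using fin v(1)
      by (intro sum_pos2[of _ v]) auto
  qed
  define X where "X = (\<lambda>n v. (1 / S n) *\<^sub>R c n v)"
  have Xsum: "(\<Sum>v\<in>V. \<bar>fst (X n v)\<bar> + \<bar>snd (X n v)\<bar>) = 1" for n
  proof -
    have "(\<Sum>v\<in>V. \<bar>fst (X n v)\<bar> + \<bar>snd (X n v)\<bar>) = (\<Sum>v\<in>V. (\<bar>fst (c n v)\<bar> + \<bar>snd (c n v)\<bar>) / S n)"
      using Spos[of n] by (intro sum.cong) (auto simp: X_def add_divide_distrib)
    also have "\<dots> = S n / S n" by (simp only: S_def sum_divide_distrib)
    finally show ?thesis using Spos[of n] by simp
  qed
  have "bounded (range (\<lambda>n. X n v))" if "v \<in> V" for v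
    unfolding bounded_iff
  proof (intro exI[of _ 1] ballI)
    fix y assume "y \<in> range (\<lambda>n. X n v)"
    then obtain n where y: "y = X n v" by blast
    have "norm (X n v) \<le> \<bar>fst (X n v)\<bar> + \<bar>snd (X n v)\<bar>"
      unfolding norm_prod_def using sqrt_sum_squares_le_sum_abs by auto
    also have "\<dots> \<le> 1"
      using member_le_sum[OF that, of "\<lambda>v. \<bar>fst (X n v)\<bar> + \<bar>snd (X n v)\<bar>"] fin Xsum[of n] by auto
    finally show "norm y \<le> 1" unfolding y .
  qed
  then obtain r l where r: "strict_mono (r :: nat \<Rightarrow> nat)"
    and l: "\<And>v. v \<in> V \<Longrightarrow> (\<lambda>n. X (r n) v) \<longlonglongrightarrow> l v"
    using bounded_family_subseq[OF fin] by metis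
  have l1: "(\<lambda>n. fst (X (r n) v)) \<longlonglongrightarrow> fst (l v)" and l2: "(\<lambda>n. snd (X (r n) v)) \<longlonglongrightarrow> snd (l v)"
    if "v \<in> V" for v
    using l[OF that] by (auto intro: tendsto_fst tendsto_snd)
  define U where "U = (\<lambda>v. fst (l v) *\<^sub>R b1 + snd (l v) *\<^sub>R b2)"
  have flexU: "f v w (U v - U w) = 0" if e: "{v, w} \<in> E" for v w
  proof -
    have vw: "v \<in> V" "w \<in> V" using simple_graph_edge[OF graph e] by auto
    define g where "g = (\<lambda>n. ngrad (P (r n) v - P (r n) w))"
    have lin: "linear (g n)" for n unfolding g_def by (rule nsmooth_linear[OF nsmooth[OF e]])
    have g: "(\<lambda>n. g n z) \<longlonglongrightarrow> f v w z" for z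
      using LIMSEQ_subseq_LIMSEQ[OF lim[OF e] r] unfolding g_def by (simp add: o_def)
    have "(\<lambda>n. (fst (X (r n) v) - fst (X (r n) w)) * g n b1 + (snd (X (r n) v) - snd (X (r n) w)) * g n b2)
        \<longlonglongrightarrow> (fst (l v) - fst (l w)) * f v w b1 + (snd (l v) - snd (l w)) * f v w b2"
      by (intro tendsto_intros l1 l2 g vw)
    moreover have "(fst (X (r n) v) - fst (X (r n) w)) * g n b1 + (snd (X (r n) v) - snd (X (r n) w)) * g n b2 = 0" for n
    proof -
      have "g n (u (r n) v - u (r n) w) = 0" unfolding g_def by (rule u[OF e])
      moreover have "g n x = A x * g n b1 + B x * g n b2" for x
      proof -
        have "g n x = g n (A x *\<^sub>R b1 + B x *\<^sub>R b2)" using coord[of x] by simp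
        then show ?thesis using lin[of n] by (simp add: linear_add linear_scale)
      qed
      ultimately have "(A (u (r n) v) - A (u (r n) w)) * g n b1 + (B (u (r n) v) - B (u (r n) w)) * g n b2 = 0"
        using linear_diff[OF AB(1)] linear_diff[OF AB(2)] by metis
      then have "(1 / S (r n)) * ((A (u (r n) v) - A (u (r n) w)) * g n b1 + (B (u (r n) v) - B (u (r n) w)) * g n b2) = 0"
        by simp
      then show ?thesis using AB
        by (simp add: X_def c_def linear_diff algebra_simps diff_divide_distrib add_divide_distrib)
    qed
    ultimately have z: "(fst (l v) - fst (l w)) * f v w b1 + (snd (l v) - snd (l w)) * f v w b2 = 0"
      by (simp add: LIMSEQ_const_iff)
    have "(\<lambda>n. g n (U v - U w)) \<longlonglongrightarrow> (fst (l v) - fst (l w)) * f v w b1 + (snd (l v) - snd (l w)) * f v w b2"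
    proof -
      have "g n (U v - U w) = (fst (l v) - fst (l w)) * g n b1 + (snd (l v) - snd (l w)) * g n b2" for n
        using lin[of n] by (simp add: U_def linear_add linear_diff linear_scale algebra_simps)
      then show ?thesis by (auto intro!: tendsto_intros g)
    qed
    then show ?thesis using LIMSEQ_unique[OF g] z by simp
  qed
  have "l v0 = 0"
  proof -
    have "X n v0 = 0" for n using AB by (simp add: X_def c_def linear_0 zero_prod_def)
    then show ?thesis using l[OF v0] by (simp add: LIMSEQ_const_iff)
  qed
  then have "U v = 0 *\<^sub>R b1 + 0 *\<^sub>R b2" if "v \<in> V" for v
    using rig[OF flexU that v0] by (simp add: U_def)
  then have "fst (l v) = 0 \<and> snd (l v) = 0" if "v \<in> V" for v
    using that b unfolding U_def indep2_def by auto
  \<comment> \<open>These sums are constantly 1 and yet converge to a sum of zeros.\<close>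
  moreover have "(\<lambda>n. \<Sum>v\<in>V. \<bar>fst (X (r n) v)\<bar> + \<bar>snd (X (r n) v)\<bar>)
      \<longlonglongrightarrow> (\<Sum>v\<in>V. \<bar>fst (l v)\<bar> + \<bar>snd (l v)\<bar>)"
    by (intro tendsto_intros l1 l2)
  ultimately show False by (simp add: Xsum LIMSEQ_const_iff)
qed

lemma null_sequence_avoiding_countable:
  fixes S :: "real set"
  assumes "countable S"
  obtains \<epsilon> where "\<epsilon> \<longlonglongrightarrow> 0" "\<And>n::nat. \<epsilon> n > 0" "\<And>n. \<epsilon> n \<notin> S"
proof -
  have "\<exists>t. 0 < t \<and> t < 1 / real (Suc n) \<and> t \<notin> S" for n
    using exists_between_avoiding_countable[OF assms, of 0 "1 / real (Suc n)"] by auto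
  then obtain \<epsilon> where e: "\<And>n. 0 < \<epsilon> n" "\<And>n. \<epsilon> n < 1 / real (Suc n)" "\<And>n. \<epsilon> n \<notin> S"
    by metis
  have "\<epsilon> \<longlonglongrightarrow> 0"
  proof (rule tendsto_sandwich[of "\<lambda>_. 0"])
    show "(\<lambda>n. 1 / real (Suc n)) \<longlonglongrightarrow> 0"
      using LIMSEQ_inverse_real_of_nat by (simp add: inverse_eq_divide)
  qed (use e less_imp_le in \<open>auto intro!: always_eventually simp: less_imp_le\<close>)
  then show thesis using that e by blast
qed

text \<open>Along a smooth direction \<open>z\<close>, all but countably many displacements of
  \<open>a\<close> keep its differences to the vertices smooth, and small ones keep rigidity by
  \<open>rigid_limit\<close>. The set \<open>S\<close> leaves room for one more condition chosen by
  the caller.\<close>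

lemma move_vertex:
  fixes p :: "'v \<Rightarrow> 'a::real_normed_vector"
  assumes plane: "normed_plane TYPE('a)" and graph: "simple_graph V E"
    and p: "fw_rigid V E p" and z: "nsmooth z" and S: "countable S"
  obtains \<epsilon> where "\<epsilon> \<notin> S" "fw_rigid V E (p(a := p a + \<epsilon> *\<^sub>R z))"
proof -
  have "finite V" using graph unfolding simple_graph_def by blast
  then have "countable (S \<union> (\<Union>w\<in>V. {t. \<not> nsmooth (p a - p w + t *\<^sub>R z)}))"
    using countable_not_nsmooth_line[OF plane z] S
    by (intro countable_Un countable_UN) (auto intro: countable_finite)
  then obtain \<epsilon> where e: "\<epsilon> \<longlonglongrightarrow> 0" "\<And>n::nat. \<epsilon> n > 0"
      "\<And>n. \<epsilon> n \<notin> S \<union> (\<Union>w\<in>V. {t. \<not> nsmooth (p a - p w + t *\<^sub>R z)})"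
    using null_sequence_avoiding_countable by metis
  define P where "P = (\<lambda>n. p(a := p a + \<epsilon> n *\<^sub>R z))"
  have nsmooth: "nsmooth (P n v - P n w)" if vw: "{v, w} \<in> E" for n v w
  proof -
    have in_V: "v \<in> V" "w \<in> V" "v \<noteq> w" using simple_graph_edge[OF graph vw] by auto
    have star: "nsmooth (P n a - P n x)" if "x \<in> V" "x \<noteq> a" for x
    proof -
      have "nsmooth (p a - p x + \<epsilon> n *\<^sub>R z)" using e(3)[of n] that by blast
      then show ?thesis using that by (simp add: P_def algebra_simps)
    qed
    consider "v = a" | "w = a" | "v \<noteq> a" "w \<noteq> a" by blast
    then show ?thesis
    proof cases
      case 1 then show ?thesis using star in_V by blast
    next
      case 2 then show ?thesis using star in_V nsmooth_minus_commute by blast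
    next
      case 3 then show ?thesis using fw_rigid_nsmooth[OF p vw] by (simp add: P_def)
    qed
  qed
  have conv: "(\<lambda>n. P n v) \<longlonglongrightarrow> p v" for v
  proof (cases "v = a")
    case True
    have "(\<lambda>n. p a + \<epsilon> n *\<^sub>R z) \<longlonglongrightarrow> p a + 0 *\<^sub>R z" by (intro tendsto_intros e(1))
    then show ?thesis using True by (simp add: P_def)
  qed (simp add: P_def)
  have "\<exists>n. fw_rigid V E (P n)"
  proof (rule rigid_limit[OF plane graph nsmooth])
    fix v w and y :: 'a assume vw: "{v, w} \<in> E"
    show "(\<lambda>n. ngrad (P n v - P n w) y) \<longlonglongrightarrow> ngrad (p v - p w) y"
      by (rule ngrad_tendsto[OF fw_rigid_nsmooth[OF p vw] nsmooth[OF vw]]) (intro tendsto_intros conv)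
  qed (use fw_rigid_flex[OF p] in blast)+
  then show thesis using that e(3) unfolding P_def by blast
qed

subsection \<open>Rigidity-preserving extensions\<close>

lemma grigid_single: "grigid TYPE('a::real_normed_vector) {v} {}"
  unfolding grigid_def fw_rigid_def by simp

text \<open>A further constraint never adds a flex, so only the smoothness of
  \<open>p a - p b\<close> has to be arranged.\<close>

lemma grigid_add_edge:
  assumes plane: "normed_plane TYPE('a::real_normed_vector)" and graph: "simple_graph V E"
    and rig: "grigid TYPE('a) V E" and ab: "a \<noteq> b"
  shows "grigid TYPE('a) V (insert {a, b} E)"
proof -
  obtain p :: "'b \<Rightarrow> 'a" where p: "fw_rigid V E p" using rig unfolding grigid_def by blast
  obtain z :: 'a where z: "nsmooth z" using exists_nsmooth[OF plane] .
  obtain \<epsilon> where e: "\<epsilon> \<notin> {t. \<not> nsmooth (p a - p b + t *\<^sub>R z)}"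
    and q: "fw_rigid V E (p(a := p a + \<epsilon> *\<^sub>R z))" (is "fw_rigid V E ?q")
    using move_vertex[OF plane graph p z countable_not_nsmooth_line[OF plane z]] .
  have ab': "nsmooth (?q a - ?q b)" using e ab by (simp add: algebra_simps)
  have "fw_rigid V (insert {a, b} E) ?q"
  proof (rule fw_rigidI)
    fix v w assume "{v, w} \<in> insert {a, b} E"
    then show "nsmooth (?q v - ?q w)"
      using ab' nsmooth_minus_commute fw_rigid_nsmooth[OF q] by (metis doubleton_eq_iff insert_iff)
  next
    fix u v w
    assume "\<And>v w. {v, w} \<in> insert {a, b} E \<Longrightarrow> ngrad (?q v - ?q w) (u v - u w) = 0"
      and "v \<in> V" "w \<in> V"
    then show "u v = u w" by (intro fw_rigid_flex[OF q, of u]) auto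
  qed
  then show ?thesis by (rule grigidI)
qed

text \<open>Without strict convexity, independent directions may share a norming functional, so the
  point \<open>y\<close> is taken close to the kernel of \<open>ngrad d\<close>. Let
  \<open>k\<close> be the point of the line in that kernel. A nonzero common kernel vector would
  give \<open>ngrad y k = 0\<close>, hence \<open>norm y \<le> (t - t0) * norm d\<close>. But
  \<open>y\<close> differs from \<open>k\<close> by a vector of just this length, which is less than
  half of \<open>norm k\<close>.\<close>

lemma transversal_smooth_point:
  fixes x d :: "'a::real_normed_vector"
  assumes plane: "normed_plane TYPE('a)" and d: "nsmooth d" and ind: "indep2 x d"
    and S: "countable S"
  obtains t where "t \<notin> S" "nsmooth (x + t *\<^sub>R d)"
    "\<And>w. ngrad d w = 0 \<Longrightarrow> ngrad (x + t *\<^sub>R d) w = 0 \<Longrightarrow> w = 0"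
proof -
  have nd: "norm d > 0" using nsmooth_nonzero[OF d] by simp
  define t0 where "t0 = - ngrad d x / norm d"
  define k where "k = x + t0 *\<^sub>R d"
  have ker: "ngrad d k = 0"
    using nd ngrad_self[OF d] nsmooth_linear[OF d] by (simp add: k_def t0_def linear_diff linear_scale)
  have indk: "indep2 k d" unfolding k_def by (rule indep2_add_multiple[OF ind])
  have nk: "norm k > 0" using indep2_nonzero[OF indk] by simp
  have "countable (S \<union> {t. \<not> nsmooth (x + t *\<^sub>R d)})"
    using S countable_not_nsmooth_line[OF plane d] by simp
  then obtain t where t: "t0 < t" "t < t0 + norm k / (2 * norm d)" "t \<notin> S \<union> {t. \<not> nsmooth (x + t *\<^sub>R d)}"
    using exists_between_avoiding_countable[of "S \<union> {t. \<not> nsmooth (x + t *\<^sub>R d)}" t0 "t0 + norm k / (2 * norm d)"] nd nk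
    by (metis less_add_same_cancel1 zero_less_divide_iff zero_less_mult_iff zero_less_numeral)
  define y where "y = x + t *\<^sub>R d"
  have smy: "nsmooth y" using t(3) by (simp add: y_def)
  have y: "y = k + (t - t0) *\<^sub>R d" by (simp add: y_def k_def algebra_simps)
  have small: "(t - t0) * norm d < norm k / 2"
    using t(2) nd by (simp add: field_simps)
  have "w = 0" if w: "ngrad d w = 0" "ngrad y w = 0" for w
  proof -
    obtain \<alpha> \<beta> where ab: "w = \<alpha> *\<^sub>R k + \<beta> *\<^sub>R d" using plane_coords[OF plane indk] .
    have "\<beta> = 0"
      using w(1) ker nd ngrad_self[OF d] nsmooth_linear[OF d] by (simp add: ab linear_add linear_scale)
    have "\<alpha> = 0"
    proof (rule ccontr)
      assume "\<alpha> \<noteq> 0"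
      then have "ngrad y k = 0"
        using w(2) nsmooth_linear[OF smy] by (simp add: ab \<open>\<beta> = 0\<close> linear_scale)
      then have "ngrad y (k + (t - t0) *\<^sub>R d) = (t - t0) * ngrad y d"
        using nsmooth_linear[OF smy] by (simp add: linear_add linear_scale)
      then have "ngrad y y = (t - t0) * ngrad y d" unfolding y[symmetric] .
      then have "norm y \<le> (t - t0) * norm d"
        using ngrad_self[OF smy] ngrad_le[OF smy, of d] t(1) by simp
      moreover have "norm k \<le> norm y + (t - t0) * norm d"
        using norm_triangle_ineq4[of y "(t - t0) *\<^sub>R d"] t(1) by (simp add: y)
      ultimately show False using small by simp
    qed
    then show "w = 0" using ab \<open>\<beta> = 0\<close> by simp
  qed
  then show thesis using that[of t] t(3) smy unfolding y_def by auto
qed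

text \<open>The new vertex is put infinitesimally close to \<open>a\<close>, so that its edge to \<open>b\<close> has
  the functional of \<open>a - b\<close> in the limit while the one to \<open>a\<close> is arbitrary.\<close>

lemma grigid_0_extension:
  assumes plane: "normed_plane TYPE('a::real_normed_vector)" and graph: "simple_graph V E"
    and rig: "grigid TYPE('a) V E" and vab: "v \<notin> V" "a \<in> V" "b \<in> V" "a \<noteq> b"
  shows "grigid TYPE('a) (insert v V) (insert {v, a} (insert {v, b} E))"
proof -
  obtain p0 :: "'b \<Rightarrow> 'a" where p0: "fw_rigid V E p0" using rig unfolding grigid_def by blast
  obtain z :: 'a where z: "nsmooth z" using exists_nsmooth[OF plane] .
  obtain \<epsilon> where e: "\<epsilon> \<notin> {t. \<not> nsmooth (p0 a - p0 b + t *\<^sub>R z)}"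
    and "fw_rigid V E (p0(a := p0 a + \<epsilon> *\<^sub>R z))"
    using move_vertex[OF plane graph p0 z countable_not_nsmooth_line[OF plane z]] .
  then obtain p :: "'b \<Rightarrow> 'a" where p: "fw_rigid V E p" and d: "nsmooth (p a - p b)"
    using vab(4) by (metis (mono_tags, lifting) add_diff_eq diff_add_eq fun_upd_apply mem_Collect_eq)
  define d where "d = p a - p b"
  have smd: "nsmooth d" using d by (simp add: d_def)
  obtain x where x: "indep2 x d"
    using exists_indep2[OF plane nsmooth_nonzero[OF smd]] indep2_commute by metis
  obtain t where "t \<notin> {}" and t: "nsmooth (x + t *\<^sub>R d)"
      "\<And>w. ngrad d w = 0 \<Longrightarrow> ngrad (x + t *\<^sub>R d) w = 0 \<Longrightarrow> w = 0"
    using transversal_smooth_point[OF plane smd x countable_empty] by blast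
  define k where "k = x + t *\<^sub>R d"
  have smk: "nsmooth k" and trans: "\<And>w. ngrad d w = 0 \<Longrightarrow> ngrad k w = 0 \<Longrightarrow> w = 0"
    using t by (auto simp: k_def)
  obtain \<eta> where eta: "\<eta> \<longlonglongrightarrow> 0" "\<And>n::nat. \<eta> n > 0" "\<And>n. \<eta> n \<notin> {t. \<not> nsmooth (d + t *\<^sub>R k)}"
    using null_sequence_avoiding_countable[OF countable_not_nsmooth_line[OF plane smk]] by metis
  define P where "P = (\<lambda>n. p(v := p a + \<eta> n *\<^sub>R k))"
  define E' where "E' = insert {v, a} (insert {v, b} E)"
  \<comment> \<open>The edge from \<open>v\<close> to \<open>a\<close> shrinks to length zero but
    keeps the direction \<open>k\<close>, so its limit functional is that of \<open>k\<close>
    although \<open>v\<close> tends to \<open>a\<close>. The inner cases take care of the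
    orientation.\<close>
  define f where "f = (\<lambda>x y. if {x, y} = {v, a} then (if x = v then ngrad k else ngrad (- k))
    else if {x, y} = {v, b} then (if x = v then ngrad d else ngrad (- d)) else ngrad (p x - p y))"
  have neq: "v \<noteq> a" "v \<noteq> b" using vab by auto
  have Pv: "P n v = p a + \<eta> n *\<^sub>R k" and Px: "x \<noteq> v \<Longrightarrow> P n x = p x" for n x by (auto simp: P_def)
  have old: "x \<noteq> v \<and> y \<noteq> v" if "{x, y} \<in> E" for x y
    using simple_graph_edge[OF graph that] vab(1) by auto
  have graph': "simple_graph (insert v V) E'"
    using graph vab unfolding simple_graph_def E'_def by blast
  have va: "P n v - P n a = \<eta> n *\<^sub>R k" for n using neq by (simp add: P_def)
  have vb: "P n v - P n b = d + \<eta> n *\<^sub>R k" for n using neq by (simp add: P_def d_def)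
  have sva: "nsmooth (P n v - P n a)" for n
    unfolding va using nsmooth_scale(1)[OF smk] eta(2)[of n] by simp
  have svb: "nsmooth (P n v - P n b)" for n
    unfolding vb using eta(3)[of n] by simp
  have edge_cases: "(x = v \<and> y = a) \<or> (x = a \<and> y = v) \<or> (x = v \<and> y = b) \<or> (x = b \<and> y = v) \<or> {x, y} \<in> E"
    if "{x, y} \<in> E'" for x y
    using that unfolding E'_def by (auto simp: doubleton_eq_iff)
  have lim_a: "(\<lambda>n. ngrad (P n v - P n a) y) \<longlonglongrightarrow> ngrad k y" for y
    unfolding va using nsmooth_scale(2)[OF smk] eta(2) by (simp add: less_imp_neq[symmetric])
  have lim_b: "(\<lambda>n. ngrad (P n v - P n b) y) \<longlonglongrightarrow> ngrad d y" for y
  proof (rule ngrad_tendsto[OF smd svb])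
    have "(\<lambda>n. d + \<eta> n *\<^sub>R k) \<longlonglongrightarrow> d + 0 *\<^sub>R k" by (intro tendsto_intros eta(1))
    then show "(\<lambda>n. P n v - P n b) \<longlonglongrightarrow> d" by (simp add: vb)
  qed
  have "\<exists>n. fw_rigid (insert v V) E' (P n)"
  proof (rule rigid_limit[OF plane graph', where f = f])
    fix n x y assume "{x, y} \<in> E'"
    then show "nsmooth (P n x - P n y)"
      using edge_cases[of x y] sva svb nsmooth_minus_commute Px old fw_rigid_nsmooth[OF p] by metis
  next
    fix x y and z :: 'a assume "{x, y} \<in> E'"
    then consider "x = v" "y = a" | "x = a" "y = v" | "x = v" "y = b" | "x = b" "y = v" | "{x, y} \<in> E"
      using edge_cases by blast
    then show "(\<lambda>n. ngrad (P n x - P n y) z) \<longlonglongrightarrow> f x y z"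
    proof cases
      case 1
      then show ?thesis using lim_a by (simp add: f_def)
    next
      case 2
      have "(\<lambda>n. - ngrad (P n v - P n a) z) \<longlonglongrightarrow> - ngrad k z" by (intro tendsto_intros lim_a)
      then show ?thesis using 2 neq ngrad_minus_commute[OF sva] nsmooth_minus(2)[OF smk]
        by (simp add: f_def insert_commute)
    next
      case 3
      then show ?thesis using lim_b vab(4) neq by (simp add: f_def doubleton_eq_iff)
    next
      case 4
      have "(\<lambda>n. - ngrad (P n v - P n b) z) \<longlonglongrightarrow> - ngrad d z" by (intro tendsto_intros lim_b)
      then show ?thesis using 4 neq vab(4) ngrad_minus_commute[OF svb] nsmooth_minus(2)[OF smd]
        by (simp add: f_def doubleton_eq_iff)
    next
      case 5
      then have "x \<noteq> v" "y \<noteq> v" using old by auto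
      then show ?thesis by (simp add: f_def Px doubleton_eq_iff)
    qed
  next
    fix u x y assume flex: "\<And>x y. {x, y} \<in> E' \<Longrightarrow> f x y (u x - u y) = 0"
      and xy: "x \<in> insert v V" "y \<in> insert v V"
    have const: "u x = u y" if "x \<in> V" "y \<in> V" for x y
    proof (rule fw_rigid_flex[OF p _ that])
      fix x y assume e: "{x, y} \<in> E"
      then have "x \<noteq> v" "y \<noteq> v" using old by auto
      then have "f x y = ngrad (p x - p y)" by (simp add: f_def doubleton_eq_iff)
      then show "ngrad (p x - p y) (u x - u y) = 0" using flex[of x y] e by (simp add: E'_def)
    qed
    have "ngrad k (u v - u a) = 0" using flex[of v a] by (simp add: E'_def f_def)
    moreover have "ngrad d (u v - u b) = 0"
      using flex[of v b] vab(4) neq by (simp add: E'_def f_def doubleton_eq_iff)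
    ultimately have "u v - u a = 0" using trans const[OF vab(2,3)] by metis
    then have "u x = u a" if "x \<in> insert v V" for x
      using const[of x a] vab(2) that by (cases "x = v") auto
    then show "u x = u y" using xy by metis
  qed
  then show ?thesis unfolding E'_def grigid_def by blast
qed

text \<open>The new vertex is put on the line through \<open>a\<close> and \<open>b\<close>, so that its edges to \<open>a\<close>
  and \<open>b\<close> together impose the constraint of the edge \<open>ab\<close> they replace.\<close>

lemma grigid_1_extension:
  assumes plane: "normed_plane TYPE('a::real_normed_vector)" and graph: "simple_graph V E"
    and rig: "grigid TYPE('a) V (insert {a, b} E)" and v: "v \<notin> V"
    and abc: "a \<in> V" "b \<in> V" "c \<in> V" "a \<noteq> b" "a \<noteq> c" "b \<noteq> c"
  shows "grigid TYPE('a) (insert v V) (insert {v, a} (insert {v, b} (insert {v, c} E)))"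
proof -
  obtain p0 :: "'b \<Rightarrow> 'a" where p0: "fw_rigid V (insert {a, b} E) p0"
    using rig unfolding grigid_def by blast
  define d where "d = p0 b - p0 a"
  have d: "nsmooth d" unfolding d_def using fw_rigid_nsmooth[OF p0, of b a] by (simp add: insert_commute)
  obtain z where z: "nsmooth z" "indep2 z d" using exists_nsmooth_indep2[OF plane nsmooth_nonzero[OF d]] .
  obtain \<alpha> \<beta> where ab: "p0 c - p0 a = \<alpha> *\<^sub>R z + \<beta> *\<^sub>R d" using plane_coords[OF plane z(2)] .
  have graph': "simple_graph V (insert {a, b} E)"
    using graph abc unfolding simple_graph_def by blast
  \<comment> \<open>The component of \<open>c - a\<close> along \<open>z\<close> becomes
    \<open>\<alpha> + \<epsilon>\<close>; keeping it nonzero puts \<open>c\<close> off the line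
    through \<open>a\<close> and \<open>b\<close>.\<close>
  obtain \<epsilon> where e: "\<epsilon> \<notin> {- \<alpha>}" and p: "fw_rigid V (insert {a, b} E) (p0(c := p0 c + \<epsilon> *\<^sub>R z))"
    (is "fw_rigid _ _ ?p")
    using move_vertex[OF plane graph' p0 z(1), of "{- \<alpha>}"] by auto
  define p where "p = ?p"
  have rigp: "fw_rigid V (insert {a, b} E) p" unfolding p_def by (rule p)
  have dp: "p b - p a = d" using abc by (simp add: p_def d_def)
  define x where "x = p c - p a"
  have "x = (\<alpha> + \<epsilon>) *\<^sub>R z + \<beta> *\<^sub>R d"
    using ab abc by (simp add: x_def p_def algebra_simps)
  then have "indep2 x d"
    using z(2) e indep2_add_multiple[of "(\<alpha> + \<epsilon>) *\<^sub>R z" d \<beta>] indep2_scale[of d z "\<alpha> + \<epsilon>"]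
      indep2_commute by (metis add_eq_0_iff singletonI)
  \<comment> \<open>With \<open>v\<close> placed at \<open>p a - t *\<^sub>R d\<close>, the values 0
    and -1 would put it on \<open>a\<close> or on \<open>b\<close>. Transversality of the functional
    of the edge to \<open>c\<close> pins down \<open>u v\<close> once \<open>u\<close> is constant
    on \<open>V\<close>.\<close>
  then obtain t where t: "t \<notin> {0, -1}" "nsmooth (x + t *\<^sub>R d)"
      "\<And>w. ngrad d w = 0 \<Longrightarrow> ngrad (x + t *\<^sub>R d) w = 0 \<Longrightarrow> w = 0"
    using transversal_smooth_point[OF plane d, of x "{0, -1}"] by auto
  define q where "q = p(v := p a - t *\<^sub>R d)"
  have neq: "a \<noteq> v" "b \<noteq> v" "c \<noteq> v" using v abc by auto
  define E' where "E' = insert {v, a} (insert {v, b} (insert {v, c} E))"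
  have old: "x \<noteq> v \<and> y \<noteq> v" if "{x, y} \<in> E" for x y
    using simple_graph_edge[OF graph that] v by auto
  have qx: "y \<noteq> v \<Longrightarrow> q y = p y" for y by (simp add: q_def)
  have va: "q v - q a = (- t) *\<^sub>R d" using neq by (simp add: q_def)
  have vb: "q v - q b = (- (t + 1)) *\<^sub>R d" using neq dp by (simp add: q_def algebra_simps)
  have vc: "q c - q v = x + t *\<^sub>R d" using neq by (simp add: q_def x_def)
  have nz: "- t \<noteq> 0" "- (t + 1) \<noteq> 0" using t(1) by auto
  have sva: "nsmooth (q v - q a)" unfolding va by (rule nsmooth_scale(1)[OF d nz(1)])
  have svb: "nsmooth (q v - q b)" unfolding vb by (rule nsmooth_scale(1)[OF d nz(2)])
  have svc: "nsmooth (q v - q c)" using t(2) vc nsmooth_minus_commute by metis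
  have edge_cases: "(x = v \<and> y \<in> {a, b, c}) \<or> (x \<in> {a, b, c} \<and> y = v) \<or> {x, y} \<in> E"
    if "{x, y} \<in> E'" for x y
    using that unfolding E'_def by (auto simp: doubleton_eq_iff)
  have "fw_rigid (insert v V) E' q"
  proof (rule fw_rigidI)
    fix x y assume "{x, y} \<in> E'"
    then consider "x = v" "y \<in> {a, b, c}" | "x \<in> {a, b, c}" "y = v" | "{x, y} \<in> E"
      using edge_cases by blast
    then show "nsmooth (q x - q y)"
    proof cases
      case 1 then show ?thesis using sva svb svc by auto
    next
      case 2 then show ?thesis using sva svb svc nsmooth_minus_commute by blast
    next
      case 3
      then show ?thesis using old[OF 3] fw_rigid_nsmooth[OF rigp, of x y] by (simp add: qx)
    qed
  next
    fix u x y assume flex: "\<And>x y. {x, y} \<in> E' \<Longrightarrow> ngrad (q x - q y) (u x - u y) = 0"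
      and xy: "x \<in> insert v V" "y \<in> insert v V"
    have da: "ngrad d (u v - u a) = 0"
      using flex[of v a] nsmooth_scale(2)[OF d nz(1)] nz(1) by (simp add: E'_def va sgn_zero_iff)
    have db: "ngrad d (u v - u b) = 0"
      using flex[of v b] nsmooth_scale(2)[OF d nz(2)] nz(2) by (simp add: E'_def vb sgn_zero_iff)
    have dab: "ngrad d (u b - u a) = 0"
    proof -
      have "u b - u a = (u v - u a) - (u v - u b)" by simp
      then show ?thesis using da db nsmooth_linear[OF d] by (metis diff_zero linear_diff)
    qed
    have const: "u x = u y" if "x \<in> V" "y \<in> V" for x y
    proof (rule fw_rigid_flex[OF rigp _ that])
      fix x y assume "{x, y} \<in> insert {a, b} E"
      then consider "x = b" "y = a" | "x = a" "y = b" | "{x, y} \<in> E" by (auto simp: doubleton_eq_iff)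
      then show "ngrad (p x - p y) (u x - u y) = 0"
      proof cases
        case 1 then show ?thesis using dab dp by simp
      next
        case 2
        have "ngrad (p a - p b) (u a - u b) = - ngrad (p b - p a) (u a - u b)"
          by (rule ngrad_minus_commute) (simp add: dp d)
        also have "\<dots> = ngrad (p b - p a) (u b - u a)"
          using ngrad_minus_arg[of "p b - p a" "u b - u a"] by (simp add: dp d)
        finally show ?thesis using 2 dab dp by simp
      next
        case 3
        then show ?thesis using flex[of x y] old[OF 3] by (simp add: E'_def qx)
      qed
    qed
    have "ngrad (q c - q v) (u c - u v) = 0"
      using flex[of c v] by (simp add: E'_def insert_commute)
    moreover have "ngrad d (u c - u v) = 0"
      using da const[of c a] abc ngrad_minus_arg[OF d, of "u v - u a"] by simp
    ultimately have "u c - u v = 0" using t(3) unfolding vc by blast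
    then have "u x = u a" if "x \<in> insert v V" for x using const abc that by (metis eq_iff_diff_eq_0 insertE)
    then show "u x = u y" using xy by metis
  qed
  then show ?thesis unfolding E'_def by (rule grigidI)
qed

definition collapse :: "'v set \<Rightarrow> 'v \<Rightarrow> 'v \<Rightarrow> 'v" where
  "collapse H h v = (if v \<in> H then h else v)"

text \<open>A small copy of a rigid framework on \<open>H\<close> is put in the place of \<open>h\<close>.\<close>

lemma grigid_substitution:
  assumes plane: "normed_plane TYPE('a::real_normed_vector)" and graph: "simple_graph V E"
    and H: "h \<in> H" "H \<subseteq> V"
    and inner: "grigid TYPE('a) H {e \<in> E. e \<subseteq> H}"
    and outer: "grigid TYPE('a) (insert h (V - H)) ((\<lambda>e. collapse H h ` e) ` {e \<in> E. \<not> e \<subseteq> H})"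
  shows "grigid TYPE('a) V E"
proof -
  let ?r = "collapse H h"
  obtain p :: "'b \<Rightarrow> 'a" where p: "fw_rigid H {e \<in> E. e \<subseteq> H} p"
    using inner unfolding grigid_def by blast
  obtain q :: "'b \<Rightarrow> 'a" where q: "fw_rigid (insert h (V - H)) ((\<lambda>e. ?r ` e) ` {e \<in> E. \<not> e \<subseteq> H}) q"
    using outer unfolding grigid_def by blast
  have fin: "finite V" using graph unfolding simple_graph_def by blast
  have smq: "nsmooth (q (?r v) - q (?r w))" if "{v, w} \<in> E" "\<not> {v, w} \<subseteq> H" for v w
  proof (rule fw_rigid_nsmooth[OF q])
    show "{?r v, ?r w} \<in> (\<lambda>e. ?r ` e) ` {e \<in> E. \<not> e \<subseteq> H}"
      using that by (intro image_eqI[of _ _ "{v, w}"]) auto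
  qed
  define bad where "bad = (\<Union>(v, w)\<in>{(v, w). {v, w} \<in> E \<and> v \<in> H \<and> w \<notin> H}. {t. \<not> nsmooth (q h - q w + t *\<^sub>R p v)})"
  have "countable bad" unfolding bad_def
  proof (rule countable_UN)
    have "{(v, w). {v, w} \<in> E \<and> v \<in> H \<and> w \<notin> H} \<subseteq> V \<times> V"
      using simple_graph_edge[OF graph] by blast
    then show "countable {(v, w). {v, w} \<in> E \<and> v \<in> H \<and> w \<notin> H}"
      using fin by (meson countable_finite finite_SigmaI finite_subset)
    fix e assume "e \<in> {(v, w). {v, w} \<in> E \<and> v \<in> H \<and> w \<notin> H}"
    then obtain v w where e: "e = (v, w)" and vw: "{v, w} \<in> E" "v \<in> H" "w \<notin> H" by auto
    have "nsmooth (q h - q w)" using smq[OF vw(1)] vw by (simp add: collapse_def)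
    then show "countable (case e of (v, w) \<Rightarrow> {t. \<not> nsmooth (q h - q w + t *\<^sub>R p v)})"
      unfolding e by (simp add: countable_not_nsmooth_ray[OF plane])
  qed
  then obtain \<delta> where del: "\<delta> \<longlonglongrightarrow> 0" "\<And>n::nat. \<delta> n > 0" "\<And>n. \<delta> n \<notin> bad"
    using null_sequence_avoiding_countable by metis
  define P where "P = (\<lambda>n v. if v \<in> H then q h + \<delta> n *\<^sub>R p v else q v)"
  \<comment> \<open>The copy of \<open>H\<close> collapses to a point, but scaling by
    \<open>\<delta> n > 0\<close> does not change the functionals of its edges. The remaining edges
    tend to edges of the quotient framework.\<close>
  define f where "f = (\<lambda>v w. if {v, w} \<subseteq> H then ngrad (p v - p w) else ngrad (q (?r v) - q (?r w)))"
  have conv: "(\<lambda>n. P n v) \<longlonglongrightarrow> q (?r v)" for v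
  proof (cases "v \<in> H")
    case True
    have "(\<lambda>n. q h + \<delta> n *\<^sub>R p v) \<longlonglongrightarrow> q h + 0 *\<^sub>R p v" by (intro tendsto_intros del(1))
    then show ?thesis using True by (simp add: P_def collapse_def)
  qed (simp add: P_def collapse_def)
  have Pin: "P n v - P n w = \<delta> n *\<^sub>R (p v - p w)" if "{v, w} \<subseteq> H" for n v w
    using that by (simp add: P_def algebra_simps)
  have cross: "nsmooth (P n v - P n w)" if "{v, w} \<in> E" "v \<in> H" "w \<notin> H" for n v w
  proof -
    have "nsmooth (q h - q w + \<delta> n *\<^sub>R p v)" using del(3)[of n] that unfolding bad_def by blast
    then show ?thesis using that by (simp add: P_def algebra_simps)
  qed
  have smP: "nsmooth (P n v - P n w)" if vw: "{v, w} \<in> E" for n v w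
  proof -
    consider "{v, w} \<subseteq> H" | "v \<in> H" "w \<notin> H" | "w \<in> H" "v \<notin> H" | "v \<notin> H" "w \<notin> H" by blast
    then show ?thesis
    proof cases
      case 1
      have "nsmooth (p v - p w)" using fw_rigid_nsmooth[OF p] vw 1 by blast
      then show ?thesis using Pin[OF 1] nsmooth_scale(1)[of "p v - p w" "\<delta> n"] del(2)[of n] by simp
    next
      case 2 then show ?thesis using cross vw by blast
    next
      case 3
      then have "nsmooth (P n w - P n v)" using cross vw by (simp add: insert_commute)
      then show ?thesis using nsmooth_minus_commute by blast
    next
      case 4
      then show ?thesis using smq[OF vw] by (simp add: P_def collapse_def)
    qed
  qed
  have "\<exists>n. fw_rigid V E (P n)"
  proof (rule rigid_limit[OF plane graph smP, where f = f])
    fix v w and z :: 'a assume vw: "{v, w} \<in> E"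
    show "(\<lambda>n. ngrad (P n v - P n w) z) \<longlonglongrightarrow> f v w z"
    proof (cases "{v, w} \<subseteq> H")
      case True
      have s: "nsmooth (p v - p w)" using fw_rigid_nsmooth[OF p] vw True by blast
      have "ngrad (P n v - P n w) z = ngrad (p v - p w) z" for n
        unfolding Pin[OF True] using nsmooth_scale(2)[OF s] del(2)[of n] by simp
      then show ?thesis using True by (simp add: f_def)
    next
      case False
      have "(\<lambda>n. ngrad (P n v - P n w) z) \<longlonglongrightarrow> ngrad (q (?r v) - q (?r w)) z"
        by (rule ngrad_tendsto[OF smq[OF vw False] smP[OF vw]]) (intro tendsto_intros conv)
      then show ?thesis using False unfolding f_def by (simp only: if_False)
    qed
  next
    fix u v w assume flex: "\<And>v w. {v, w} \<in> E \<Longrightarrow> f v w (u v - u w) = 0"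
      and vw: "v \<in> V" "w \<in> V"
    have constH: "u x = u y" if "x \<in> H" "y \<in> H" for x y
    proof (rule fw_rigid_flex[OF p _ that])
      fix x y assume "{x, y} \<in> {e \<in> E. e \<subseteq> H}"
      then show "ngrad (p x - p y) (u x - u y) = 0" using flex[of x y] by (simp add: f_def)
    qed
    have ur: "u (?r x) = u x" for x using constH[OF H(1)] by (simp add: collapse_def)
    have "u x = u y" if "x \<in> insert h (V - H)" "y \<in> insert h (V - H)" for x y
    proof (rule fw_rigid_flex[OF q _ that])
      fix x y assume "{x, y} \<in> (\<lambda>e. ?r ` e) ` {e \<in> E. \<not> e \<subseteq> H}"
      then obtain e where e: "e \<in> E" "\<not> e \<subseteq> H" "{x, y} = ?r ` e" by blast
      obtain s t where st: "e = {s, t}" using e(1) graph unfolding simple_graph_def by blast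
      have "{x, y} = {?r s, ?r t}" using e(3) st by simp
      then obtain s' t' where s': "e = {s', t'}" "x = ?r s'" "y = ?r t'"
        using st by (metis doubleton_eq_iff insert_commute)
      have "ngrad (q (?r s') - q (?r t')) (u s' - u t') = 0"
        using flex[of s' t'] e s'(1) unfolding f_def by (simp only: if_False)
      then show "ngrad (q x - q y) (u x - u y) = 0" by (simp add: s' ur)
    qed
    moreover have "?r v \<in> insert h (V - H)" "?r w \<in> insert h (V - H)"
      using vw by (auto simp: collapse_def)
    ultimately show "u v = u w" using ur by metis
  qed
  then show ?thesis unfolding grigid_def by blast
qed

subsection \<open>Parallelograms\<close>

lemma ngrad_kernel_multiple:
  fixes x k w :: "'a::real_normed_vector"
  assumes plane: "normed_plane TYPE('a)" and x: "nsmooth x"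
    and k: "ngrad x k = 0" "k \<noteq> 0" and w: "ngrad x w = 0"
  obtains c where "w = c *\<^sub>R k"
proof -
  have "indep2 x k"
  proof (rule ccontr)
    assume "\<not> ?thesis"
    then obtain c where "x = c *\<^sub>R k" using not_indep2E k(2) by blast
    then have "ngrad x x = 0" using k(1) nsmooth_linear[OF x] by (metis linear_scale scaleR_zero_right)
    then show False using ngrad_self[OF x] nsmooth_nonzero[OF x] by simp
  qed
  then obtain a b where ab: "w = a *\<^sub>R x + b *\<^sub>R k" using plane_coords[OF plane] by blast
  then have "ngrad x w = a * norm x"
    using ngrad_self[OF x] k(1) nsmooth_linear[OF x] by (simp add: linear_add linear_scale)
  then have "a = 0" using w nsmooth_nonzero[OF x] by simp
  then have "w = b *\<^sub>R k" using ab by simp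
  then show thesis by (rule that)
qed

definition K4_edges :: "'v \<Rightarrow> 'v \<Rightarrow> 'v \<Rightarrow> 'v \<Rightarrow> 'v set set" where
  "K4_edges v a b c = {{v, a}, {v, b}, {v, c}, {a, b}, {a, c}, {b, c}}"

text \<open>Opposite sides have the same functional. Relative to \<open>v\<close>, a flex moves
  \<open>a\<close> by a multiple \<open>\<tau>\<close> of \<open>kx\<close>, \<open>c\<close> by a
  multiple \<open>\<sigma>\<close> of \<open>ky\<close>, and \<open>b\<close> by the sum of both,
  because the kernels of the sides meet only in zero. The diagonals give two linear equations for
  \<open>\<tau>\<close> and \<open>\<sigma>\<close>. Up to sign their determinant is the expression
  in \<open>neq\<close>; its vanishing says that the kernels at \<open>x + y\<close> and
  \<open>x - y\<close> are harmonic with respect to \<open>kx\<close> and \<open>ky\<close>.\<close>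

lemma parallelogram_rigid:
  fixes x y kx ky :: "'a::real_normed_vector"
  assumes plane: "normed_plane TYPE('a)" and dist: "distinct [v, a, b, c]"
    and nsmooth: "nsmooth x" "nsmooth y" "nsmooth (x + y)" "nsmooth (x - y)"
    and indep: "\<And>w. ngrad x w = 0 \<Longrightarrow> ngrad y w = 0 \<Longrightarrow> w = 0"
    and kx: "kx \<noteq> 0" "ngrad x kx = 0" and ky: "ky \<noteq> 0" "ngrad y ky = 0"
    and neq: "ngrad (x + y) kx * ngrad (x - y) ky + ngrad (x + y) ky * ngrad (x - y) kx \<noteq> 0"
  shows "grigid TYPE('a) {v, a, b, c} (K4_edges v a b c)"
proof -
  define p where "p = (\<lambda>i. if i = a then x else if i = b then x + y else if i = c then y else 0)"
  have p: "p v = 0" "p a = x" "p b = x + y" "p c = y" using dist by (auto simp: p_def)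
  have nsmooth': "nsmooth (p a - p v)" "nsmooth (p c - p v)" "nsmooth (p b - p v)" "nsmooth (p b - p a)" "nsmooth (p b - p c)" "nsmooth (p a - p c)"
    using nsmooth by (simp_all add: p)
  have "fw_rigid {v, a, b, c} (K4_edges v a b c) p"
  proof (rule fw_rigidI)
    fix i j assume "{i, j} \<in> K4_edges v a b c"
    then show "nsmooth (p i - p j)"
      using nsmooth' nsmooth'[unfolded nsmooth_minus_commute[of "p _" "p _"]]
      unfolding K4_edges_def by (auto simp: doubleton_eq_iff nsmooth_minus_commute)
  next
    fix u :: "_ \<Rightarrow> 'a" and i j
    assume flex: "\<And>i j. {i, j} \<in> K4_edges v a b c \<Longrightarrow> ngrad (p i - p j) (u i - u j) = 0"
      and ij: "i \<in> {v, a, b, c}" "j \<in> {v, a, b, c}"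
    have va: "ngrad x (u a - u v) = 0" using flex[of a v] by (simp add: p K4_edges_def insert_commute)
    have vc: "ngrad y (u c - u v) = 0" using flex[of c v] by (simp add: p K4_edges_def insert_commute)
    have ba: "ngrad y (u b - u a) = 0" using flex[of b a] by (simp add: p K4_edges_def insert_commute)
    have bc: "ngrad x (u b - u c) = 0" using flex[of b c] by (simp add: p K4_edges_def insert_commute)
    have bv: "ngrad (x + y) (u b - u v) = 0" using flex[of b v] by (simp add: p K4_edges_def insert_commute)
    have ac: "ngrad (x - y) (u a - u c) = 0" using flex[of a c] by (simp add: p K4_edges_def insert_commute)
    obtain \<tau> where tau: "u a - u v = \<tau> *\<^sub>R kx" using ngrad_kernel_multiple[OF plane nsmooth(1) kx(2,1) va] .
    obtain \<sigma> where sigma: "u c - u v = \<sigma> *\<^sub>R ky" using ngrad_kernel_multiple[OF plane nsmooth(2) ky(2,1) vc] .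
    have "u b - u v - (u a - u v) - (u c - u v) = 0"
    proof (rule indep)
      have "u b - u v - (u a - u v) - (u c - u v) = (u b - u c) - (u a - u v)" by simp
      then show "ngrad x (u b - u v - (u a - u v) - (u c - u v)) = 0"
        using bc va linear_diff[OF nsmooth_linear[OF nsmooth(1)]] by simp
      have "u b - u v - (u a - u v) - (u c - u v) = (u b - u a) - (u c - u v)" by simp
      then show "ngrad y (u b - u v - (u a - u v) - (u c - u v)) = 0"
        using ba vc linear_diff[OF nsmooth_linear[OF nsmooth(2)]] by simp
    qed
    then have b: "u b - u v = \<tau> *\<^sub>R kx + \<sigma> *\<^sub>R ky" using tau sigma by (simp add: algebra_simps)
    have ac': "u a - u c = \<tau> *\<^sub>R kx - \<sigma> *\<^sub>R ky" using tau sigma by (simp add: algebra_simps)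
    have e1: "\<tau> * ngrad (x + y) kx + \<sigma> * ngrad (x + y) ky = 0"
      using bv unfolding b using nsmooth_linear[OF nsmooth(3)] by (simp add: linear_add linear_scale)
    have e2: "\<tau> * ngrad (x - y) kx - \<sigma> * ngrad (x - y) ky = 0"
      using ac unfolding ac' using nsmooth_linear[OF nsmooth(4)] by (simp add: linear_diff linear_scale)
    let ?N = "ngrad (x + y) kx * ngrad (x - y) ky + ngrad (x + y) ky * ngrad (x - y) kx"
    have "\<tau> * ?N = ngrad (x - y) ky * (\<tau> * ngrad (x + y) kx + \<sigma> * ngrad (x + y) ky)
        + ngrad (x + y) ky * (\<tau> * ngrad (x - y) kx - \<sigma> * ngrad (x - y) ky)" by (simp add: algebra_simps)
    then have "\<tau> = 0" using neq by (simp add: e1 e2)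
    have "\<sigma> * ?N = ngrad (x - y) kx * (\<tau> * ngrad (x + y) kx + \<sigma> * ngrad (x + y) ky)
        - ngrad (x + y) kx * (\<tau> * ngrad (x - y) kx - \<sigma> * ngrad (x - y) ky)" by (simp add: algebra_simps)
    then have "\<sigma> = 0" using neq by (simp add: e1 e2)
    have "u a = u v" "u b = u v" "u c = u v" using tau sigma b \<open>\<tau> = 0\<close> \<open>\<sigma> = 0\<close> by auto
    then show "u i = u j" using ij by auto
  qed
  then show ?thesis by (rule grigidI)
qed

subsection \<open>The norm along a line\<close>

text \<open>\<open>h t\<close> is the norm of \<open>e + t y\<close>, and \<open>m t\<close>, \<open>r t\<close> are the values of the norming
  functional at \<open>e + t y\<close> on \<open>e\<close> and \<open>y\<close>, for \<open>t\<close> in the set \<open>D\<close> of smooth parameters.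
  Divided by the three values of \<open>m\<close>, the assumption \<open>harmonic\<close> is Jensen's equation for \<open>r / m\<close>.\<close>

locale norm_on_line =
  fixes D :: "real set" and h r m :: "real \<Rightarrow> real" and C :: real
  assumes codense: "countable (- D)"
    and C_pos: "C > 0"
    and h_pos: "h t > 0"
    and h_ge: "h t \<ge> C * \<bar>t\<bar>"
    and h_lipschitz: "\<bar>h t - h s\<bar> \<le> C * \<bar>t - s\<bar>"
    and h_eq: "t \<in> D \<Longrightarrow> h t = m t + t * r t"
    and tangent: "t \<in> D \<Longrightarrow> h s \<ge> m t + s * r t"
    and r_le: "t \<in> D \<Longrightarrow> \<bar>r t\<bar> \<le> C"
    and harmonic: "\<lbrakk>t \<in> D; t + s \<in> D; t - s \<in> D; s \<noteq> 0; m t \<noteq> 0\<rbrakk> \<Longrightarrow>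
      2 * m (t + s) * m (t - s) * r t = m t * (r (t + s) * m (t - s) + r (t - s) * m (t + s))"
begin

text \<open>Replacing \<open>y\<close> by \<open>- y\<close> reverses the line. This carries
  statements about positive parameters over to negative ones.\<close>

lemma reflected: "norm_on_line (uminus ` D) (\<lambda>t. h (- t)) (\<lambda>t. - r (- t)) (\<lambda>t. m (- t)) C"
proof
  have "- (uminus ` D) = uminus ` (- D)" by (metis bij_image_Compl_eq bij_uminus)
  then show "countable (- (uminus ` D))" using codense by simp
  show "2 * m (- (t + s)) * m (- (t - s)) * - r (- t) =
        m (- t) * (- r (- (t + s)) * m (- (t - s)) + - r (- (t - s)) * m (- (t + s)))"
    if "t \<in> uminus ` D" "t + s \<in> uminus ` D" "t - s \<in> uminus ` D" "s \<noteq> 0" "m (- t) \<noteq> 0" for t s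
  proof -
    have minus: "x \<in> uminus ` D \<longleftrightarrow> - x \<in> D" for x
      by (metis image_iff minus_minus)
    have "- t \<in> D" "- t + - s \<in> D" "- t - - s \<in> D"
      using that(1-3)[unfolded minus] by (simp_all add: algebra_simps)
    then have "2 * m (- t + - s) * m (- t - - s) * r (- t) =
        m (- t) * (r (- t + - s) * m (- t - - s) + r (- t - - s) * m (- t + - s))"
      using that by (intro harmonic) auto
    then show ?thesis by (simp add: algebra_simps)
  qed
  show "\<bar>h (- t) - h (- s)\<bar> \<le> C * \<bar>t - s\<bar>" for t s
    using h_lipschitz[of "- t" "- s"] by (simp add: abs_minus_commute)
  show "h (- s) \<ge> m (- t) + s * - r (- t)" if "t \<in> uminus ` D" for s t
    using tangent[of "- t" "- s"] that by auto
  show "C * \<bar>t\<bar> \<le> h (- t)" for t using h_ge[of "- t"] by simp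
qed (use C_pos h_pos h_eq r_le in auto)

lemma r_mono:
  assumes "s \<in> D" "t \<in> D" "s \<le> t" shows "r s \<le> r t"
proof (cases "s = t")
  case False
  have "(r t - r s) * (t - s) \<ge> 0"
    using tangent[OF assms(1), of t] tangent[OF assms(2), of s] h_eq[OF assms(1)] h_eq[OF assms(2)]
    by (simp add: algebra_simps)
  then show ?thesis using False assms(3) by (simp add: zero_le_mult_iff)
qed simp

lemma m_nonneg:
  assumes "t \<in> D" shows "m t \<ge> 0"
proof -
  have "t * r t \<le> \<bar>t\<bar> * \<bar>r t\<bar>" by (metis abs_ge_self abs_mult)
  also have "\<dots> \<le> \<bar>t\<bar> * C" using r_le[OF assms] by (simp add: mult_left_mono)
  finally show ?thesis using h_eq[OF assms] h_ge[of t] by (simp add: mult.commute)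
qed

text \<open>A zero of \<open>m\<close> would mean that \<open>e + z y\<close> shares its norming
  functional with \<open>y\<close>, a flat piece of the unit sphere. Zeros of \<open>m\<close>, the
  intercept of the tangent, propagate to the right, so they fill everything in \<open>D\<close>
  beyond some \<open>T\<close>. With \<open>t - s\<close> and \<open>t\<close> before
  \<open>T\<close> and \<open>t + s\<close> behind it, a single term of \<open>harmonic\<close>
  survives and forces \<open>r (t + s) = 0\<close>, hence \<open>h (t + s) = 0\<close>.\<close>

lemma m_pos_right:
  assumes z: "z \<in> D" "z > 0" shows "m z \<noteq> 0"
proof
  assume mz: "m z = 0"
  define Z where "Z = {t \<in> D. t > 0 \<and> m t = 0}"
  \<comment> \<open>If \<open>m t = 0\<close> and \<open>t > 0\<close>, then
    \<open>h t = t * r t \<le> C * t\<close>; together with \<open>h 0 \<le> h t + C * t\<close>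
    this gives \<open>t \<ge> h 0 / (2 * C)\<close>.\<close>
  define c where "c = h 0 / (2 * C)"
  have c: "c > 0" using h_pos[of 0] C_pos by (simp add: c_def)
  have zZ: "z \<in> Z" using z mz by (simp add: Z_def)
  have lower: "t \<ge> c" if "t \<in> Z" for t
  proof (rule ccontr)
    assume "\<not> t \<ge> c"
    then have t: "t \<in> D" "t > 0" "m t = 0" "t < c" using that by (auto simp: Z_def)
    have "h t \<le> t * C" using h_eq[OF t(1)] t r_le[OF t(1)] by (simp add: mult_left_mono)
    moreover have "h 0 \<le> h t + C * t" using h_lipschitz[of 0 t] t by simp
    ultimately have "h 0 \<le> 2 * C * t" by (simp add: algebra_simps)
    also have "\<dots> < 2 * C * c" using t C_pos by simp
    finally show False using C_pos by (simp add: c_def)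
  qed
  define T where "T = Inf Z"
  have bdd: "bdd_below Z" using lower by (rule bdd_belowI)
  have T: "T \<ge> c" unfolding T_def using zZ lower by (intro cInf_greatest) auto
  have up: "m t = 0" if "t \<in> D" "t > T" for t
  proof -
    obtain s where s: "s \<in> Z" "s < t" using cInf_lessD[of Z t] zZ \<open>t > T\<close> unfolding T_def by auto
    then have sD: "s \<in> D" "s > 0" "m s = 0" by (auto simp: Z_def)
    have "s * (r t - r s) \<ge> 0" using r_mono[OF sD(1) that(1)] s sD by simp
    then have "m t \<le> 0"
      using tangent[OF that(1), of s] h_eq[OF sD(1)] sD(3) by (simp add: algebra_simps)
    then show ?thesis using m_nonneg[OF that(1)] by simp
  qed
  have down: "m t \<noteq> 0" if "t \<in> D" "0 < t" "t < T" for t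
    using cInf_lower[OF _ bdd, of t] that unfolding T_def Z_def by auto
  \<comment> \<open>As \<open>T \<ge> c\<close>, margins of \<open>c / 4\<close> in the choices of
    \<open>t\<close> and \<open>s\<close> keep \<open>t - s\<close> positive, as \<open>down\<close>
    requires.\<close>
  obtain t where t: "T - c / 4 < t" "t < T" "t \<notin> - D"
    using exists_between_avoiding_countable[OF codense, of "T - c / 4" T] c by auto
  have "countable ((\<lambda>x. x - t) ` (- D) \<union> (\<lambda>x. t - x) ` (- D))" using codense by simp
  then obtain s where s: "T - t < s" "s < T - t + c / 4"
      "s \<notin> (\<lambda>x. x - t) ` (- D) \<union> (\<lambda>x. t - x) ` (- D)"
    using exists_between_avoiding_countable[of _ "T - t" "T - t + c / 4"] c by (metis less_add_same_cancel1 zero_less_divide_iff zero_less_numeral)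
  have D: "t \<in> D" "t + s \<in> D" "t - s \<in> D"
    using t(3) s(3) by (auto simp: image_iff) (smt (verit) ComplI)+
  have pos: "0 < t" "t + s > T" "0 < t - s" "t - s < T" "s > 0" using t s T c by auto
  have mt: "m t \<noteq> 0" "m (t - s) \<noteq> 0" "m (t + s) = 0"
    using down up D pos t by auto
  have "m t * (r (t + s) * m (t - s)) = 0"
    using harmonic[OF D] pos mt by simp
  then have "r (t + s) = 0" using mt by simp
  then show False using h_eq[OF D(2)] h_pos[of "t + s"] mt by simp
qed

lemma m_pos:
  assumes "t \<in> D" shows "m t > 0"
proof -
  interpret refl: norm_on_line "uminus ` D" "\<lambda>t. h (- t)" "\<lambda>t. - r (- t)" "\<lambda>t. m (- t)" C
    by (rule reflected)
  consider "t > 0" | "t = 0" | "t < 0" by linarith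
  then have "m t \<noteq> 0"
  proof cases
    case 1 then show ?thesis using m_pos_right assms by blast
  next
    case 2 then show ?thesis using h_eq[OF assms] h_pos[of 0] by auto
  next
    case 3 then show ?thesis using refl.m_pos_right[of "- t"] assms by auto
  qed
  then show ?thesis using m_nonneg[OF assms] by simp
qed

section \<open>Jensen's equation for the slope \<open>r / m\<close>\<close>

lemma jensen:
  assumes "t \<in> D" "t + s \<in> D" "t - s \<in> D"
  shows "r (t + s) / m (t + s) + r (t - s) / m (t - s) = 2 * (r t / m t)"
proof (cases "s = 0")
  case False
  have pos: "m t > 0" "m (t + s) > 0" "m (t - s) > 0" using assms m_pos by auto
  then show ?thesis using harmonic[OF assms False] by (simp add: field_simps)
qed simp

text \<open>The norming functional turns in one sense along the line. The tangents at
  \<open>s\<close> and \<open>t\<close> bound \<open>m s - m t\<close> by multiples of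
  \<open>r t - r s\<close>, so that \<open>r t * m s - r s * m t\<close> is at least
  \<open>(r t - r s) * h s\<close> or \<open>(r t - r s) * h t\<close>, unless the signs of
  \<open>r s\<close> and \<open>r t\<close> already decide.\<close>

lemma slope_mono:
  assumes "s \<in> D" "t \<in> D" "s \<le> t" shows "r s / m s \<le> r t / m t"
proof -
  have m: "m s > 0" "m t > 0" using assms m_pos by auto
  have r: "r t - r s \<ge> 0" using r_mono[OF assms] by simp
  have a: "m s - m t \<ge> s * (r t - r s)"
    using tangent[OF assms(2), of s] h_eq[OF assms(1)] by (simp add: algebra_simps)
  have b: "m s - m t \<le> t * (r t - r s)"
    using tangent[OF assms(1), of t] h_eq[OF assms(2)] by (simp add: algebra_simps)
  have "r s * m t \<le> r t * m s"
  proof -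
    consider "r s \<ge> 0" | "r t \<le> 0" | "r s < 0" "r t > 0" by linarith
    then show ?thesis
    proof cases
      case 1
      have "r s * (m s - m t) \<ge> r s * (s * (r t - r s))" using a 1 by (rule mult_left_mono)
      moreover have "(r t - r s) * h s \<ge> 0" using r h_pos[of s] by simp
      ultimately show ?thesis using h_eq[OF assms(1)] by (simp add: algebra_simps)
    next
      case 2
      have "r t * (m s - m t) \<ge> r t * (t * (r t - r s))" using b 2 by (rule mult_left_mono_neg)
      moreover have "(r t - r s) * h t \<ge> 0" using r h_pos[of t] by simp
      ultimately show ?thesis using h_eq[OF assms(2)] by (simp add: algebra_simps)
    next
      case 3
      then have "r s * m t \<le> 0" "r t * m s \<ge> 0" using m by (auto simp: mult_nonpos_nonneg)
      then show ?thesis by simp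
    qed
  qed
  then show ?thesis using m by (simp add: field_simps)
qed

text \<open>On a rational grid inside \<open>D\<close>, Jensen's equation makes \<open>r / m\<close>
  an arithmetic progression. Monotonicity, in place of continuity, extends the formula to the rest
  of \<open>D\<close>.\<close>

lemma slope_affine: "\<exists>\<alpha> \<beta>. \<forall>t\<in>D. r t = (\<alpha> * t + \<beta>) * m t"
proof -
  define g where "g = (\<lambda>t. r t / m t)"
  obtain t1 where t1: "t1 \<in> D"
    using exists_between_avoiding_countable[OF codense, of 0 1] by auto
  \<comment> \<open>An excluded point \<open>b\<close> and a rational \<open>q\<close> together rule
    out a single step width. For \<open>q = 0\<close> the quotient is 0, outside the range of
    \<open>\<delta>\<close>.\<close>
  have "countable (\<Union>q\<in>\<rat>. (\<lambda>b. (b - t1) / q) ` (- D))"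
    using codense by (intro countable_UN countable_rat) auto
  then obtain \<delta> where d: "\<delta> > 0" "\<delta> \<notin> (\<Union>q\<in>\<rat>. (\<lambda>b. (b - t1) / q) ` (- D))"
    using exists_between_avoiding_countable[of _ 0 1] by (metis zero_less_one)
  have grid: "t1 + q * \<delta> \<in> D" if "q \<in> \<rat>" for q
  proof (cases "q = 0")
    case False
    show ?thesis
    proof (rule ccontr)
      assume "t1 + q * \<delta> \<notin> D"
      moreover have "\<delta> = (t1 + q * \<delta> - t1) / q" using False by simp
      ultimately have "\<delta> \<in> (\<lambda>b. (b - t1) / q) ` (- D)" by blast
      then show False using d(2) that by blast
    qed
  qed (simp add: t1)
  define \<Delta> where "\<Delta> = g (t1 + \<delta>) - g t1"
  have step: "g (t1 + (q + e) * \<delta>) - g (t1 + q * \<delta>) = g (t1 + q * \<delta>) - g (t1 + (q - e) * \<delta>)"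
    if "q \<in> \<rat>" "e \<in> \<rat>" for q e
  proof -
    have "t1 + q * \<delta> + e * \<delta> \<in> D" "t1 + q * \<delta> - e * \<delta> \<in> D"
      using grid[of "q + e"] grid[of "q - e"] that by (simp_all add: algebra_simps)
    from jensen[OF grid[OF that(1)] this] show ?thesis by (simp add: g_def algebra_simps)
  qed
  have prog: "g (t1 + (of_nat k * e) * \<delta>) = g t1 + of_nat k * (g (t1 + e * \<delta>) - g t1)"
    if "e \<in> \<rat>" for k :: nat and e
  proof (induction k rule: less_induct)
    case (less k)
    consider "k = 0" | "k = 1" | j where "k = Suc (Suc j)" by (metis One_nat_def not0_implies_Suc)
    then show ?case
    proof cases
      case 3
      have "g (t1 + (of_nat (Suc j) * e + e) * \<delta>) - g (t1 + (of_nat (Suc j) * e) * \<delta>)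
          = g (t1 + (of_nat (Suc j) * e) * \<delta>) - g (t1 + (of_nat (Suc j) * e - e) * \<delta>)"
        using that by (intro step) auto
      moreover have "of_nat (Suc j) * e + e = of_nat k * e" "of_nat (Suc j) * e - e = of_nat j * e"
        using 3 by (simp_all add: algebra_simps)
      ultimately show ?thesis
        using less[of "Suc j"] less[of j] 3 by (simp add: algebra_simps)
    qed auto
  qed
  have rat: "g (t1 + q * \<delta>) = g t1 + q * \<Delta>" if q: "q \<in> \<rat>" for q
  proof -
    \<comment> \<open>The steps \<open>q\<close> and 1 are both multiples of the common unit
      \<open>1 / j\<close>.\<close>
    have pos: "g (t1 + q * \<delta>) = g t1 + q * \<Delta>" if q: "q \<in> \<rat>" "q > 0" for q
    proof -
      obtain i j where ij: "j > 0" "q = of_nat i / of_nat j"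
        using Rats_abs_nat_div_natE[OF q(1)] q(2) by (metis abs_of_pos not_gr0)
      have e: "1 / real j \<in> \<rat>" by simp
      define X where "X = g (t1 + (1 / j) * \<delta>) - g t1"
      have "g (t1 + \<delta>) = g t1 + j * X"
        using prog[OF e, of j] ij(1) by (simp add: X_def)
      then have "\<Delta> = j * X" by (simp add: \<Delta>_def)
      moreover have "g (t1 + q * \<delta>) = g t1 + i * X"
        using prog[OF e, of i] ij(2) by (simp add: X_def)
      ultimately show ?thesis using ij by simp
    qed
    consider "q > 0" | "q = 0" | "q < 0" by linarith
    then show ?thesis
    proof cases
      case 3
      then have "g (t1 + (- q) * \<delta>) = g t1 + (- q) * \<Delta>" using q by (intro pos) auto
      moreover have "g (t1 + (0 + - q) * \<delta>) - g (t1 + 0 * \<delta>) = g (t1 + 0 * \<delta>) - g (t1 + (0 - - q) * \<delta>)"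
        using q by (intro step) auto
      ultimately show ?thesis by simp
    qed (use pos q in auto)
  qed
  have Delta: "\<Delta> \<ge> 0"
    using slope_mono[of t1 "t1 + \<delta>"] grid[of 1] t1 d by (simp add: \<Delta>_def g_def)
  have aff: "g t = g t1 + (t - t1) / \<delta> * \<Delta>" if t: "t \<in> D" for t
  proof -
    define \<tau> where "\<tau> = (t - t1) / \<delta>"
    have tt: "t = t1 + \<tau> * \<delta>" using d by (simp add: \<tau>_def)
    define x where "x = g t - g t1"
    have lo: "q * \<Delta> \<le> x" if "q \<in> \<rat>" "q < \<tau>" for q
      using slope_mono[of "t1 + q * \<delta>" t] grid[OF that(1)] t that d rat[OF that(1)]
      by (simp add: g_def x_def tt)
    have hi: "x \<le> q * \<Delta>" if "q \<in> \<rat>" "\<tau> < q" for q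
      using slope_mono[of t "t1 + q * \<delta>"] grid[OF that(1)] t that d rat[OF that(1)]
      by (simp add: g_def x_def tt)
    have "x = \<tau> * \<Delta>"
    proof (cases "\<Delta> = 0")
      case True
      obtain q1 q2 where "q1 \<in> \<rat>" "q1 < \<tau>" "q2 \<in> \<rat>" "\<tau> < q2"
        using Rats_dense_in_real[of "\<tau> - 1" \<tau>] Rats_dense_in_real[of \<tau> "\<tau> + 1"] by auto
      then show ?thesis using lo[of q1] hi[of q2] True by simp
    next
      case False
      then have pos: "\<Delta> > 0" using Delta by simp
      show ?thesis
      proof (rule ccontr)
        assume "x \<noteq> \<tau> * \<Delta>"
        then consider "x / \<Delta> < \<tau>" | "\<tau> < x / \<Delta>" using pos by (metis linorder_neqE_linordered_idom nonzero_eq_divide_eq less_irrefl)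
        then show False
        proof cases
          case 1
          then obtain q where "q \<in> \<rat>" "x / \<Delta> < q" "q < \<tau>" using Rats_dense_in_real by blast
          then show False using lo[of q] pos by (simp add: field_simps)
        next
          case 2
          then obtain q where "q \<in> \<rat>" "\<tau> < q" "q < x / \<Delta>" using Rats_dense_in_real by blast
          then show False using hi[of q] pos by (simp add: field_simps)
        qed
      qed
    qed
    then show ?thesis by (simp add: x_def \<tau>_def)
  qed
  have "r t = (\<Delta> / \<delta> * t + (g t1 - t1 / \<delta> * \<Delta>)) * m t" if t: "t \<in> D" for t
  proof -
    have "r t = g t * m t" using m_pos[OF t] by (simp add: g_def)
    also have "g t = \<Delta> / \<delta> * t + (g t1 - t1 / \<delta> * \<Delta>)"
      using aff[OF t] by (simp add: diff_divide_distrib algebra_simps)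
    finally show ?thesis .
  qed
  then show ?thesis by blast
qed

lemma dense_le_everywhere:
  fixes F G :: "real \<Rightarrow> real"
  assumes "\<And>t. isCont F t" "\<And>t. isCont G t" "\<And>t. t \<in> D \<Longrightarrow> F t \<le> G t"
  shows "F t \<le> G t"
proof -
  have "countable ((\<lambda>x. x - t) ` (- D))" using codense by simp
  then obtain \<epsilon> where e: "\<epsilon> \<longlonglongrightarrow> 0" "\<And>n::nat. \<epsilon> n > 0" "\<And>n. \<epsilon> n \<notin> (\<lambda>x. x - t) ` (- D)"
    using null_sequence_avoiding_countable by metis
  have inD: "t + \<epsilon> n \<in> D" for n
  proof (rule ccontr)
    assume "t + \<epsilon> n \<notin> D"
    then have "\<epsilon> n \<in> (\<lambda>x. x - t) ` (- D)" by (intro image_eqI[of _ _ "t + \<epsilon> n"]) auto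
    with e(3) show False by blast
  qed
  have l: "(\<lambda>n. t + \<epsilon> n) \<longlonglongrightarrow> t" using tendsto_add[OF tendsto_const[of t] e(1)] by simp
  show ?thesis
  proof (rule LIMSEQ_le)
    show "(\<lambda>n. F (t + \<epsilon> n)) \<longlonglongrightarrow> F t" "(\<lambda>n. G (t + \<epsilon> n)) \<longlonglongrightarrow> G t"
      using assms(1,2) l isCont_tendsto_compose by blast+
    show "\<exists>N. \<forall>n\<ge>N. F (t + \<epsilon> n) \<le> G (t + \<epsilon> n)" using assms(3) inD by blast
  qed
qed

lemma h_cont: "isCont h t"
proof -
  have "(\<lambda>s. h s - h t) \<midarrow>t\<rightarrow> 0"
  proof (rule Lim_null_comparison)
    show "\<forall>\<^sub>F s in at t. norm (h s - h t) \<le> C * \<bar>s - t\<bar>" using h_lipschitz by simp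
    have "((\<lambda>s. C * \<bar>s - t\<bar>) \<longlongrightarrow> C * \<bar>t - t\<bar>) (at t)" by (intro tendsto_intros)
    then show "((\<lambda>s. C * \<bar>s - t\<bar>) \<longlongrightarrow> 0) (at t)" by simp
  qed
  then show ?thesis unfolding isCont_def by (simp add: LIM_zero_iff)
qed

end

section \<open>Integration of the equation along the line\<close>

lemma quadratic_nonneg_leading_coeff:
  fixes a b c :: real
  assumes "\<And>t. t > 0 \<Longrightarrow> a * t\<^sup>2 + b * t + c \<ge> 0"
  shows "a \<ge> 0"
proof (rule ccontr)
  assume "\<not> a \<ge> 0"
  then have a: "a < 0" by simp
  \<comment> \<open>Chosen so that \<open>a * t = a - (\<bar>b\<bar> + \<bar>c\<bar>)\<close>; as
    \<open>t \<ge> 1\<close>, the whole polynomial is then at most \<open>a * t\<close>.\<close>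
  define t where "t = 1 + (\<bar>b\<bar> + \<bar>c\<bar>) / (- a)"
  have "(\<bar>b\<bar> + \<bar>c\<bar>) / (- a) \<ge> 0" using a by (intro divide_nonneg_pos) auto
  then have t: "t \<ge> 1" unfolding t_def by simp
  have "a * t = a - (\<bar>b\<bar> + \<bar>c\<bar>)" using a by (simp add: t_def field_simps)
  then have "a * t\<^sup>2 = (a - (\<bar>b\<bar> + \<bar>c\<bar>)) * t" by (simp add: power2_eq_square)
  moreover have "b * t \<le> \<bar>b\<bar> * t" using t by (simp add: mult_right_mono)
  moreover have "c \<le> \<bar>c\<bar> * t" using t by (smt (verit) mult_left_mono mult_cancel_left2 abs_ge_zero)
  ultimately have "a * t\<^sup>2 + b * t + c \<le> a * t" by (simp add: algebra_simps)
  also have "\<dots> < 0" using a t by (simp add: mult_neg_pos)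
  finally show False using assms[of t] t by simp
qed

context norm_on_line
begin

text \<open>Since \<open>h = m * Q\<close>, affinity of \<open>r / m\<close> reads
  \<open>h' / h = (\<alpha> t + \<beta>) / Q\<close>, and \<open>\<Phi> = h^2 / Q\<close> has
  derivative \<open>\<beta> h^2 / Q^2\<close>. For nonzero \<open>\<beta>\<close> it would be
  strictly monotone, whereas the growth of \<open>h\<close> like \<open>C |t|\<close> demands the
  value \<open>C^2 / \<alpha>\<close> at both ends. For \<open>\<beta> = 0\<close> it is
  constant.\<close>

lemma norm_quadratic:
  obtains \<alpha> where "\<And>t. (h t)\<^sup>2 = (h 0)\<^sup>2 * (1 + \<alpha> * t\<^sup>2)" "C\<^sup>2 = (h 0)\<^sup>2 * \<alpha>"
proof -
  obtain \<alpha> \<beta> where r: "\<And>t. t \<in> D \<Longrightarrow> r t = (\<alpha> * t + \<beta>) * m t" using slope_affine by blast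
  define Q where "Q = (\<lambda>t. 1 + \<beta> * t + \<alpha> * t\<^sup>2)"
  have Qcont: "isCont Q t" for t unfolding Q_def by (intro continuous_intros)
  have hQ: "h t = m t * Q t" if "t \<in> D" for t
    using h_eq[OF that] r[OF that] by (simp add: Q_def algebra_simps power2_eq_square)
  have QD: "Q t > 0" if "t \<in> D" for t
    using hQ[OF that] h_pos[of t] m_pos[OF that] by (metis zero_less_mult_pos)
  have rQ: "r t * Q t = (\<alpha> * t + \<beta>) * h t" if "t \<in> D" for t
    using hQ[OF that] r[OF that] by simp
  have "0 \<le> Q t" for t
    by (rule dense_le_everywhere[of "\<lambda>_. 0" Q]) (use Qcont QD less_imp_le in auto)
  \<comment> \<open>The bound on \<open>r\<close> passes to the limit in \<open>rQ\<close>, so at a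
    zero of \<open>Q\<close> also \<open>\<alpha> * t + \<beta>\<close> vanishes; but then
    \<open>Q t = 1 + t * (\<alpha> * t + \<beta>) = 1\<close>.\<close>
  moreover have "Q t \<noteq> 0" for t
  proof
    assume Q0: "Q t = 0"
    have "\<bar>(\<alpha> * s + \<beta>) * h s\<bar> \<le> C * Q s" for s
    proof (rule dense_le_everywhere[of "\<lambda>s. \<bar>(\<alpha> * s + \<beta>) * h s\<bar>" "\<lambda>s. C * Q s"])
      fix s assume s: "s \<in> D"
      have "\<bar>r s * Q s\<bar> \<le> C * Q s"
        using r_le[OF s] QD[OF s] by (simp add: abs_mult mult_right_mono)
      then show "\<bar>(\<alpha> * s + \<beta>) * h s\<bar> \<le> C * Q s" using rQ[OF s] by simp
    qed (intro continuous_intros h_cont Qcont)+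
    from this[of t] have "\<alpha> * t + \<beta> = 0" using Q0 h_pos[of t] by simp
    then have "t * (\<alpha> * t + \<beta>) = 0" by simp
    then show False using Q0 by (simp add: Q_def algebra_simps power2_eq_square)
  qed
  ultimately have Qpos: "Q t > 0" for t by (metis order_le_less)
  \<comment> \<open>A continuous extension of \<open>r\<close> to all parameters. The tangent
    inequality extends with it, so \<open>h\<close> turns out to be differentiable
    everywhere.\<close>
  define R where "R = (\<lambda>t. (\<alpha> * t + \<beta>) * h t / Q t)"
  have Rcont: "isCont R t" for t
    unfolding R_def using Qpos[of t] by (intro continuous_intros h_cont Qcont) auto
  have rR: "r t = R t" if "t \<in> D" for t
    using rQ[OF that] Qpos[of t] by (simp add: R_def field_simps)
  have sub: "h s \<ge> h t + R t * (s - t)" for s t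
  proof (rule dense_le_everywhere[of "\<lambda>t. h t + R t * (s - t)" "\<lambda>_. h s"])
    fix t assume t: "t \<in> D"
    show "h t + R t * (s - t) \<le> h s"
      using tangent[OF t, of s] h_eq[OF t] rR[OF t] by (simp add: algebra_simps)
  qed (intro continuous_intros h_cont Rcont)+
  have der: "(h has_real_derivative R t) (at t)" for t
    by (rule derivative_from_subgradient[OF sub Rcont])
  define \<Phi> where "\<Phi> = (\<lambda>t. (h t)\<^sup>2 / Q t)"
  have derPhi: "(\<Phi> has_real_derivative \<beta> * ((h t)\<^sup>2 / (Q t)\<^sup>2)) (at t)" for t
  proof -
    have "(Q has_real_derivative (\<beta> + 2 * \<alpha> * t)) (at t)"
      unfolding Q_def by (auto intro!: derivative_eq_intros)
    then have "(\<Phi> has_real_derivative ((2 * h t * R t) * Q t - (h t)\<^sup>2 * (\<beta> + 2 * \<alpha> * t)) / (Q t * Q t)) (at t)"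
      unfolding \<Phi>_def using Qpos[of t] by (auto intro!: derivative_eq_intros der)
    moreover have "R t * Q t = (\<alpha> * t + \<beta>) * h t" using Qpos[of t] by (simp add: R_def)
    then have "(2 * h t * R t) * Q t = 2 * h t * ((\<alpha> * t + \<beta>) * h t)" by (simp add: mult.assoc)
    then have "((2 * h t * R t) * Q t - (h t)\<^sup>2 * (\<beta> + 2 * \<alpha> * t)) = \<beta> * (h t)\<^sup>2"
      by (simp add: algebra_simps power2_eq_square)
    ultimately show ?thesis by (simp add: power2_eq_square)
  qed
  have hPhi: "(h t)\<^sup>2 = \<Phi> t * Q t" for t using Qpos[of t] by (simp add: \<Phi>_def)
  have lower: "C\<^sup>2 * t\<^sup>2 \<le> (h t)\<^sup>2" for t
    using power_mono[OF h_ge[of t], of 2] C_pos by (simp add: power_mult_distrib)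
  have upper: "(h t)\<^sup>2 \<le> (h 0 + C * \<bar>t\<bar>)\<^sup>2" for t
    using h_lipschitz[of t 0] h_pos[of t] by (intro power_mono) auto
  \<comment> \<open>The sign \<open>\<sigma>\<close> selects an end of the line. There
    \<open>C^2 t^2 \<le> h^2 \<le> A Q\<close>, and comparing leading coefficients replaces a limit
    at infinity.\<close>
  have le: "C\<^sup>2 \<le> A * \<alpha>" if A: "\<And>t. t > 0 \<Longrightarrow> \<Phi> (\<sigma> * t) \<le> A" and \<sigma>: "\<sigma>\<^sup>2 = 1" for A \<sigma>
  proof -
    have "(A * \<alpha> - C\<^sup>2) * t\<^sup>2 + (A * \<beta> * \<sigma>) * t + A \<ge> 0" if "t > 0" for t
    proof -
      have "C\<^sup>2 * (\<sigma> * t)\<^sup>2 \<le> A * Q (\<sigma> * t)"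
        using lower[of "\<sigma> * t"] hPhi[of "\<sigma> * t"]
          mult_right_mono[OF A[OF that] less_imp_le[OF Qpos[of "\<sigma> * t"]]] by linarith
      then show ?thesis using \<sigma> by (simp add: Q_def power_mult_distrib algebra_simps)
    qed
    from quadratic_nonneg_leading_coeff[OF this] show ?thesis by simp
  qed
  \<comment> \<open>The bound is asked for only beyond 1, hence the shift to \<open>t + 1\<close>.
    This admits \<open>A = \<Phi> (\<sigma> * 1)\<close>, a value strictly above
    \<open>\<Phi> 0\<close> in the monotone case.\<close>
  have ge: "C\<^sup>2 \<ge> A * \<alpha>" if A: "\<And>t. t > 1 \<Longrightarrow> \<Phi> (\<sigma> * t) \<ge> A" and \<sigma>: "\<sigma>\<^sup>2 = 1" for A \<sigma>
  proof -
    have s1: "\<bar>\<sigma>\<bar> = 1" using \<sigma> by (simp add: power2_eq_1_iff) auto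
    have "(C\<^sup>2 - A * \<alpha>) * t\<^sup>2 + (2 * (C\<^sup>2 - A * \<alpha>) + 2 * h 0 * C - A * \<beta> * \<sigma>) * t
        + ((C\<^sup>2 - A * \<alpha>) + 2 * h 0 * C - A * \<beta> * \<sigma> + (h 0)\<^sup>2 - A) \<ge> 0" if "t > 0" for t
    proof -
      have "A * Q (\<sigma> * (t + 1)) \<le> (h (\<sigma> * (t + 1)))\<^sup>2"
        unfolding hPhi using A[of "t + 1"] that Qpos[of "\<sigma> * (t + 1)"]
        by (intro mult_right_mono) auto
      also have "\<dots> \<le> (h 0 + C * (t + 1))\<^sup>2"
        using upper[of "\<sigma> * (t + 1)"] that s1 by (simp add: abs_mult)
      finally have "A * Q (\<sigma> * (t + 1)) \<le> (h 0 + C * (t + 1))\<^sup>2" .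
      moreover have "Q (\<sigma> * (t + 1)) = 1 + \<beta> * \<sigma> * (t + 1) + \<alpha> * (t + 1)\<^sup>2"
        using \<sigma> by (simp add: Q_def power_mult_distrib)
      ultimately show ?thesis by (simp add: algebra_simps power2_eq_square)
    qed
    from quadratic_nonneg_leading_coeff[OF this] show ?thesis by simp
  qed
  have alpha: "\<alpha> > 0"
  proof -
    have "\<alpha> \<ge> 0"
      by (rule quadratic_nonneg_leading_coeff[of \<alpha> \<beta> 1]) (use Qpos less_imp_le in \<open>auto simp: Q_def add_ac\<close>)
    moreover have "\<alpha> \<noteq> 0"
    proof
      assume a0: "\<alpha> = 0"
      have "\<beta> = 0"
      proof (rule ccontr)
        assume "\<beta> \<noteq> 0"
        then have "Q (- 1 / \<beta>) = 0" by (simp add: Q_def a0)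
        with Qpos[of "- 1 / \<beta>"] show False by simp
      qed
      then have "(\<Phi> has_real_derivative 0) (at t)" for t using derPhi[of t] by simp
      then have "\<Phi> t = \<Phi> 0" for t using DERIV_isconst_all by blast
      then have "C\<^sup>2 \<le> \<Phi> 0 * \<alpha>" by (intro le[of 1 "\<Phi> 0"] eq_refl) (assumption, simp)
      then show False using a0 C_pos by simp
    qed
    ultimately show ?thesis by simp
  qed
  have "\<beta> = 0"
  proof (rule ccontr)
    assume b: "\<beta> \<noteq> 0"
    \<comment> \<open>This orients the line so that \<open>\<Phi>\<close> increases. Its values
      before 0 yield \<open>C^2 \<le> \<Phi> 0 * \<alpha>\<close>, those beyond 1 yield
      \<open>C^2 \<ge> \<Phi> (\<sigma> * 1) * \<alpha>\<close>, and the two are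
      incompatible.\<close>
    define \<sigma> where "\<sigma> = sgn \<beta>"
    have s: "\<sigma>\<^sup>2 = 1" "\<sigma> \<noteq> 0" "\<beta> * \<sigma> > 0"
      using b by (auto simp: \<sigma>_def sgn_real_def)
    have "((\<lambda>t. \<Phi> (\<sigma> * t)) has_real_derivative \<beta> * ((h (\<sigma> * t))\<^sup>2 / (Q (\<sigma> * t))\<^sup>2) * \<sigma>) (at t)" for t
      by (rule DERIV_chain'[OF _ derPhi]) (auto intro!: derivative_eq_intros)
    moreover have "\<beta> * ((h (\<sigma> * t))\<^sup>2 / (Q (\<sigma> * t))\<^sup>2) * \<sigma> > 0" for t
    proof -
      have "(h (\<sigma> * t))\<^sup>2 / (Q (\<sigma> * t))\<^sup>2 > 0"
        using h_pos[of "\<sigma> * t"] Qpos[of "\<sigma> * t"] by (intro divide_pos_pos zero_less_power)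
      from mult_pos_pos[OF s(3) this] show ?thesis by (simp add: mult_ac)
    qed
    ultimately have incr: "\<Phi> (\<sigma> * s) < \<Phi> (\<sigma> * t)" if "s < t" for s t
      using DERIV_pos_imp_increasing[OF that, of "\<lambda>t. \<Phi> (\<sigma> * t)"] by blast
    have "C\<^sup>2 \<le> \<Phi> 0 * \<alpha>"
    proof (rule le[of "- \<sigma>"])
      show "\<Phi> (- \<sigma> * t) \<le> \<Phi> 0" if "t > 0" for t using incr[of "- t" 0] that by simp
    qed (use s in simp)
    moreover have "C\<^sup>2 \<ge> \<Phi> (\<sigma> * 1) * \<alpha>"
    proof (rule ge[of _ \<sigma>])
      show "\<Phi> (\<sigma> * 1) \<le> \<Phi> (\<sigma> * t)" if "t > 1" for t using incr[of 1 t] that by simp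
    qed (use s in simp)
    moreover have "\<Phi> 0 * \<alpha> < \<Phi> (\<sigma> * 1) * \<alpha>" using incr[of 0 1] alpha by simp
    ultimately show False by simp
  qed
  then have "(\<Phi> has_real_derivative 0) (at t)" for t using derPhi[of t] by simp
  then have const: "\<Phi> t = \<Phi> 0" for t using DERIV_isconst_all by blast
  have Phi0: "\<Phi> 0 = (h 0)\<^sup>2" by (simp add: \<Phi>_def Q_def)
  have "(h t)\<^sup>2 = (h 0)\<^sup>2 * (1 + \<alpha> * t\<^sup>2)" for t
    using hPhi[of t] const[of t] Phi0 \<open>\<beta> = 0\<close> by (simp add: Q_def)
  moreover have "C\<^sup>2 = (h 0)\<^sup>2 * \<alpha>"
  proof (rule antisym)
    show "C\<^sup>2 \<le> (h 0)\<^sup>2 * \<alpha>"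
      unfolding Phi0[symmetric] by (rule le[of 1]) (rule eq_refl[OF const], simp)
    show "(h 0)\<^sup>2 * \<alpha> \<le> C\<^sup>2"
      unfolding Phi0[symmetric] by (rule ge[of _ 1]) (rule eq_refl[OF const[symmetric]], simp)
  qed
  ultimately show thesis by (rule that)
qed

end

subsection \<open>Rigidity of the complete graph on four vertices\<close>

text \<open>The parallelograms have sides \<open>e + t y\<close> and \<open>s y\<close>, so the
  diagonals \<open>e + (t + s) y\<close> and \<open>e + (t - s) y\<close> lie on the same line. If
  all of them are flexible, \<open>norm_on_line\<close> applies to this line, and homogeneity
  carries the quadratic formula to the plane.\<close>

lemma grigid_K4:
  assumes plane: "normed_plane TYPE('a::real_normed_vector)"
    and noneuclid: "\<not> euclidean_norm TYPE('a)" and dist: "distinct [v, a, b, c]"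
  shows "grigid TYPE('a) {v, a, b, c} (K4_edges v a b c)"
proof (rule ccontr)
  assume flexible: "\<not> ?thesis"
  obtain y :: 'a where y: "nsmooth y" using exists_nsmooth[OF plane] .
  \<comment> \<open>As \<open>ngrad y\<close> vanishes on \<open>e\<close>, it takes the value
    \<open>t * norm y\<close> at \<open>e + t *\<^sub>R y\<close>. This bounds \<open>h t\<close>
    from below with the constant \<open>norm y\<close> that is also its Lipschitz constant. Moreover
    \<open>e\<close> becomes the kernel vector for the sides parallel to \<open>y\<close>.\<close>
  obtain e where e: "e \<noteq> 0" "ngrad y e = 0" using functional_kernel[OF plane nsmooth_linear[OF y]] .
  have "indep2 y e"
  proof (rule ccontr)
    assume "\<not> ?thesis"
    then obtain c where "y = c *\<^sub>R e" using not_indep2E e(1) by blast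
    then have "ngrad y y = 0" using e(2) nsmooth_linear[OF y] by (metis linear_scale scaleR_zero_right)
    then show False using ngrad_self[OF y] nsmooth_nonzero[OF y] by simp
  qed
  then have ind: "indep2 e y" using indep2_commute by blast
  define D where "D = {t. nsmooth (e + t *\<^sub>R y)}"
  define h where "h = (\<lambda>t. norm (e + t *\<^sub>R y))"
  define r where "r = (\<lambda>t. ngrad (e + t *\<^sub>R y) y)"
  define m where "m = (\<lambda>t. ngrad (e + t *\<^sub>R y) e)"
  have ngrad_lin: "ngrad (e + t *\<^sub>R y) (\<mu> *\<^sub>R e + \<nu> *\<^sub>R y) = \<mu> * m t + \<nu> * r t" if "t \<in> D" for t \<mu> \<nu>
    using nsmooth_linear[of "e + t *\<^sub>R y"] that by (simp add: D_def m_def r_def linear_add linear_scale)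
  interpret norm_on_line D h r m "norm y"
  proof
    have "- D = {t. \<not> nsmooth (e + t *\<^sub>R y)}" by (auto simp: D_def)
    then show "countable (- D)" using countable_not_nsmooth_line[OF plane y] by simp
    show "norm y > 0" using nsmooth_nonzero[OF y] by simp
    show "h t > 0" for t
      using indep2_nonzero[OF indep2_add_multiple[OF ind, of t]] by (simp add: h_def)
    show "norm y * \<bar>t\<bar> \<le> h t" for t
    proof -
      have "ngrad y (e + t *\<^sub>R y) = t * norm y"
        using e(2) ngrad_self[OF y] nsmooth_linear[OF y] by (simp add: linear_add linear_scale)
      then show ?thesis using ngrad_abs_le[OF y, of "e + t *\<^sub>R y"] by (simp add: h_def abs_mult mult.commute)
    qed
    show "\<bar>h t - h s\<bar> \<le> norm y * \<bar>t - s\<bar>" for t s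
    proof -
      have "\<bar>h t - h s\<bar> \<le> norm ((e + t *\<^sub>R y) - (e + s *\<^sub>R y))"
        unfolding h_def by (rule norm_triangle_ineq3)
      also have "(e + t *\<^sub>R y) - (e + s *\<^sub>R y) = (t - s) *\<^sub>R y" by (simp add: algebra_simps)
      finally show ?thesis by (simp add: mult.commute)
    qed
    show "h t = m t + t * r t" if "t \<in> D" for t
      using ngrad_self[of "e + t *\<^sub>R y"] ngrad_lin[OF that, of 1 t] that by (simp add: D_def h_def)
    show "m t + s * r t \<le> h s" if "t \<in> D" for t s
      using ngrad_le[of "e + t *\<^sub>R y" "e + s *\<^sub>R y"] ngrad_lin[OF that, of 1 s] that
      by (simp add: D_def h_def)
    show "\<bar>r t\<bar> \<le> norm y" if "t \<in> D" for t
      using ngrad_abs_le that by (simp add: D_def r_def)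
    show "2 * m (t + s) * m (t - s) * r t = m t * (r (t + s) * m (t - s) + r (t - s) * m (t + s))"
      if D: "t \<in> D" "t + s \<in> D" "t - s \<in> D" and s: "s \<noteq> 0" and mt: "m t \<noteq> 0" for t s
    proof (rule ccontr)
      assume neq: "\<not> ?thesis"
      define x where "x = e + t *\<^sub>R y"
      \<comment> \<open>A kernel vector of the functional at \<open>x\<close>, whose values on
        \<open>e\<close> and \<open>y\<close> are \<open>m t\<close> and \<open>r t\<close>.\<close>
      define kx where "kx = r t *\<^sub>R e + (- m t) *\<^sub>R y"
      have xp: "x + s *\<^sub>R y = e + (t + s) *\<^sub>R y" and xm: "x - s *\<^sub>R y = e + (t - s) *\<^sub>R y"
        by (simp_all add: x_def algebra_simps)
      have smx: "nsmooth x" "nsmooth (x + s *\<^sub>R y)" "nsmooth (x - s *\<^sub>R y)"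
        using D unfolding xp xm by (simp_all add: x_def D_def)
      have "grigid TYPE('a) {v, a, b, c} (K4_edges v a b c)"
      proof (rule parallelogram_rigid[OF plane dist smx(1) _ smx(2,3)])
        show sy: "nsmooth (s *\<^sub>R y)" using nsmooth_scale(1)[OF y s] .
        show "kx \<noteq> 0" using ind mt unfolding kx_def indep2_def by fastforce
        show "ngrad x kx = 0" unfolding x_def kx_def ngrad_lin[OF D(1)] by simp
        show "e \<noteq> 0" by (rule e(1))
        show "ngrad (s *\<^sub>R y) e = 0" using nsmooth_scale(2)[OF y s] e(2) by simp
        show "w = 0" if w: "ngrad x w = 0" "ngrad (s *\<^sub>R y) w = 0" for w
        proof -
          have "ngrad y w = 0" using w(2) nsmooth_scale(2)[OF y s] s by (simp add: sgn_zero_iff)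
          then obtain c where c: "w = c *\<^sub>R e" using ngrad_kernel_multiple[OF plane y e(2,1)] by blast
          then have "c * m t = 0" using w(1) ngrad_lin[OF D(1), of c 0] by (simp add: x_def)
          then show ?thesis using mt c by simp
        qed
        have "ngrad (x + s *\<^sub>R y) e = m (t + s)" "ngrad (x - s *\<^sub>R y) e = m (t - s)"
          unfolding xp xm by (simp_all add: m_def)
        moreover have "ngrad (x + s *\<^sub>R y) kx = r t * m (t + s) - m t * r (t + s)"
          "ngrad (x - s *\<^sub>R y) kx = r t * m (t - s) - m t * r (t - s)"
          unfolding xp xm kx_def ngrad_lin[OF D(2)] ngrad_lin[OF D(3)] by simp_all
        ultimately have "ngrad (x + s *\<^sub>R y) kx * ngrad (x - s *\<^sub>R y) e + ngrad (x + s *\<^sub>R y) e * ngrad (x - s *\<^sub>R y) kx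
          = 2 * m (t + s) * m (t - s) * r t - m t * (r (t + s) * m (t - s) + r (t - s) * m (t + s))"
          by (simp only:) (simp add: algebra_simps)
        then show "ngrad (x + s *\<^sub>R y) kx * ngrad (x - s *\<^sub>R y) e + ngrad (x + s *\<^sub>R y) e * ngrad (x - s *\<^sub>R y) kx \<noteq> 0"
          using neq by simp
      qed
      with flexible show False by blast
    qed
  qed
  \<comment> \<open>The equation \<open>ny\<close> fits the formula to the direction of
    \<open>y\<close>, which no point of the line represents.\<close>
  obtain \<alpha> where quad: "\<And>t. (h t)\<^sup>2 = (h 0)\<^sup>2 * (1 + \<alpha> * t\<^sup>2)" and ny: "(norm y)\<^sup>2 = (h 0)\<^sup>2 * \<alpha>"
    using norm_quadratic by metis
  have h0: "h 0 = norm e" by (simp add: h_def)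
  obtain A B where AB: "linear A" "linear B" and coord: "\<And>p. p = A p *\<^sub>R e + B p *\<^sub>R y"
    using plane_coordinate_functionals[OF plane ind] by metis
  have norm2: "(norm p)\<^sup>2 = (norm e)\<^sup>2 * (A p * A p) + (norm y)\<^sup>2 * (B p * B p)" for p
  proof (cases "A p = 0")
    case True
    then have "p = B p *\<^sub>R y" using coord[of p] by simp
    then have "norm p = \<bar>B p\<bar> * norm y" by (metis norm_scaleR)
    then show ?thesis using True by (simp add: power_mult_distrib power2_eq_square)
  next
    case False
    have "p = A p *\<^sub>R (e + (B p / A p) *\<^sub>R y)"
      using coord[of p] False by (simp add: scaleR_add_right)
    then have "norm p = \<bar>A p\<bar> * h (B p / A p)" unfolding h_def by (metis norm_scaleR)
    then have "(norm p)\<^sup>2 = (A p)\<^sup>2 * ((norm e)\<^sup>2 * (1 + \<alpha> * (B p / A p)\<^sup>2))"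
      using quad[of "B p / A p"] h0 by (simp add: power_mult_distrib)
    also have "\<dots> = (norm e)\<^sup>2 * (A p)\<^sup>2 + (norm e)\<^sup>2 * \<alpha> * (B p)\<^sup>2"
      using False by (simp add: field_simps)
    finally show ?thesis using ny h0 by (simp add: power2_eq_square)
  qed
  define F where "F = (\<lambda>p q. (norm e)\<^sup>2 * (A p * A q) + (norm y)\<^sup>2 * (B p * B q))"
  have "euclidean_norm TYPE('a)"
    unfolding euclidean_norm_def
  proof (intro exI[of _ F] conjI allI impI)
    show "linear (F x)" for x
      using AB by (intro linearI) (simp_all add: F_def linear_add linear_scale algebra_simps)
    show "linear (\<lambda>x. F x z)" for z
      using AB by (intro linearI) (simp_all add: F_def linear_add linear_scale algebra_simps)
    show "F x z = F z x" for x z by (simp add: F_def mult.commute)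
    have sq: "F x x = (norm x)\<^sup>2" for x unfolding F_def by (rule norm2[symmetric])
    show "F x x > 0" if "x \<noteq> 0" for x using that by (simp add: sq)
    show "norm x = sqrt (F x x)" for x by (simp add: sq)
  qed
  with noneuclid show False by blast
qed

subsection \<open>Sparse graphs\<close>

definition induced :: "'v set set \<Rightarrow> 'v set \<Rightarrow> 'v set set" where
  "induced E X = {e \<in> E. e \<subseteq> X}"

text \<open>The 2 accounts for the translations; it stands on the left because subtraction of
  naturals truncates.\<close>

definition sparse22 :: "'v set \<Rightarrow> 'v set set \<Rightarrow> bool" where
  "sparse22 V E \<longleftrightarrow> simple_graph V E \<and>
     (\<forall>X\<subseteq>V. X \<noteq> {} \<longrightarrow> card (induced E X) + 2 \<le> 2 * card X)"

definition tight22 :: "'v set set \<Rightarrow> 'v set \<Rightarrow> bool" where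
  "tight22 E X \<longleftrightarrow> card (induced E X) + 2 = 2 * card X"

lemma ex_max_card:
  assumes "P A" "\<And>B. P B \<Longrightarrow> card B \<le> n"
  shows "\<exists>X. P X \<and> (\<forall>Y. P Y \<longrightarrow> card Y \<le> card X)"
  using ex_has_greatest_nat[of P A card "Suc n"] assms by (simp add: less_Suc_eq_le)

lemma simple_graph_finite:
  assumes "simple_graph V E" shows "finite V" "finite E"
proof -
  show "finite V" using assms unfolding simple_graph_def by blast
  moreover have "E \<subseteq> Pow V"
  proof
    fix e assume "e \<in> E"
    then obtain x y where "e = {x, y}" "x \<in> V" "y \<in> V" using assms unfolding simple_graph_def by blast
    then show "e \<in> Pow V" by simp
  qed
  ultimately show "finite E" by (meson finite_Pow_iff finite_subset)
qed

lemma simple_graph_edgeE: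
  assumes "simple_graph V E" "e \<in> E"
  obtains x y where "e = {x, y}" "x \<noteq> y" "x \<in> V" "y \<in> V"
  using assms unfolding simple_graph_def by blast

lemma simple_graph_induced: "simple_graph V E \<Longrightarrow> X \<subseteq> V \<Longrightarrow> simple_graph X (induced E X)"
  unfolding simple_graph_def induced_def
  by (intro conjI ballI) (blast intro: finite_subset, metis insert_subset mem_Collect_eq)

lemma induced_whole: "simple_graph V E \<Longrightarrow> induced E V = E"
  unfolding induced_def by (blast elim: simple_graph_edgeE)

lemma finite_induced: "simple_graph V E \<Longrightarrow> finite (induced E X)"
  unfolding induced_def using simple_graph_finite by fastforce

lemma sparse22_simple: "sparse22 V E \<Longrightarrow> simple_graph V E"
  unfolding sparse22_def by blast

lemma sparse22_le:
  "sparse22 V E \<Longrightarrow> X \<subseteq> V \<Longrightarrow> X \<noteq> {} \<Longrightarrow> card (induced E X) + 2 \<le> 2 * card X"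
  unfolding sparse22_def by blast

lemma sparse22_induced:
  assumes "sparse22 V E" "X \<subseteq> V" shows "sparse22 X (induced E X)"
  unfolding sparse22_def
proof (intro conjI allI impI)
  show "simple_graph X (induced E X)"
    using simple_graph_induced sparse22_simple assms by blast
  fix Y assume Y: "Y \<subseteq> X" "Y \<noteq> {}"
  then have "induced (induced E X) Y = induced E Y" unfolding induced_def by blast
  then show "card (induced (induced E X) Y) + 2 \<le> 2 * card Y"
    using sparse22_le[OF assms(1), of Y] Y assms(2) by auto
qed

text \<open>The number of induced edges is supermodular in the vertex set, and the sparsity bound
  holds for the intersection because that is nonempty. This forces equality for the union.\<close>

lemma tight22_Un:
  assumes sparse: "sparse22 V E" and sub: "X \<subseteq> V" "Y \<subseteq> V" and meet: "X \<inter> Y \<noteq> {}"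
    and tight: "tight22 E X" "tight22 E Y"
  shows "tight22 E (X \<union> Y)"
proof -
  note graph = sparse22_simple[OF sparse]
  have fin: "finite X" "finite Y" using sub simple_graph_finite(1)[OF graph] finite_subset by auto
  have "card (induced E X) + card (induced E Y)
      = card (induced E X \<union> induced E Y) + card (induced E X \<inter> induced E Y)"
    by (rule card_Un_Int) (rule finite_induced[OF graph])+
  also have "card (induced E X \<union> induced E Y) \<le> card (induced E (X \<union> Y))"
    by (rule card_mono[OF finite_induced[OF graph]]) (auto simp: induced_def)
  also have "induced E X \<inter> induced E Y = induced E (X \<inter> Y)" by (auto simp: induced_def)
  finally have "card (induced E X) + card (induced E Y)
      \<le> card (induced E (X \<union> Y)) + card (induced E (X \<inter> Y))" by simp
  moreover have "card (induced E (X \<inter> Y)) + 2 \<le> 2 * card (X \<inter> Y)"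
    using sparse22_le[OF sparse, of "X \<inter> Y"] sub meet by auto
  moreover have "card (induced E (X \<union> Y)) + 2 \<le> 2 * card (X \<union> Y)"
    using sparse22_le[OF sparse, of "X \<union> Y"] sub meet by auto
  moreover have "card X + card Y = card (X \<union> Y) + card (X \<inter> Y)" by (rule card_Un_Int[OF fin])
  ultimately show ?thesis using tight unfolding tight22_def by simp
qed

section \<open>Reductions of tight graphs\<close>

lemma handshake:
  assumes "simple_graph V E"
  shows "(\<Sum>v\<in>V. card {e \<in> E. v \<in> e}) = 2 * card E"
proof -
  have "(\<Sum>v\<in>V. card {e \<in> E. v \<in> e}) = (\<Sum>e\<in>E. 2)"
  proof (rule sum_multicount_gen[OF simple_graph_finite[OF assms]], intro ballI)
    fix e assume "e \<in> E"
    then obtain x y where "e = {x, y}" "x \<noteq> y" "x \<in> V" "y \<in> V"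
      using simple_graph_edgeE[OF assms] by blast
    then have "{v \<in> V. v \<in> e} = {x, y}" "card {x, y} = 2" by auto
    then show "card {v \<in> V. v \<in> e} = 2" by simp
  qed
  then show ?thesis by simp
qed

text \<open>By \<open>few\<close> no parallel edges arise, so contraction loses no edge outside
  \<open>X\<close> and the count stays exact. A set through \<open>h\<close> is bounded by expanding
  \<open>h\<close> back to \<open>X\<close>, which adds exactly \<open>2 * card X - 2\<close>
  induced edges.\<close>

lemma collapse_tight:
  assumes sparse: "sparse22 V E" and tightV: "card E + 2 = 2 * card V"
    and X: "X \<subseteq> V" "tight22 E X" and h: "h \<in> X"
    and few: "\<And>w x y. w \<in> V - X \<Longrightarrow> x \<in> X \<Longrightarrow> y \<in> X \<Longrightarrow> {w, x} \<in> E \<Longrightarrow> {w, y} \<in> E \<Longrightarrow> x = y"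
  defines "V' \<equiv> insert h (V - X)"
    and "E' \<equiv> (\<lambda>e. collapse X h ` e) ` {e \<in> E. \<not> e \<subseteq> X}"
  shows "sparse22 V' E'" "card E' + 2 = 2 * card V'" "card V' + card X = card V + 1"
proof -
  let ?r = "collapse X h"
  note graph = sparse22_simple[OF sparse]
  note fin = simple_graph_finite[OF graph]
  have finX: "finite X" using X(1) fin(1) finite_subset by blast
  let ?O = "{e \<in> E. \<not> e \<subseteq> X}"
  have edge: "\<exists>x y. e = {x, y} \<and> x \<noteq> y \<and> x \<in> V \<and> y \<in> V - X" if e: "e \<in> ?O" for e
  proof -
    obtain x y where xy: "e = {x, y}" "x \<noteq> y" "x \<in> V" "y \<in> V"
      using simple_graph_edgeE[OF graph] e by blast
    then consider "y \<notin> X" | "x \<notin> X" using e by auto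
    then show ?thesis using xy by cases (blast, metis DiffI insert_commute)
  qed
  have inj: "inj_on (\<lambda>e. ?r ` e) ?O"
  proof (rule inj_onI)
    fix e1 e2 assume e: "e1 \<in> ?O" "e2 \<in> ?O" "?r ` e1 = ?r ` e2"
    obtain x y where 1: "e1 = {x, y}" "x \<noteq> y" "y \<in> V - X" using edge[OF e(1)] by blast
    obtain s t where 2: "e2 = {s, t}" "s \<noteq> t" "t \<in> V - X" using edge[OF e(2)] by blast
    have eq: "{?r x, y} = {?r s, t}" using e(3) 1 2 by (simp only: image_insert image_empty) (simp add: collapse_def)
    show "e1 = e2"
    proof (cases "x \<in> X")
      case True
      then have eq': "{h, y} = {?r s, t}" using eq by (simp add: collapse_def)
      have "h \<noteq> t" using h 2 by auto
      then have "?r s = h" "y = t" using eq' by (auto simp: doubleton_eq_iff)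
      then have "s \<in> X" using h by (auto simp: collapse_def split: if_splits)
      then have "x = s" using few[OF 1(3) True, of s] e 1 2 \<open>y = t\<close> by (simp add: insert_commute)
      then show ?thesis using 1 2 \<open>y = t\<close> by simp
    next
      case False
      then have eq': "{x, y} = {?r s, t}" using eq by (simp add: collapse_def)
      have "s \<notin> X"
      proof
        assume "s \<in> X"
        then have "h \<in> {x, y}" using eq' by (simp add: collapse_def)
        then show False using h False 1 by auto
      qed
      then show ?thesis using eq' 1 2 by (simp add: collapse_def)
    qed
  qed
  have partE: "card E = card ?O + card (induced E X)"
  proof -
    have "card (?O \<union> induced E X) = card ?O + card (induced E X)"
      by (rule card_Un_disjoint) (use fin finite_induced[OF graph] in \<open>auto simp: induced_def\<close>)
    moreover have "?O \<union> induced E X = E" by (auto simp: induced_def)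
    ultimately show ?thesis by simp
  qed
  have cardE': "card E' = card ?O" unfolding E'_def by (rule card_image[OF inj])
  have cardX: "card X \<le> card V" using card_mono[OF fin(1) X(1)] .
  show cardV': "card V' + card X = card V + 1"
  proof -
    have "card V' = card (V - X) + 1" unfolding V'_def using fin(1) h by simp
    then show ?thesis using card_Diff_subset[OF finX X(1)] cardX by simp
  qed
  show "card E' + 2 = 2 * card V'"
    using cardE' partE tightV X(2) cardV' unfolding tight22_def by linarith
  have simple': "simple_graph V' E'"
    unfolding simple_graph_def
  proof (intro conjI ballI)
    show "finite V'" unfolding V'_def using fin(1) by simp
    fix e' assume "e' \<in> E'"
    then obtain e where e: "e \<in> ?O" "e' = ?r ` e" unfolding E'_def by blast
    obtain x y where xy: "e = {x, y}" "x \<noteq> y" "x \<in> V" "y \<in> V - X" using edge[OF e(1)] by blast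
    have "e' = {?r x, ?r y}" using e(2) xy(1) by (simp only: image_insert image_empty)
    then have "e' = {?r x, y}" using xy(4) by (simp add: collapse_def)
    moreover have "?r x \<noteq> y" using xy h by (auto simp: collapse_def)
    moreover have "?r x \<in> V'" "y \<in> V'" using xy by (auto simp: collapse_def V'_def)
    ultimately show "\<exists>x y. e' = {x, y} \<and> x \<noteq> y \<and> x \<in> V' \<and> y \<in> V'" by blast
  qed
  have "card (induced E' Y) + 2 \<le> 2 * card Y" if Y: "Y \<subseteq> V'" "Y \<noteq> {}" for Y
  proof -
    define A where "A = {e \<in> ?O. ?r ` e \<subseteq> Y}"
    have finA: "finite A" using fin(2) by (simp add: A_def)
    have "induced E' Y \<subseteq> (\<lambda>e. ?r ` e) ` A" by (auto simp: induced_def E'_def A_def)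
    then have le: "card (induced E' Y) \<le> card A"
      using finA by (metis card_image_le card_mono finite_imageI le_trans)
    have finY: "finite Y" using Y(1) fin(1) finite_subset unfolding V'_def by blast
    show ?thesis
    proof (cases "h \<in> Y")
      case True
      define Z where "Z = (Y - {h}) \<union> X"
      have Z: "Z \<subseteq> V" "Z \<noteq> {}" using Y X(1) h unfolding Z_def V'_def by auto
      have "A \<union> induced E X \<subseteq> induced E Z"
      proof
        fix e assume "e \<in> A \<union> induced E X"
        then consider "e \<in> E" "?r ` e \<subseteq> Y" | "e \<in> E" "e \<subseteq> X" by (auto simp: A_def induced_def)
        then show "e \<in> induced E Z"
        proof cases
          case 1
          have "e \<subseteq> Z"
          proof
            fix x assume "x \<in> e"
            then have "?r x \<in> Y" using 1 by blast
            then show "x \<in> Z" using h by (cases "x \<in> X") (auto simp: collapse_def Z_def)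
          qed
          then show ?thesis using 1 by (simp add: induced_def)
        qed (auto simp: induced_def Z_def)
      qed
      then have "card (A \<union> induced E X) \<le> card (induced E Z)"
        by (rule card_mono[OF finite_induced[OF graph]])
      moreover have "card (A \<union> induced E X) = card A + card (induced E X)"
        using finA finite_induced[OF graph] by (intro card_Un_disjoint) (auto simp: A_def induced_def)
      moreover have "card (induced E Z) + 2 \<le> 2 * card Z" by (rule sparse22_le[OF sparse Z])
      moreover have "card Z = card Y - 1 + card X"
      proof -
        have "card Z = card (Y - {h}) + card X" unfolding Z_def
          using finY finX Y(1) by (intro card_Un_disjoint) (auto simp: V'_def)
        then show ?thesis using True finY by simp
      qed
      moreover have "card Y > 0" using Y(2) finY by (simp add: card_gt_0_iff)
      ultimately show ?thesis using le X(2) unfolding tight22_def by simp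
    next
      case False
      have "A \<subseteq> induced E Y"
      proof
        fix e assume e: "e \<in> A"
        have "e \<subseteq> Y"
        proof
          fix x assume "x \<in> e"
          then have "?r x \<in> Y" using e by (auto simp: A_def)
          then show "x \<in> Y" using False by (auto simp: collapse_def split: if_splits)
        qed
        then show "e \<in> induced E Y" using e by (simp add: A_def induced_def)
      qed
      then have "card A \<le> card (induced E Y)" by (rule card_mono[OF finite_induced[OF graph]])
      moreover have "Y \<subseteq> V" using Y(1) False unfolding V'_def by blast
      then have "card (induced E Y) + 2 \<le> 2 * card Y" using sparse22_le[OF sparse _ Y(2)] by blast
      ultimately show ?thesis using le by simp
    qed
  qed
  then show "sparse22 V' E'" using simple' unfolding sparse22_def by blast
qed

text \<open>No proper vertex set containing \<open>a\<close> and \<open>b\<close> is tight, so each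
  of them has room for one more edge.\<close>

lemma sparse22_1_reduction:
  assumes sparse: "sparse22 V E" and ab: "a \<in> V" "b \<in> V" "a \<noteq> b" "a \<noteq> v" "b \<noteq> v"
    and loose: "\<And>Y. Y \<subset> V \<Longrightarrow> card Y \<ge> 2 \<Longrightarrow> \<not> tight22 E Y" and v: "v \<in> V"
  shows "sparse22 (V - {v}) (insert {a, b} {e \<in> E. v \<notin> e})"
  unfolding sparse22_def
proof (intro conjI allI impI)
  note graph = sparse22_simple[OF sparse]
  let ?E = "insert {a, b} {e \<in> E. v \<notin> e}"
  show "simple_graph (V - {v}) ?E"
    unfolding simple_graph_def
  proof (intro conjI ballI)
    show "finite (V - {v})" using simple_graph_finite[OF graph] by simp
    fix e assume "e \<in> ?E"
    then consider "e = {a, b}" | "e \<in> E" "v \<notin> e" by blast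
    then show "\<exists>x y. e = {x, y} \<and> x \<noteq> y \<and> x \<in> V - {v} \<and> y \<in> V - {v}"
    proof cases
      case 1 then show ?thesis using ab by blast
    next
      case 2
      then obtain x y where "e = {x, y}" "x \<noteq> y" "x \<in> V" "y \<in> V"
        using simple_graph_edgeE[OF graph] by blast
      then show ?thesis using 2 by blast
    qed
  qed
  fix Y assume Y: "Y \<subseteq> V - {v}" "Y \<noteq> {}"
  then have YV: "Y \<subseteq> V" "Y \<subset> V" using v by auto
  have le: "card (induced E Y) + 2 \<le> 2 * card Y" by (rule sparse22_le[OF sparse YV(1) Y(2)])
  show "card (induced ?E Y) + 2 \<le> 2 * card Y"
  proof (cases "{a, b} \<subseteq> Y")
    case True
    have "finite Y" using YV(1) simple_graph_finite(1)[OF graph] finite_subset by blast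
    then have "card Y \<ge> 2" using card_mono[of Y "{a, b}"] True ab(3) by simp
    then have "card (induced E Y) + 2 \<noteq> 2 * card Y" using loose[OF YV(2)] unfolding tight22_def by blast
    moreover have "card (induced ?E Y) \<le> card (insert {a, b} (induced E Y))"
      by (rule card_mono) (use finite_induced[OF graph] in \<open>auto simp: induced_def\<close>)
    moreover have "card (insert {a, b} (induced E Y)) \<le> card (induced E Y) + 1"
      by (simp add: card_insert_if finite_induced[OF graph])
    ultimately show ?thesis using le by simp
  next
    case False
    then have "induced ?E Y \<subseteq> induced E Y" by (auto simp: induced_def)
    then have "card (induced ?E Y) \<le> card (induced E Y)" by (rule card_mono[OF finite_induced[OF graph]])
    then show ?thesis using le by simp
  qed
qed

text \<open>The degrees sum to \<open>4 * card V - 4\<close>, so some degree is at most 3. A degree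
  below 2 would leave too many edges on \<open>V - {v}\<close>, and degree 2 would make that set
  tight.\<close>

lemma sparse22_degree_3:
  assumes sparse: "sparse22 V E" and tight: "card E + 2 = 2 * card V"
    and loose: "\<And>Y. Y \<subset> V \<Longrightarrow> card Y \<ge> 2 \<Longrightarrow> \<not> tight22 E Y" and V2: "card V \<ge> 2"
  obtains v N where "v \<in> V" "N \<subseteq> V - {v}" "card N = 3" "{e \<in> E. v \<in> e} = (\<lambda>w. {v, w}) ` N"
proof -
  note graph = sparse22_simple[OF sparse]
  note fin = simple_graph_finite[OF graph]
  have "\<exists>v\<in>V. card {e \<in> E. v \<in> e} \<le> 3"
  proof (rule ccontr)
    assume "\<not> ?thesis"
    then have "(\<Sum>v\<in>V. 4) \<le> (\<Sum>v\<in>V. card {e \<in> E. v \<in> e})" by (intro sum_mono) force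
    then show False using handshake[OF graph] tight by simp
  qed
  then obtain v where v: "v \<in> V" "card {e \<in> E. v \<in> e} \<le> 3" by blast
  define N where "N = {w. {v, w} \<in> E}"
  have NV: "N \<subseteq> V - {v}" using simple_graph_edge[OF graph] unfolding N_def by blast
  have finN: "finite N" using NV fin(1) finite_subset by blast
  have star: "{e \<in> E. v \<in> e} = (\<lambda>w. {v, w}) ` N"
  proof (intro equalityI subsetI)
    fix e assume e: "e \<in> {e \<in> E. v \<in> e}"
    then obtain x y where "e = {x, y}" using simple_graph_edgeE[OF graph] by blast
    then show "e \<in> (\<lambda>w. {v, w}) ` N" using e by (auto simp: N_def insert_commute)
  qed (auto simp: N_def)
  have inj: "inj_on (\<lambda>w. {v, w}) N" by (auto simp: inj_on_def doubleton_eq_iff)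
  have deg: "card {e \<in> E. v \<in> e} = card N" unfolding star by (rule card_image[OF inj])
  have rest: "card (induced E (V - {v})) + card N = card E"
  proof -
    have "induced E (V - {v}) = E - {e \<in> E. v \<in> e}"
      using induced_whole[OF graph] by (auto simp: induced_def)
    moreover have "card (E - {e \<in> E. v \<in> e}) = card E - card {e \<in> E. v \<in> e}"
      using fin(2) by (intro card_Diff_subset) auto
    moreover have "card {e \<in> E. v \<in> e} \<le> card E" using fin(2) by (intro card_mono) auto
    ultimately show ?thesis using deg by simp
  qed
  have cardV: "card (V - {v}) + 1 = card V" using v(1) fin(1) V2 by simp
  then have ne: "V - {v} \<noteq> {}" using V2 by force
  have "card (induced E (V - {v})) + 2 \<le> 2 * card (V - {v})"
    using sparse22_le[OF sparse _ ne] by blast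
  then have N2: "card N \<ge> 2" using rest tight cardV by linarith
  \<comment> \<open>Two neighbours make \<open>V - {v}\<close> large enough for
    \<open>loose\<close>.\<close>
  have "card (V - {v}) \<ge> 2" using card_mono[OF _ NV] fin(1) N2 by simp
  then have "\<not> tight22 E (V - {v})" using loose v(1) by blast
  then have "card N \<noteq> 2" using rest tight cardV unfolding tight22_def by linarith
  then have "card N = 3" using N2 v(2) deg by linarith
  then show thesis using that v(1) NV star by blast
qed

text \<open>Without proper tight subgraphs, a pair of neighbours of a vertex of degree three is available
  for the new edge of a 1-reduction unless it is already an edge.\<close>

lemma tight_grigid:
  assumes plane: "normed_plane TYPE('a::real_normed_vector)"
    and noneuclid: "\<not> euclidean_norm TYPE('a)"
    and "sparse22 V E" "card E + 2 = 2 * card V"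
  shows "grigid TYPE('a) V E"
  using assms(3,4)
proof (induction "card V" arbitrary: V E rule: less_induct)
  case less
  note sparse = less.prems(1) and tight = less.prems(2)
  note graph = sparse22_simple[OF sparse]
  note fin = simple_graph_finite[OF graph]
  show ?case
  proof (cases "card V \<ge> 2")
    case False
    then have c: "card V = 1" "card E = 0" using tight by auto
    obtain v where "V = {v}" using c(1) by (rule card_1_singletonE)
    moreover have "E = {}" using c(2) fin(2) by simp
    ultimately show ?thesis by (simp add: grigid_single)
  next
    case V2: True
    show ?thesis
    proof (cases "\<exists>X. X \<subset> V \<and> card X \<ge> 2 \<and> tight22 E X")
      case True
      let ?P = "\<lambda>X. X \<subset> V \<and> card X \<ge> 2 \<and> tight22 E X"
      have "\<exists>X. ?P X \<and> (\<forall>Y. ?P Y \<longrightarrow> card Y \<le> card X)"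
        using True card_mono[OF fin(1)]
        by (elim exE, intro ex_max_card[of ?P _ "card V"]) auto
      then obtain X where X: "X \<subset> V" "card X \<ge> 2" "tight22 E X"
        and max: "\<And>Y. ?P Y \<Longrightarrow> card Y \<le> card X" by blast
      have XV: "X \<subseteq> V" using X(1) by blast
      have finX: "finite X" using XV fin(1) finite_subset by blast
      have cardX: "card X < card V" by (rule psubset_card_mono[OF fin(1) X(1)])
      have inner: "grigid TYPE('a) X (induced E X)"
        using less.hyps[OF cardX sparse22_induced[OF sparse XV]] X(3) unfolding tight22_def by blast
      have graphX: "simple_graph X (induced E X)" by (rule simple_graph_induced[OF graph XV])
      show ?thesis
      proof (cases "\<exists>w x y. w \<in> V - X \<and> x \<in> X \<and> y \<in> X \<and> {w, x} \<in> E \<and> {w, y} \<in> E \<and> x \<noteq> y")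
        case True
        then obtain w x y where wxy: "w \<in> V" "w \<notin> X" "x \<in> X" "y \<in> X" "{w, x} \<in> E" "{w, y} \<in> E" "x \<noteq> y"
          by blast
        \<comment> \<open>Two edges from \<open>w\<close> make \<open>insert w X\<close> tight, so
          by maximality of \<open>X\<close> it is all of \<open>V\<close>. The count leaves no
          further edge, and \<open>E\<close> is a 0-extension.\<close>
        define F where "F = insert {w, x} (insert {w, y} (induced E X))"
        have "{w, x} \<notin> insert {w, y} (induced E X)" "{w, y} \<notin> induced E X"
          using wxy by (auto simp: induced_def doubleton_eq_iff)
        then have cardF: "card F = card (induced E X) + 2"
          unfolding F_def using finite_induced[OF graph] by simp
        have FE: "F \<subseteq> induced E (insert w X)" using wxy by (auto simp: F_def induced_def)
        have wX: "insert w X \<subseteq> V" "card (insert w X) = card X + 1" using wxy XV finX by auto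
        have "card F \<le> card (induced E (insert w X))" by (rule card_mono[OF finite_induced[OF graph] FE])
        moreover have "card (induced E (insert w X)) + 2 \<le> 2 * card (insert w X)"
          by (rule sparse22_le[OF sparse wX(1)]) simp
        ultimately have tw: "tight22 E (insert w X)" "card F + 2 = 2 * card (insert w X)"
          using cardF X(3) wX(2) unfolding tight22_def by auto
        have V: "V = insert w X"
        proof (rule ccontr)
          assume "V \<noteq> insert w X"
          then have "card (insert w X) \<le> card X" using wX tw(1) X(2) by (intro max) auto
          then show False using wX(2) by simp
        qed
        have "F = E"
        proof (rule card_subset_eq[OF fin(2)])
          show "F \<subseteq> E" using FE by (auto simp: induced_def)
          show "card F = card E" using tw(2) tight V by simp
        qed
        moreover have "grigid TYPE('a) (insert w X) F" unfolding F_def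
          by (rule grigid_0_extension[OF plane graphX inner wxy(2,3,4,7)])
        ultimately show ?thesis using V by simp
      next
        case False
        obtain h where h: "h \<in> X" using X(2) by fastforce
        let ?V = "insert h (V - X)" and ?E = "(\<lambda>e. collapse X h ` e) ` {e \<in> E. \<not> e \<subseteq> X}"
        have few: "x = y" if "w \<in> V - X" "x \<in> X" "y \<in> X" "{w, x} \<in> E" "{w, y} \<in> E" for w x y
          using False that by blast
        have contr: "sparse22 ?V ?E" "card ?E + 2 = 2 * card ?V" "card ?V + card X = card V + 1"
          by (rule collapse_tight[OF sparse tight XV X(3) h], (rule few; assumption))+
        have "card ?V < card V" using contr(3) X(2) by simp
        then have "grigid TYPE('a) ?V ?E" using contr(1,2) less.hyps by blast
        then show ?thesis
          using grigid_substitution[OF plane graph h XV] inner unfolding induced_def by blast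
      qed
    next
      case False
      then have loose: "\<not> tight22 E Y" if "Y \<subset> V" "card Y \<ge> 2" for Y using that by blast
      obtain v N where v: "v \<in> V" and N: "N \<subseteq> V - {v}" "card N = 3"
        and star: "{e \<in> E. v \<in> e} = (\<lambda>w. {v, w}) ` N"
        using sparse22_degree_3[OF sparse tight loose V2] by blast
      let ?E0 = "{e \<in> E. v \<notin> e}"
      have reduce: "grigid TYPE('a) V E"
        if abc: "N = {a, b, c}" "a \<noteq> b" "a \<noteq> c" "b \<noteq> c" and ab: "{a, b} \<notin> E" for a b c
      proof -
        have mem: "a \<in> V - {v}" "b \<in> V - {v}" "c \<in> V - {v}" using N(1) abc(1) by auto
        have E: "E = insert {v, a} (insert {v, b} (insert {v, c} ?E0))"
        proof -
          have "E = {e \<in> E. v \<in> e} \<union> ?E0" by blast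
          also have "{e \<in> E. v \<in> e} = {{v, a}, {v, b}, {v, c}}" unfolding star abc(1) by simp
          finally show ?thesis by simp
        qed
        have new: "{v, a} \<notin> insert {v, b} (insert {v, c} ?E0)" "{v, b} \<notin> insert {v, c} ?E0" "{v, c} \<notin> ?E0"
          using abc by (auto simp: doubleton_eq_iff)
        have "card (insert {v, a} (insert {v, b} (insert {v, c} ?E0))) = card ?E0 + 3"
          using new fin(2) by simp
        then have cardE: "card E = card ?E0 + 3" using E by simp
        have cardV: "card (V - {v}) + 1 = card V" using v fin(1) V2 by simp
        have "sparse22 (V - {v}) (insert {a, b} ?E0)"
          using mem abc by (intro sparse22_1_reduction[OF sparse _ _ _ _ _ loose v]) auto
        moreover have "card (insert {a, b} ?E0) + 2 = 2 * card (V - {v})"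
          using ab fin(2) cardE cardV tight by simp
        ultimately have "grigid TYPE('a) (V - {v}) (insert {a, b} ?E0)"
          using less.hyps cardV by simp
        moreover have "simple_graph (V - {v}) ?E0"
          using \<open>sparse22 (V - {v}) (insert {a, b} ?E0)\<close>[THEN sparse22_simple]
          by (rule simple_graph_mono) blast
        ultimately have "grigid TYPE('a) (insert v (V - {v})) (insert {v, a} (insert {v, b} (insert {v, c} ?E0)))"
          using mem abc by (intro grigid_1_extension[OF plane]) auto
        then show ?thesis using E v by (simp add: insert_absorb)
      qed
      obtain a b c where abc: "N = {a, b, c}" "a \<noteq> b" "a \<noteq> c" "b \<noteq> c"
        using N(2) by (auto simp: card_3_iff)
      consider "{a, b} \<notin> E" | "{a, c} \<notin> E" | "{b, c} \<notin> E" | "{a, b} \<in> E" "{a, c} \<in> E" "{b, c} \<in> E"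
        by blast
      then show ?thesis
      proof cases
        case 1 then show ?thesis using reduce[of a b c] abc by blast
      next
        case 2 then show ?thesis using reduce[of a c b] abc by (simp add: insert_commute)
      next
        case 3 then show ?thesis using reduce[of b c a] abc by (simp add: insert_commute)
      next
        case 4
        have dist: "distinct [v, a, b, c]" using abc N(1) by auto
        let ?X = "{v, a, b, c}"
        have cX: "card ?X = 4" using dist by simp
        have XV: "?X \<subseteq> V" using abc(1) N(1) v by auto
        have "(\<lambda>w. {v, w}) ` N \<subseteq> E" using star by blast
        then have KE: "K4_edges v a b c \<subseteq> induced E ?X"
          using 4 abc(1) unfolding K4_edges_def induced_def by auto
        have cK: "card (K4_edges v a b c) = 6"
          using dist unfolding K4_edges_def by (simp add: doubleton_eq_iff)
        have "card (K4_edges v a b c) \<le> card (induced E ?X)"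
          by (rule card_mono[OF finite_induced[OF graph] KE])
        moreover have "card (induced E ?X) + 2 \<le> 2 * card ?X"
          by (rule sparse22_le[OF sparse XV]) simp
        \<comment> \<open>Six edges on four vertices reach the sparsity bound, so
          \<open>loose\<close> leaves no room for further vertices.\<close>
        ultimately have "tight22 E ?X" using cK cX unfolding tight22_def by linarith
        then have V: "V = ?X" using loose[of ?X] XV cX by auto
        have "K4_edges v a b c = E"
        proof (rule card_subset_eq[OF fin(2)])
          show "K4_edges v a b c \<subseteq> E" using KE by (auto simp: induced_def)
          show "card (K4_edges v a b c) = card E" using cK tight V cX by simp
        qed
        then show ?thesis using grigid_K4[OF plane noneuclid dist] V by simp
      qed
    qed
  qed
qed

subsection \<open>Four-edge-connected graphs\<close>

text \<open>Deleting fewer than \<open>k\<close> boundary edges would confine every path that starts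
  in \<open>X\<close> to \<open>X\<close>.\<close>

lemma edge_connected_boundary:
  assumes conn: "k_edge_connected k V E" and X: "X \<subseteq> V" "X \<noteq> {}" "X \<noteq> V"
  shows "card {e \<in> E. e \<inter> X \<noteq> {} \<and> \<not> e \<subseteq> X} \<ge> k"
proof (rule ccontr)
  let ?B = "{e \<in> E. e \<inter> X \<noteq> {} \<and> \<not> e \<subseteq> X}"
  assume "\<not> ?thesis"
  then have "graph_connected V (E - ?B)" using conn unfolding k_edge_connected_def by auto
  moreover obtain x y where xy: "x \<in> X" "y \<in> V" "y \<notin> X" using X by blast
  ultimately have "(\<lambda>a b. {a, b} \<in> E - ?B)\<^sup>*\<^sup>* x y" using X(1) unfolding graph_connected_def by blast
  then have "y \<in> X" by (induction rule: rtranclp_induct) (use xy in auto)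
  with xy show False by blast
qed

lemma four_edge_connected_tight:
  assumes graph: "simple_graph V E" and conn: "k_edge_connected 4 V E"
  obtains F where "F \<subseteq> E" "sparse22 V F" "card F + 2 = 2 * card V"
proof -
  note fin = simple_graph_finite[OF graph]
  have V: "V \<noteq> {}" using conn unfolding k_edge_connected_def graph_connected_def
    by (metis card.empty empty_subsetI zero_less_numeral)
  have "sparse22 V {}" unfolding sparse22_def
  proof (intro conjI allI impI)
    show "simple_graph V {}" using fin(1) by (simp add: simple_graph_def)
    fix X assume "X \<subseteq> V" "X \<noteq> {}"
    then have "card X > 0" using fin(1) finite_subset card_gt_0_iff by blast
    then show "card (induced {} X) + 2 \<le> 2 * card X" by (simp add: induced_def)
  qed
  let ?P = "\<lambda>F. F \<subseteq> E \<and> sparse22 V F"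
  have "\<exists>F. ?P F \<and> (\<forall>G. ?P G \<longrightarrow> card G \<le> card F)"
    using \<open>sparse22 V {}\<close> card_mono[OF fin(2)] by (intro ex_max_card[of ?P "{}" "card E"]) auto
  then obtain F where F: "F \<subseteq> E" "sparse22 V F" and max: "\<And>G. ?P G \<Longrightarrow> card G \<le> card F" by blast
  note graphF = sparse22_simple[OF F(2)]
  have finF: "finite F" using F(1) fin(2) finite_subset by blast
  let ?T = "\<lambda>v X. X \<subseteq> V \<and> v \<in> X \<and> tight22 F X"
  have "\<exists>X. ?T v X \<and> (\<forall>Y. ?T v Y \<longrightarrow> card Y \<le> card X)" if v: "v \<in> V" for v
  proof -
    \<comment> \<open>Singletons are tight, so every vertex lies in some largest tight set.\<close>
    have "induced F {v} = {}"
    proof (rule equals0I)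
      fix e assume e: "e \<in> induced F {v}"
      then have "e \<in> F" by (simp add: induced_def)
      then obtain x y where "e = {x, y}" "x \<noteq> y" by (rule simple_graph_edgeE[OF graphF])
      then show False using e by (auto simp: induced_def)
    qed
    then have "?T v {v}" using v by (simp add: tight22_def)
    then show ?thesis
      using card_mono[OF fin(1)] by (intro ex_max_card[of "?T v" "{v}" "card V"]) auto
  qed
  then obtain B where B: "\<And>v. v \<in> V \<Longrightarrow> ?T v (B v)"
    and Bmax: "\<And>v Y. v \<in> V \<Longrightarrow> ?T v Y \<Longrightarrow> card Y \<le> card (B v)" by metis
  have finB: "finite (B v)" if "v \<in> V" for v using B[OF that] fin(1) finite_subset by blast
  \<comment> \<open>Overlapping tight sets merge, so a largest one swallows every tight set that it
    meets.\<close>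
  have absorb: "Y \<subseteq> B v" if v: "v \<in> V" and Y: "Y \<subseteq> V" "tight22 F Y" "Y \<inter> B v \<noteq> {}" for v Y
  proof -
    have "tight22 F (Y \<union> B v)" by (rule tight22_Un[OF F(2) Y(1) _ Y(3,2)]) (use B[OF v] in auto)
    then have "card (Y \<union> B v) \<le> card (B v)" using B[OF v] Y(1) by (intro Bmax[OF v]) auto
    moreover have "finite (Y \<union> B v)" using Y(1) finB[OF v] fin(1) finite_subset by blast
    ultimately have "B v = Y \<union> B v" by (intro card_seteq) auto
    then show ?thesis by blast
  qed
  have eqB: "B v = B w" if "v \<in> V" "w \<in> V" "B v \<inter> B w \<noteq> {}" for v w
    using absorb[of v "B w"] absorb[of w "B v"] B that by blast
  define \<P> where "\<P> = B ` V"
  have finP: "finite \<P>" unfolding \<P>_def using fin(1) by simp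
  define C where "C = {e \<in> E. \<forall>P\<in>\<P>. \<not> e \<subseteq> P}"
  have finC: "finite C" unfolding C_def using fin(2) by simp
  have CF: "C \<subseteq> F"
  proof
    fix e assume e: "e \<in> C"
    show "e \<in> F"
    proof (rule ccontr)
      assume nF: "e \<notin> F"
      have eE: "e \<in> E" using e by (simp add: C_def)
      obtain x y where xy: "e = {x, y}" "x \<in> V" "y \<in> V" using simple_graph_edgeE[OF graph eE] by blast
      \<comment> \<open>By maximality of \<open>F\<close>, a rejected edge violates sparsity on some
        \<open>X\<close> that contains it. As \<open>F\<close> itself is sparse, \<open>X\<close> is
        tight in \<open>F\<close> and lies in a block, so the edge does not run between
        blocks.\<close>
      have "\<not> sparse22 V (insert e F)"
      proof
        assume "sparse22 V (insert e F)"
        then have "card (insert e F) \<le> card F" using F(1) eE by (intro max) auto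
        then show False using nF finF by simp
      qed
      moreover have "simple_graph V (insert e F)"
        by (rule simple_graph_mono[OF graph]) (use F(1) eE in blast)
      ultimately obtain X where X: "X \<subseteq> V" "X \<noteq> {}" "\<not> card (induced (insert e F) X) + 2 \<le> 2 * card X"
        unfolding sparse22_def by blast
      have le: "card (induced F X) + 2 \<le> 2 * card X" by (rule sparse22_le[OF F(2) X(1,2)])
      have eX: "e \<subseteq> X"
      proof (rule ccontr)
        assume "\<not> e \<subseteq> X"
        then have "induced (insert e F) X = induced F X" by (auto simp: induced_def)
        then show False using X(3) le by simp
      qed
      then have "induced (insert e F) X = insert e (induced F X)" by (auto simp: induced_def)
      then have "card (induced (insert e F) X) \<le> card (induced F X) + 1"
        using finite_induced[OF graphF] by (simp add: card_insert_if)
      then have "tight22 F X" using X(3) le unfolding tight22_def by linarith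
      then have "X \<subseteq> B x" using absorb[OF xy(2) X(1)] B[OF xy(2)] eX xy(1) by blast
      then show False using e eX xy(2) unfolding C_def \<P>_def by blast
    qed
  qed
  have disj: "P = Q" if "P \<in> \<P>" "Q \<in> \<P>" "P \<inter> Q \<noteq> {}" for P Q
    using that eqB unfolding \<P>_def by blast
  have tightP: "tight22 F P" "P \<subseteq> V" "P \<noteq> {}" if "P \<in> \<P>" for P
    using that B unfolding \<P>_def by auto
  have UP: "\<Union>\<P> = V" using B unfolding \<P>_def by blast
  have finPP: "finite P" if "P \<in> \<P>" for P using that finB unfolding \<P>_def by blast
  have cardV: "card V = (\<Sum>P\<in>\<P>. card P)"
    unfolding UP[symmetric]
    by (rule card_Union_disjoint) (use disj finPP in \<open>auto simp: pairwise_def disjnt_def\<close>)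
  have cardF: "card F = card C + (\<Sum>P\<in>\<P>. card (induced F P))"
  proof -
    have "card (\<Union>P\<in>\<P>. induced F P) = (\<Sum>P\<in>\<P>. card (induced F P))"
    proof (rule card_UN_disjoint[OF finP])
      show "\<forall>P\<in>\<P>. finite (induced F P)" using finite_induced[OF graphF] by blast
      show "\<forall>P\<in>\<P>. \<forall>Q\<in>\<P>. P \<noteq> Q \<longrightarrow> induced F P \<inter> induced F Q = {}"
      proof (intro ballI impI equals0I)
        fix P Q e assume PQ: "P \<in> \<P>" "Q \<in> \<P>" "P \<noteq> Q" and e: "e \<in> induced F P \<inter> induced F Q"
        then have "e \<in> F" by (simp add: induced_def)
        then obtain x y where "e = {x, y}" by (rule simple_graph_edgeE[OF graphF])
        then have "x \<in> P \<inter> Q" using e by (auto simp: induced_def)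
        then show False using disj[OF PQ(1,2)] PQ(3) by blast
      qed
    qed
    moreover have "card (C \<union> (\<Union>P\<in>\<P>. induced F P)) = card C + card (\<Union>P\<in>\<P>. induced F P)"
      using finC finP finite_induced[OF graphF]
      by (intro card_Un_disjoint) (auto simp: C_def induced_def)
    moreover have "C \<union> (\<Union>P\<in>\<P>. induced F P) = F"
      using CF F(1) by (auto simp: C_def induced_def)
    ultimately show ?thesis by simp
  qed
  \<comment> \<open>Each block \<open>P\<close> carries \<open>2 * card P - 2\<close> edges of
    \<open>F\<close>, and the blocks partition \<open>V\<close>.\<close>
  have count: "card F + 2 * card \<P> = card C + 2 * card V"
  proof -
    have "(\<Sum>P\<in>\<P>. card (induced F P)) + 2 * card \<P> = (\<Sum>P\<in>\<P>. card (induced F P) + 2)"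
      unfolding sum.distrib by simp
    also have "\<dots> = (\<Sum>P\<in>\<P>. 2 * card P)"
      using tightP(1) by (intro sum.cong) (auto simp: tight22_def)
    also have "\<dots> = 2 * card V" unfolding cardV by (simp add: sum_distrib_left)
    finally show ?thesis using cardF by simp
  qed
  have "\<P> = {V}"
  proof (rule ccontr)
    assume nV: "\<P> \<noteq> {V}"
    have proper: "P \<noteq> V" if P: "P \<in> \<P>" for P
    proof
      assume "P = V"
      then have "Q = V" if "Q \<in> \<P>" for Q
        using disj[OF that P] tightP(2,3)[OF that] by blast
      then show False using nV P \<open>P = V\<close> by blast
    qed
    \<comment> \<open>Every block has at least four boundary edges and every edge of
      \<open>C\<close> belongs to two blocks, so \<open>card C \<ge> 2 * card \<P>\<close>. By
      \<open>count\<close> this makes \<open>card F\<close> at least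
      \<open>2 * card V\<close>.\<close>
    have "(\<Sum>P\<in>\<P>. 4) \<le> (\<Sum>P\<in>\<P>. card {e \<in> C. e \<inter> P \<noteq> {}})"
    proof (rule sum_mono)
      fix P assume P: "P \<in> \<P>"
      have "{e \<in> E. e \<inter> P \<noteq> {} \<and> \<not> e \<subseteq> P} \<subseteq> {e \<in> C. e \<inter> P \<noteq> {}}"
      proof
        fix e assume e: "e \<in> {e \<in> E. e \<inter> P \<noteq> {} \<and> \<not> e \<subseteq> P}"
        have "\<not> e \<subseteq> Q" if "Q \<in> \<P>" for Q
          using disj[OF P that] e by blast
        then show "e \<in> {e \<in> C. e \<inter> P \<noteq> {}}" using e by (auto simp: C_def)
      qed
      then have "card {e \<in> E. e \<inter> P \<noteq> {} \<and> \<not> e \<subseteq> P} \<le> card {e \<in> C. e \<inter> P \<noteq> {}}"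
        using finC by (intro card_mono) auto
      then show "4 \<le> card {e \<in> C. e \<inter> P \<noteq> {}}"
        using edge_connected_boundary[OF conn tightP(2,3)[OF P] proper[OF P]] by linarith
    qed
    also have "(\<Sum>P\<in>\<P>. card {e \<in> C. e \<inter> P \<noteq> {}}) = (\<Sum>e\<in>C. 2)"
    proof (rule sum_multicount_gen[OF finP finC], intro ballI)
      fix e assume e: "e \<in> C"
      then have "e \<in> E" by (simp add: C_def)
      then obtain x y where xy: "e = {x, y}" "x \<in> V" "y \<in> V" by (rule simple_graph_edgeE[OF graph])
      have mem: "x \<in> B x" "y \<in> B y" "B x \<in> \<P>" "B y \<in> \<P>" using B xy(2,3) by (auto simp: \<P>_def)
      have "{P \<in> \<P>. e \<inter> P \<noteq> {}} = {B x, B y}"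
      proof (intro equalityI subsetI)
        fix P assume P: "P \<in> {P \<in> \<P>. e \<inter> P \<noteq> {}}"
        then have "x \<in> P \<or> y \<in> P" using xy(1) by auto
        then show "P \<in> {B x, B y}" using disj[of P "B x"] disj[of P "B y"] P mem by blast
      qed (use mem xy(1) in auto)
      moreover have "B x \<noteq> B y"
      proof
        assume "B x = B y"
        then have "e \<subseteq> B x" using mem xy(1) by auto
        then show False using e mem(3) unfolding C_def by blast
      qed
      ultimately show "card {P \<in> \<P>. e \<inter> P \<noteq> {}} = 2" by simp
    qed
    finally have "2 * card \<P> \<le> card C" by simp
    moreover have "card F + 2 \<le> 2 * card V"
      using sparse22_le[OF F(2) order.refl V] induced_whole[OF graphF] by simp
    ultimately show False using count by linarith
  qed
  then have "tight22 F V" using tightP(1) by blast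
  then have "card F + 2 = 2 * card V" using induced_whole[OF graphF] by (simp add: tight22_def)
  then show thesis using that F by blast
qed

lemma grigid_add_edges:
  assumes plane: "normed_plane TYPE('a::real_normed_vector)" and graph: "simple_graph V E"
    and FE: "F \<subseteq> E" and rig: "grigid TYPE('a) V F"
  shows "grigid TYPE('a) V E"
proof -
  have "grigid TYPE('a) V (F \<union> S)" if "finite S" "S \<subseteq> E" for S
    using that
  proof (induction S rule: finite_induct)
    case (insert e S)
    then have "e \<in> E" by simp
    then obtain a b where e: "e = {a, b}" "a \<noteq> b" by (rule simple_graph_edgeE[OF graph])
    have "simple_graph V (F \<union> S)" by (rule simple_graph_mono[OF graph]) (use insert FE in blast)
    then have "grigid TYPE('a) V (insert {a, b} (F \<union> S))"
      using insert e(2) by (intro grigid_add_edge[OF plane]) auto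
    then show ?case using e by simp
  qed (simp add: rig)
  from this[OF simple_graph_finite(2)[OF graph] order.refl] show ?thesis
    using FE by (simp add: Un_absorb1)
qed

theorem mainTheorem8:
  fixes V :: "'v set" and E :: "'v set set"
  assumes "normed_plane TYPE('a::real_normed_vector)"
    and "\<not> euclidean_norm TYPE('a)"
    and "simple_graph V E"
    and "k_edge_connected 4 V E"
  shows "rigid_in TYPE('a) V E"
proof -
  obtain F where "F \<subseteq> E" "sparse22 V F" "card F + 2 = 2 * card V"
    using four_edge_connected_tight[OF assms(3,4)] .
  then have "grigid TYPE('a) V E"
    using tight_grigid[OF assms(1,2)] grigid_add_edges[OF assms(1,3)] by blast
  then show ?thesis by (rule grigid_rigid_in)
qed

end
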